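(* Let $N\in\mathbb{N}$, let $k\in -2\mathbb{N}$ (so $k\le -2$ is even) and let $m\in\mathbb{N}$. Let $H_{k,m}:=H_{k,m}^++H_{k,m}^-$, where $H_{k,m}^\pm$ are the functions defined in the context below. Then $H_{k,m}(\tau)$ converges for all $\tau\in\mathbb{H}\cup(-\mathbb{H})$. Furthermore, if $\tau\in\mathbb{H}$ then $$H_{k,m}(\tau)=F_{k,-m}(\tau),$$ and if $\tau\in-\mathbb{H}$ then $$H_{k,m}(\tau)=m^{1-k}\left(\mathcal{E}_{P_{2-k,m}}(-\tau)-\frac{(4\pi)^{1-k}}{(-k)!}\,P^{*}_{2-k,-m}(-\tau)\right).$$
   Context: Notation: $\mathbb{H}$ is the upper half-plane, $-\mathbb{H}$ the lower half-plane; $\tau=u+iv$, $q:=e^{2\pi i\tau}$, $e(x):=e^{2\pi i x}$, $\zeta_c^{b}:=e^{2\pi i b/c}$. For $c\in\mathbb{N}$, $\sum_{d \pmod c^*}$ runs over residues $d$ modulo $c$ with $\gcd(d,c)=1$, and $\bar d$ denotes the inverse of $d$ modulo $c$. The Kloosterman sum is $K(a,b;c):=\sum_{d\pmod c^*}e\left(\frac{a\bar d+bd}{c}\right)$. Sums $\sum_{c>0,\,N\mid c}$ run over positive multiples of $N$. Incomplete gamma function: $\Gamma(s,y):=\int_y^\infty t^{s-1}e^{-t}\,dt$ for $y>0$; for a positive integer $s$ it is extended to all real $y$ by $\Gamma(s,y)=(s-1)!\,e^{-y}\sum_{j=0}^{s-1}y^j/j!$. Normalized: $\Gamma^*(s,y):=\Gamma(s,y)/\Gamma(s)$.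 Polylogarithm: $\mathrm{Li}_s(w):=\sum_{n\ge1}w^n/n^s$ for $|w|<1$; for $s$ a negative integer, $\mathrm{Li}_s$ is a rational function of $w$ (namely $\mathrm{Li}_{-n}(w)=(w\frac{d}{dw})^n\frac{w}{1-w}$) and is understood as such for all $w\neq1$. Modular objects on $\Gamma_0(N)$: for $\gamma=\begin{pmatrix}a&b\\c&d\end{pmatrix}$, $(\varphi|_\kappa\gamma)(\tau):=(c\tau+d)^{-\kappa}\varphi\left(\frac{a\tau+b}{c\tau+d}\right)$, and $\Gamma_\infty:=\{\pm\begin{pmatrix}1&n\\0&1\end{pmatrix}:n\in\mathbb{Z}\}$. For even $\kappa>2$ and $\ell\in\mathbb{Z}\setminus\{0\}$, the Poincaré series is $P_{\kappa,\ell}(\tau):=\sum_{\gamma\in\Gamma_\infty\backslash\Gamma_0(N)}(q^\ell)|_\kappa\gamma$; its Fourier expansion at $i\infty$ has the form $\sum_n c(n)q^n$ with zero constant term (for $\ell>0$ it is a cusp form; for $\ell<0$ a weakly holomorphic form $q^{\ell}+\sum_{n\ge1}c(n)q^n$). For $f(\tau)=\sum_n c_f(n)q^n$ of weight $\kappa$ with $c_f(0)=0$, define the Eichler integral $\mathcal{E}_f(\tau):=\sum_{n\ne0}\frac{c_f(n)}{n^{\kappa-1}}q^n$ and the non-holomorphic Eichler integral $f^*(\tau):=-(4\pi)^{1-\kappa}\sum_{n\ne0}\frac{\overline{c_f(n)}}{n^{\kappa-1}}\Gamma(\kappa-1,4\pi nv)q^{-n}$. These are applied with $\kappa=2-k$.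 The Maass–Poincaré series is $F_{k,-m}(\tau):=\sum_{\gamma\in\Gamma_\infty\backslash\Gamma_0(N)}\phi|_k\gamma(\tau)$ with seed $\phi(\tau):=\bigl(1-\Gamma^*(1-k,4\pi m v)\bigr)q^{-m}$ (a harmonic Maass form of weight $k$). Auxiliary series: for $c\in\mathbb{N}$, $\alpha^+_{m,c}(s):=\sum_{j\ge0}\frac{1}{(j+1-k)!}\left(\frac{2\pi\sqrt m}{c}\right)^{2j+1-k}s^{-j-1}$ and $\alpha^-_{m,c}(s):=\sum_{j\ge0}\frac{(-1)^j}{(j+1-k)!}\left(\frac{2\pi\sqrt m}{c}\right)^{2j+1-k}s^{-j-1}$. For $\tau\in\mathbb{H}\cup(-\mathbb{H})$ and $\gcd(c,d)=1$ set $\phi^+_{k,m}(c,d;\tau):=\frac{1}{2\pi i}\int_{|s|=r}\frac{\alpha^+_{m,c}(s)e^s}{1-e^s\zeta_c^dq}\,ds$, $\phi^-_{k,m}(c,d;\tau):=\frac{1}{2\pi i}\int_1^\infty t^{-k}\int_{|s|=r}\alpha^-_{m,c}(s)\,\mathrm{Li}_{k-1}\!\left(e^{s-4\pi vt}\zeta_c^{-d}q^{-1}\right)ds\,dt$, where $r=r(\tau)>0$ is taken sufficiently small (in particular $r<2\pi|v|$, and so that $|e^{s}q|$ stays on the same side of $1$ as $|q|$ for $|s|\le r$). Let $a^+_{k,-m}(0):=\frac{(2\pi)^{2-k}(-1)^{\frac k2+1}(-m)^{1-k}}{(1-k)!}\sum_{c>0,\,N\mid c}\frac{K(-m,0;c)}{c^{2-k}}$.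 Define $$H^+_{k,m}(\tau):=q^{-m}+a^+_{k,-m}(0)+2\pi(-1)^{\frac k2}m^{\frac{1-k}{2}}\sum_{c>0,\,N\mid c}\frac1c\sum_{d\pmod c^*}e\left(\frac{-m\bar d+d}{c}+\tau\right)\phi^+_{k,m}(c,d;\tau),$$ $$H^-_{k,m}(\tau):=-\Gamma^*(1-k,4\pi mv)q^{-m}+\frac{2\pi(-1)^{\frac k2}(4\pi v)^{1-k}}{(-k)!}m^{\frac{1-k}{2}}\sum_{c>0,\,N\mid c}\frac1c\sum_{d\pmod c^*}e\left(\frac{-m\bar d}{c}\right)\phi^-_{k,m}(c,d;\tau).$$ *)

theory Defs
  imports "HOL-Complex_Analysis.Complex_Analysis"
begin

definition ee :: "complex \<Rightarrow> complex" where
  "ee z = exp (2 * of_real pi * \<i> * z)"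

definition qq :: "complex \<Rightarrow> complex" where
  "qq \<tau> = ee \<tau>"

definition zeta :: "nat \<Rightarrow> int \<Rightarrow> complex" where
  "zeta c b = ee (of_int b / of_nat c)"

text \<open>An inverse of d modulo c (only its residue class matters below).\<close>
definition minv :: "int \<Rightarrow> int \<Rightarrow> int" where
  "minv c d = (SOME x. (d * x) mod c = 1 mod c)"

definition units_mod :: "nat \<Rightarrow> int set" where
  "units_mod c = {d \<in> {0..<int c}. coprime d (int c)}"

definition kloosterman :: "int \<Rightarrow> int \<Rightarrow> nat \<Rightarrow> complex" where
  "kloosterman a b c =
     (\<Sum>d\<in>units_mod c. ee (of_int (a * minv (int c) d + b * d) / of_nat c))"

text \<open>Incomplete gamma function for a positive integer s: the integral for y > 0,
  and the stated closed-form extension for all other real y.\<close>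
definition inc_gamma :: "nat \<Rightarrow> real \<Rightarrow> real" where
  "inc_gamma s y =
     (if 0 < y then integral {y..} (\<lambda>t. t ^ (s - 1) * exp (- t))
      else fact (s - 1) * exp (- y) * (\<Sum>j<s. y ^ j / fact j))"

definition ninc_gamma :: "nat \<Rightarrow> real \<Rightarrow> real" where
  "ninc_gamma s y = inc_gamma s y / fact (s - 1)"

text \<open>Polylogarithm of negative integer order -n as the rational function
  (w d/dw)^n (w/(1-w)).\<close>
definition polylog_neg :: "nat \<Rightarrow> complex \<Rightarrow> complex" where
  "polylog_neg n w =
     (((\<lambda>f z. z * deriv f z) ^^ n) (\<lambda>z. z / (1 - z))) w"

definition alpha_plus :: "int \<Rightarrow> nat \<Rightarrow> nat \<Rightarrow> complex \<Rightarrow> complex" where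
  "alpha_plus k m c s =
     (\<Sum>j. of_real (1 / fact (nat (int j + 1 - k))
              * (2 * pi * sqrt (real m) / real c) ^ nat (2 * int j + 1 - k))
            / s ^ (j + 1))"

definition alpha_minus :: "int \<Rightarrow> nat \<Rightarrow> nat \<Rightarrow> complex \<Rightarrow> complex" where
  "alpha_minus k m c s =
     (\<Sum>j. of_real ((-1) ^ j / fact (nat (int j + 1 - k))
              * (2 * pi * sqrt (real m) / real c) ^ nat (2 * int j + 1 - k))
            / s ^ (j + 1))"

definition phi_plus :: "int \<Rightarrow> nat \<Rightarrow> real \<Rightarrow> nat \<Rightarrow> int \<Rightarrow> complex \<Rightarrow> complex" where
  "phi_plus k m rr c d \<tau> =
     1 / (2 * of_real pi * \<i>) *
     contour_integral (circlepath 0 rr)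
       (\<lambda>s. alpha_plus k m c s * exp s / (1 - exp s * zeta c d * qq \<tau>))"

definition phi_minus_integrand :: "int \<Rightarrow> nat \<Rightarrow> real \<Rightarrow> nat \<Rightarrow> int \<Rightarrow> complex \<Rightarrow> real \<Rightarrow> complex" where
  "phi_minus_integrand k m rr c d \<tau> t =
     of_real (t ^ nat (- k)) *
     contour_integral (circlepath 0 rr)
       (\<lambda>s. alpha_minus k m c s *
            polylog_neg (nat (1 - k))
              (exp (s - of_real (4 * pi * Im \<tau> * t)) * zeta c (- d) * inverse (qq \<tau>)))"

definition phi_minus :: "int \<Rightarrow> nat \<Rightarrow> real \<Rightarrow> nat \<Rightarrow> int \<Rightarrow> complex \<Rightarrow> complex" where
  "phi_minus k m rr c d \<tau> =
     1 / (2 * of_real pi * \<i>) * integral {1..} (phi_minus_integrand k m rr c d \<tau>)"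

text \<open>Sums over c > 0 with N | c are taken in increasing order c = N, 2N, 3N, ...\<close>

definition aplus_term :: "int \<Rightarrow> nat \<Rightarrow> nat \<Rightarrow> complex" where
  "aplus_term k m c = kloosterman (- int m) 0 c / of_nat c ^ nat (2 - k)"

definition aplus0 :: "nat \<Rightarrow> int \<Rightarrow> nat \<Rightarrow> complex" where
  "aplus0 N k m =
     of_real ((2 * pi) ^ nat (2 - k)) * ((-1::complex) powi (k div 2 + 1))
     * of_int ((- int m) ^ nat (1 - k)) / of_real (fact (nat (1 - k)))
     * (\<Sum>n. aplus_term k m (N * Suc n))"

definition Hplus_term :: "int \<Rightarrow> nat \<Rightarrow> real \<Rightarrow> complex \<Rightarrow> nat \<Rightarrow> complex" where
  "Hplus_term k m rr \<tau> c =
     1 / of_nat c *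
     (\<Sum>d\<in>units_mod c.
        ee (of_int (- int m * minv (int c) d + d) / of_nat c + \<tau>) * phi_plus k m rr c d \<tau>)"

definition Hplus :: "nat \<Rightarrow> int \<Rightarrow> nat \<Rightarrow> real \<Rightarrow> complex \<Rightarrow> complex" where
  "Hplus N k m rr \<tau> =
     ee (- of_nat m * \<tau>) + aplus0 N k m
     + 2 * of_real pi * ((-1::complex) powi (k div 2))
       * of_real (real m powr ((1 - real_of_int k) / 2))
       * (\<Sum>n. Hplus_term k m rr \<tau> (N * Suc n))"

definition Hminus_term :: "int \<Rightarrow> nat \<Rightarrow> real \<Rightarrow> complex \<Rightarrow> nat \<Rightarrow> complex" where
  "Hminus_term k m rr \<tau> c =
     1 / of_nat c *
     (\<Sum>d\<in>units_mod c.
        ee (of_int (- int m * minv (int c) d) / of_nat c) * phi_minus k m rr c d \<tau>)"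

definition Hminus :: "nat \<Rightarrow> int \<Rightarrow> nat \<Rightarrow> real \<Rightarrow> complex \<Rightarrow> complex" where
  "Hminus N k m rr \<tau> =
     - of_real (ninc_gamma (nat (1 - k)) (4 * pi * real m * Im \<tau>)) * ee (- of_nat m * \<tau>)
     + 2 * of_real pi * ((-1::complex) powi (k div 2))
       * of_real ((4 * pi * Im \<tau>) ^ nat (1 - k) / fact (nat (- k)))
       * of_real (real m powr ((1 - real_of_int k) / 2))
       * (\<Sum>n. Hminus_term k m rr \<tau> (N * Suc n))"

definition Hfun :: "nat \<Rightarrow> int \<Rightarrow> nat \<Rightarrow> real \<Rightarrow> complex \<Rightarrow> complex" where
  "Hfun N k m rr \<tau> = Hplus N k m rr \<tau> + Hminus N k m rr \<tau>"

definition Hconverges :: "nat \<Rightarrow> int \<Rightarrow> nat \<Rightarrow> real \<Rightarrow> complex \<Rightarrow> bool" where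
  "Hconverges N k m rr \<tau> \<longleftrightarrow>
     summable (\<lambda>n. aplus_term k m (N * Suc n)) \<and>
     summable (\<lambda>n. Hplus_term k m rr \<tau> (N * Suc n)) \<and>
     summable (\<lambda>n. Hminus_term k m rr \<tau> (N * Suc n)) \<and>
     (\<forall>c>0. \<forall>d\<in>units_mod c. phi_minus_integrand k m rr c d \<tau> integrable_on {1..})"

type_synonym mat2 = "int \<times> int \<times> int \<times> int"

fun mmul :: "mat2 \<Rightarrow> mat2 \<Rightarrow> mat2" where
  "mmul (a, b, c, d) (a', b', c', d') =
     (a * a' + b * c', a * b' + b * d', c * a' + d * c', c * b' + d * d')"

definition Gamma0 :: "nat \<Rightarrow> mat2 set" where
  "Gamma0 N = {(a, b, c, d). a * d - b * c = 1 \<and> int N dvd c}"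

definition Gamma_inf :: "mat2 set" where
  "Gamma_inf = {(1, n, 0, 1) | n. True} \<union> {(-1, -n, 0, -1) | n. True}"

definition cosets :: "nat \<Rightarrow> mat2 set set" where
  "cosets N = (\<lambda>\<gamma>. {mmul g \<gamma> | g. g \<in> Gamma_inf}) ` Gamma0 N"

fun mobius :: "mat2 \<Rightarrow> complex \<Rightarrow> complex" where
  "mobius (a, b, c, d) \<tau> = (of_int a * \<tau> + of_int b) / (of_int c * \<tau> + of_int d)"

fun slash :: "int \<Rightarrow> (complex \<Rightarrow> complex) \<Rightarrow> mat2 \<Rightarrow> complex \<Rightarrow> complex" where
  "slash \<kappa> f (a, b, c, d) \<tau> =
     (of_int c * \<tau> + of_int d) powi (- \<kappa>) * f (mobius (a, b, c, d) \<tau>)"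

definition poincare_sum :: "nat \<Rightarrow> int \<Rightarrow> (complex \<Rightarrow> complex) \<Rightarrow> complex \<Rightarrow> complex" where
  "poincare_sum N \<kappa> f \<tau> = (\<Sum>\<^sub>\<infinity>C\<in>cosets N. slash \<kappa> f (SOME \<gamma>. \<gamma> \<in> C) \<tau>)"

definition Poinc :: "nat \<Rightarrow> int \<Rightarrow> int \<Rightarrow> complex \<Rightarrow> complex" where
  "Poinc N \<kappa> l \<tau> = poincare_sum N \<kappa> (\<lambda>z. ee (of_int l * z)) \<tau>"

definition MaassPoinc :: "nat \<Rightarrow> int \<Rightarrow> nat \<Rightarrow> complex \<Rightarrow> complex" where
  "MaassPoinc N k m \<tau> =
     poincare_sum N k
       (\<lambda>z. of_real (1 - ninc_gamma (nat (1 - k)) (4 * pi * real m * Im z)) * ee (- of_nat m * z)) \<tau>"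

text \<open>Fourier coefficients of a 1-periodic holomorphic function on H.\<close>
definition fourier_coeff :: "(complex \<Rightarrow> complex) \<Rightarrow> int \<Rightarrow> complex" where
  "fourier_coeff f n = integral {0..1} (\<lambda>u. f (Complex u 1) * ee (- of_int n * Complex u 1))"

definition eichler :: "(complex \<Rightarrow> complex) \<Rightarrow> int \<Rightarrow> complex \<Rightarrow> complex" where
  "eichler f \<kappa> \<tau> =
     (\<Sum>\<^sub>\<infinity>n\<in>{n::int. n \<noteq> 0}. fourier_coeff f n / of_int n ^ nat (\<kappa> - 1) * ee (of_int n * \<tau>))"

definition nh_eichler :: "(complex \<Rightarrow> complex) \<Rightarrow> int \<Rightarrow> complex \<Rightarrow> complex" where
  "nh_eichler f \<kappa> \<tau> =
     - of_real ((4 * pi) powi (1 - \<kappa>)) *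
     (\<Sum>\<^sub>\<infinity>n\<in>{n::int. n \<noteq> 0}.
        cnj (fourier_coeff f n) / of_int n ^ nat (\<kappa> - 1)
        * of_real (inc_gamma (nat (\<kappa> - 1)) (4 * pi * of_int n * Im \<tau>))
        * ee (- of_int n * \<tau>))"

end

theory Submission
  imports Defs
begin

text \<open>Put K = -k. On the circle of integration the kernels of phi_plus and phi_minus expand into power
  series in q or in 1/q, depending on the half-plane containing tau. Integrated against alpha_plus and
  alpha_minus, the exponentials leave the power series of the Bessel functions I and J, so that in both
  half-planes H is a sum over c and n of Kloosterman sums times Bessel functions.

  In the upper half-plane the Maass-Poincare series is unfolded over the pairs (c, d). With
  z = tau + d/c and A = 2 pi i m / c^2, its summand is, up to a root of unity and a power of c, the
  remainder at z of the Taylor polynomial of degree K of z^K exp(A/z) around the conjugate of z (a form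
  of Bol's identity). Expanding in powers of A leaves Taylor remainders of the functions z^(-P), and their
  sums over integer translates are given by the Lipschitz formula, which follows from the reflection formula of the
  polygamma functions; P = 1 produces the constant term. The result agrees with H for each c.

  In the lower half-plane the constant term of H cancels against the term n = 0 of the expansion of
  phi_plus. The Lipschitz formula also gives the Fourier coefficients of the holomorphic Poincare series,
  and the identity follows by interchanging the sums over c and n.\<close>

section \<open>Polylogarithms and the Lipschitz formula\<close>

text \<open>Two obstacles shape the proof. The sum of 1/(z + n) over all integers is not absolutely
  convergent, so the holomorphic and the non-holomorphic half of the Maass-Poincare series cannot be
  summed over translates one by one. In the Taylor remainders the critical power occurs only as a
  difference between z and its conjugate, which gains one power of n; the constants of the two
  reflection formulas then add up instead of cancelling. Further, the sums over c, over the
  frequency n and over the power series index are reordered repeatedly, and each reordering needs a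
  majorant. The power series of I and J are bounded by a constant times exp(\<rho> n), uniformly in
  c, for every \<rho> > 0. With \<rho> a small multiple of |v|, part of the decay of the exponential
  or of the incomplete gamma function pays for this and the rest remains for convergence. The radius
  r matters only for expanding the kernels: r < 2 \<pi> |v| makes their series converge on the
  circle, and the evaluated contour integrals no longer contain r.\<close>

lemma ee_add: "ee (x + y) = ee x * ee y"
  by (simp add: ee_def ring_distribs exp_add)

lemma ee_0 [simp]: "ee 0 = 1"
  by (simp add: ee_def)

lemma ee_nonzero [simp]: "ee z \<noteq> 0"
  by (simp add: ee_def)

lemma ee_minus: "ee (- x) = inverse (ee x)"
  by (simp add: ee_def exp_minus)

lemma norm_ee: "norm (ee z) = exp (- (2 * pi * Im z))"
  by (simp add: ee_def)

lemma ee_of_nat_mult: "ee (of_nat n * z) = ee z ^ n"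
  by (simp add: ee_def exp_of_nat_mult [symmetric] algebra_simps)

lemma ee_of_int [simp]: "ee (of_int n) = 1"
  by (auto simp: ee_def exp_eq_1)

lemma ee_add_of_int: "ee (z + of_int n) = ee z"
  by (simp add: ee_add)

lemma cnj_ee: "cnj (ee z) = ee (- cnj z)"
  by (simp add: ee_def exp_cnj)

text \<open>This is how powers of the conjugate of q become negative powers of q, with the factor
  exp(-4 \<pi> v) that the incomplete gamma function contributes.\<close>

lemma cnj_ee': "cnj (ee z) = of_real (exp (- (4 * pi * Im z))) * inverse (ee z)"
proof -
  have "- cnj z = - z + 2 * \<i> * Im z"
    by (simp add: complex_eq_iff)
  then have "cnj (ee z) = inverse (ee z) * ee (2 * \<i> * Im z)"
    using ee_add [of "- z" "2 * \<i> * Im z"] by (simp only: cnj_ee ee_minus)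
  also have "ee (2 * \<i> * Im z) = of_real (exp (- (4 * pi * Im z)))"
    unfolding ee_def exp_of_real [symmetric] by (rule arg_cong [where f = exp]) (simp add: complex_eq_iff)
  finally show ?thesis by (simp add: mult.commute)
qed

lemma ee_has_deriv: "(ee has_field_derivative ee z * (2 * of_real pi * \<i>)) (at z)"
  unfolding ee_def by (auto intro!: derivative_eq_intros)

section \<open>Polylogarithms of negative order\<close>

lemma polylog_neg_0: "polylog_neg 0 = (\<lambda>z. z / (1 - z))"
  by (simp add: polylog_neg_def fun_eq_iff)

lemma polylog_neg_Suc: "polylog_neg (Suc n) = (\<lambda>w. w * deriv (polylog_neg n) w)"
  unfolding polylog_neg_def by (simp add: fun_eq_iff)

lemma polylog_neg_holomorphic: "polylog_neg n holomorphic_on - {1}"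
proof (induction n)
  case 0
  then show ?case
    unfolding polylog_neg_0 by (intro holomorphic_intros) auto
next
  case (Suc n)
  then show ?case
    unfolding polylog_neg_Suc by (intro holomorphic_intros holomorphic_deriv) auto
qed

lemma polylog_neg_has_deriv:
  assumes "w \<noteq> 1"
  shows "(polylog_neg n has_field_derivative deriv (polylog_neg n) w) (at w)"
  using polylog_neg_holomorphic [of n] assms
  by (intro holomorphic_derivI [of _ "- {1}"]) auto

lemma polylog_neg_sums:
  assumes "norm w < 1"
  shows "(\<lambda>l. of_nat (Suc l) ^ n * w ^ Suc l) sums polylog_neg n w"
proof -
  \<comment> \<open>The index starts at 0 so that the power series can be differentiated termwise.
    The guard matters for n = 0, where \<open>0 ^ 0 = 1\<close> would add a spurious term.\<close>
  have "(\<lambda>k. (if k = 0 then 0 else of_nat k ^ n) * w ^ k) sums polylog_neg n w"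
    if "norm w < 1" for w :: complex and n
    using that
  proof (induction n arbitrary: w)
    case 0
    have "(\<lambda>k. w ^ k - (if k = 0 then 1 else 0)) sums (1 / (1 - w) - 1)"
      using sums_diff [OF geometric_sums [of w] sums_single [of 0 "\<lambda>_. 1"]] 0 by simp
    moreover have "1 / (1 - w) - 1 = polylog_neg 0 w"
      using 0 by (auto simp: polylog_neg_0 divide_simps)
    moreover have "(\<lambda>k. w ^ k - (if k = 0 then 1 else 0)) = (\<lambda>k. (if k = 0 then 0 else of_nat k ^ 0) * w ^ k)"
      by auto
    ultimately show ?case by simp
  next
    case (Suc n)
    have "w \<noteq> 1" using Suc.prems by auto
    then have "(\<lambda>k. diffs (\<lambda>k. if k = 0 then 0 else of_nat k ^ n) k * w ^ k) sums deriv (polylog_neg n) w"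
      using Suc polylog_neg_has_deriv by (intro termdiffs_sums_strong [where K = 1]) auto
    then have "(\<lambda>k. w * (diffs (\<lambda>k. if k = 0 then 0 else of_nat k ^ n) k * w ^ k)) sums polylog_neg (Suc n) w"
      unfolding polylog_neg_Suc by (rule sums_mult)
    moreover have "w * (diffs (\<lambda>k. if k = 0 then 0 else of_nat k ^ n) k * w ^ k)
        = (if Suc k = 0 then 0 else of_nat (Suc k) ^ Suc n) * w ^ Suc k" for k
      by (simp add: diffs_def)
    ultimately have "(\<lambda>k. (if Suc k = 0 then 0 else of_nat (Suc k) ^ Suc n) * w ^ Suc k) sums polylog_neg (Suc n) w"
      by simp
    from sums_Suc [OF this] show ?case by simp
  qed
  from this [OF assms, of n] show ?thesis
    using sums_Suc_iff [of "\<lambda>k. (if k = 0 then 0 else of_nat k ^ n) * w ^ k" "polylog_neg n w"]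
    by simp
qed

text \<open>The operator w d/dw changes sign under inversion of w, so only order 0 needs a
  computation; its extra constant disappears with the first derivative.\<close>

lemma polylog_neg_inverse:
  assumes "w \<noteq> 0" "w \<noteq> 1"
  shows "polylog_neg n w = (-1) ^ Suc n * polylog_neg n (inverse w) - (if n = 0 then 1 else 0)"
  using assms
proof (induction n arbitrary: w)
  case 0
  then show ?case by (auto simp: polylog_neg_0 field_simps)
next
  case (Suc n)
  have nz: "inverse w \<noteq> 1" using Suc.prems by (simp add: field_simps)
  have D: "((\<lambda>w. (-1) ^ Suc n * polylog_neg n (inverse w) - (if n = 0 then 1 else 0)) has_field_derivative
      (-1) ^ Suc n * (deriv (polylog_neg n) (inverse w) * (- (inverse w * 1 * inverse w)))) (at w)"
    using Suc.prems nz
    by (auto intro!: derivative_eq_intros DERIV_chain2 [OF polylog_neg_has_deriv] simp: power2_eq_square)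
  have "(polylog_neg n has_field_derivative
      (-1) ^ Suc n * (deriv (polylog_neg n) (inverse w) * (- (inverse w * 1 * inverse w)))) (at w)"
  proof (rule DERIV_cong_ev [THEN iffD2, OF refl _ refl D])
    have "eventually (\<lambda>x. x \<in> - {0, 1}) (nhds w)"
      using Suc.prems by (intro eventually_nhds_in_open) auto
    then show "eventually (\<lambda>x. polylog_neg n x =
        (-1) ^ Suc n * polylog_neg n (inverse x) - (if n = 0 then 1 else 0)) (nhds w)"
      by (rule eventually_mono) (rule Suc.IH, auto)
  qed
  then have "deriv (polylog_neg n) w = (-1) ^ Suc n * (deriv (polylog_neg n) (inverse w) * (- (inverse w * 1 * inverse w)))"
    by (rule DERIV_imp_deriv)
  then show ?case
    using Suc.prems by (simp add: polylog_neg_Suc)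
qed

lemma polylog_neg_cnj:
  assumes "norm w < 1"
  shows "polylog_neg n (cnj w) = cnj (polylog_neg n w)"
proof -
  have "(\<lambda>l. cnj (of_nat (Suc l) ^ n * w ^ Suc l)) sums cnj (polylog_neg n w)"
    using polylog_neg_sums [OF assms] by (simp only: sums_cnj)
  moreover have "(\<lambda>l. of_nat (Suc l) ^ n * cnj w ^ Suc l) sums polylog_neg n (cnj w)"
    using assms by (intro polylog_neg_sums) simp
  ultimately show ?thesis by (simp add: sums_unique2)
qed

section \<open>Reflection formulas for the polygamma functions\<close>

text \<open>Logarithmic derivative of the reflection formula for \<open>rGamma\<close>.\<close>

lemma Digamma_reflection:
  fixes z :: complex
  assumes "z \<notin> \<int>"
  shows "Digamma (1 - z) - Digamma z = of_real pi * cos (of_real pi * z) / sin (of_real pi * z)"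
proof -
  have nz: "z \<notin> \<int>\<^sub>\<le>\<^sub>0" "1 - z \<notin> \<int>\<^sub>\<le>\<^sub>0"
    using assms nonpos_Ints_Int [of z] nonpos_Ints_Int [of "1 - z"] Ints_diff [of 1 "1 - z"] by auto
  have "((\<lambda>z. rGamma z * rGamma (1 - z)) has_field_derivative
      (rGamma z * rGamma (1 - z) * (Digamma (1 - z) - Digamma z))) (at z)"
    using nz by (auto intro!: derivative_eq_intros simp: algebra_simps)
  moreover have "((\<lambda>z. rGamma z * rGamma (1 - z)) has_field_derivative cos (of_real pi * z)) (at z)"
    unfolding rGamma_reflection_complex by (auto intro!: derivative_eq_intros)
  ultimately have "rGamma z * rGamma (1 - z) * (Digamma (1 - z) - Digamma z) = cos (of_real pi * z)"
    by (rule DERIV_unique)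
  moreover have "sin (of_real pi * z) \<noteq> 0"
  proof
    assume "sin (of_real pi * z) = 0"
    then obtain n :: int where "of_real pi * z = of_real (of_int n * pi)"
      by (auto simp: sin_eq_0)
    then have "z = of_int n" by (simp add: field_simps)
    with assms show False by simp
  qed
  ultimately show ?thesis
    unfolding rGamma_reflection_complex by (simp add: field_simps)
qed


text \<open>For n = 0 the cotangent is written in terms of E = exp(\<pi> i z). Each further
  derivative raises both polygamma orders and, through the chain rule for \<open>ee\<close>, applies
  w d/dw to the polylogarithm with a factor 2 \<pi> i; the first one removes the constant. The
  half-plane keeps \<open>ee z\<close> away from the pole at 1.\<close>

lemma Polygamma_reflection:
  fixes z :: complex
  assumes "Im z > 0"
  shows "(-1) ^ n * Polygamma n (1 - z) - Polygamma n z =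
    - (if n = 0 then of_real pi * \<i> else 0) - (2 * of_real pi * \<i>) ^ Suc n * polylog_neg n (ee z)"
  using assms
proof (induction n arbitrary: z)
  case 0
  define E where "E = exp (\<i> * (of_real pi * z))"
  have E0: "E \<noteq> 0" by (simp add: E_def)
  have "ee z = E * E"
    unfolding E_def ee_def by (simp add: mult_ac flip: exp_add)
  moreover have "norm (ee z) \<noteq> 1"
    using 0 by (simp add: norm_ee)
  ultimately have E1: "E * E \<noteq> 1" and eeE: "ee z = E * E" by auto
  have "z \<notin> \<int>"
    using 0 by (auto elim!: Ints_cases)
  then have "Digamma (1 - z) - Digamma z = of_real pi * cos (of_real pi * z) / sin (of_real pi * z)"
    by (rule Digamma_reflection)
  also have "\<dots> = of_real pi * \<i> * (E + inverse E) / (E - inverse E)"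
  proof -
    have "cos (of_real pi * z) = (E + inverse E) / 2" "sin (of_real pi * z) = (E - inverse E) / (2 * \<i>)"
      by (simp_all add: cos_exp_eq sin_exp_eq E_def exp_minus)
    moreover have "x * (a / 2) / (b / (2 * \<i>)) = x * \<i> * a / b" for x a b :: complex
      by (cases "b = 0") (simp_all add: field_simps)
    ultimately show ?thesis by (simp only:)
  qed
  also have "\<dots> = of_real pi * \<i> * (E * E + 1) / (E * E - 1)"
    using E0 E1 by (simp add: divide_simps)
  also have "\<dots> = - (of_real pi * \<i>) - 2 * of_real pi * \<i> * polylog_neg 0 (E * E)"
    using E1 by (simp add: polylog_neg_0 divide_simps) (simp add: algebra_simps)
  finally show ?case by (simp add: eeE)
next
  case (Suc n)
  have ne: "w \<notin> \<int>\<^sub>\<le>\<^sub>0" "1 - w \<notin> \<int>\<^sub>\<le>\<^sub>0" if "Im w > 0" for w :: complex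
    using that by (auto elim!: nonpos_Ints_cases simp: complex_eq_iff)
  have 1: "((\<lambda>z. (-1) ^ n * Polygamma n (1 - z) - Polygamma n z) has_field_derivative
      (-1) ^ n * - Polygamma (Suc n) (1 - z) - Polygamma (Suc n) z) (at z)"
    using ne [OF Suc.prems] by (auto intro!: derivative_eq_intros)
  have "ee z \<noteq> 1"
    using Suc.prems norm_ee [of z] by auto
  have "((\<lambda>z. - (if n = 0 then of_real pi * \<i> else 0) - (2 * of_real pi * \<i>) ^ Suc n * polylog_neg n (ee z))
     has_field_derivative - ((2 * of_real pi * \<i>) ^ Suc n * (deriv (polylog_neg n) (ee z) * (ee z * (2 * of_real pi * \<i>))))) (at z)"
    by (rule derivative_eq_intros DERIV_chain2 [OF polylog_neg_has_deriv [OF \<open>ee z \<noteq> 1\<close>] ee_has_deriv] refl)+ simp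
  then have "((\<lambda>z. (-1) ^ n * Polygamma n (1 - z) - Polygamma n z) has_field_derivative
      - ((2 * of_real pi * \<i>) ^ Suc n * (deriv (polylog_neg n) (ee z) * (ee z * (2 * of_real pi * \<i>))))) (at z)"
  proof (rule DERIV_cong_ev [THEN iffD2, OF refl _ refl, rotated])
    have "eventually (\<lambda>x. x \<in> {w. 0 < Im w}) (nhds z)"
      using Suc.prems open_halfspace_Im_gt [of 0] by (intro eventually_nhds_in_open) auto
    then show "eventually (\<lambda>z. (-1) ^ n * Polygamma n (1 - z) - Polygamma n z =
        - (if n = 0 then of_real pi * \<i> else 0) - (2 * of_real pi * \<i>) ^ Suc n * polylog_neg n (ee z)) (nhds z)"
      by (rule eventually_mono) (rule Suc.IH, auto)
  qed
  from DERIV_unique [OF 1 this] show ?case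
    by (simp add: polylog_neg_Suc mult_ac)
qed

section \<open>Sums over all integers and the Lipschitz formula\<close>

lemma summable_on_norm_bound:
  fixes f :: "'a \<Rightarrow> 'b::banach"
  assumes "g summable_on A" "\<And>x. x \<in> A \<Longrightarrow> norm (f x) \<le> g x"
  shows "f summable_on A"
  using Infinite_Sum.abs_summable_on_comparison_test' [OF assms] by (rule abs_summable_summable)

text \<open>Unconditional summability is assumed, so the two ordinary limits determine the sum. The
  half-lines n and -1 - n are those that the polygamma series at z and 1 - z provide.\<close>

lemma has_sum_int_sums:
  fixes f :: "int \<Rightarrow> complex"
  assumes f: "f summable_on UNIV" and a: "(\<lambda>n. f (int n)) sums a" and b: "(\<lambda>n. f (- 1 - int n)) sums b"
  shows "(f has_sum (a + b)) UNIV"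
proof -
  have *: "(f has_sum s) (range h)" if inj: "inj h" and s: "(\<lambda>n. f (h n)) sums s" for h :: "nat \<Rightarrow> int" and s
  proof -
    have "f summable_on range h"
      using f by (rule summable_on_subset) auto
    then have "(\<lambda>n. f (h n)) summable_on UNIV"
      using summable_on_reindex [OF inj, of f] by (simp add: o_def)
    then have "((\<lambda>n. f (h n)) has_sum s) UNIV"
      using has_sum_infsum has_sum_imp_sums sums_unique2 [OF _ s] by metis
    then show ?thesis
      using has_sum_reindex [OF inj, of f] by (simp add: o_def)
  qed
  have "(f has_sum (a + b)) (range int \<union> range (\<lambda>n. - 1 - int n))"
    by (intro has_sum_Un_disjoint * a b) (auto simp: inj_def)
  also have "range int \<union> range (\<lambda>n. - 1 - int n) = UNIV"
  proof -
    have "x \<in> range int \<union> range (\<lambda>n. - 1 - int n)" for x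
    proof (cases "x \<ge> 0")
      case True
      then have "x = int (nat x)" by simp
      then show ?thesis by blast
    next
      case False
      then have "x = - 1 - int (nat (- 1 - x))" by simp
      then show ?thesis by blast
    qed
    then show ?thesis by blast
  qed
  finally show ?thesis .
qed

text \<open>The constant depends on z only through its norm and imaginary part, so it can later be
  made uniform over the shifts by d/c.\<close>

lemma one_plus_abs_le_norm_shift:
  assumes "Im z \<noteq> 0"
  shows "1 + \<bar>real_of_int n\<bar> \<le> norm (z + of_int n) * (1 + (1 + norm z) / \<bar>Im z\<bar>)"
proof -
  have "\<bar>Im z\<bar> \<le> norm (z + of_int n)"
    using abs_Im_le_cmod [of "z + of_int n"] by simp
  then have "(1 + norm z) * \<bar>Im z\<bar> \<le> (1 + norm z) * norm (z + of_int n)"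
    by (intro mult_left_mono) auto
  then have "(1 + norm z) \<le> norm (z + of_int n) * ((1 + norm z) / \<bar>Im z\<bar>)"
    using assms by (simp add: field_simps)
  moreover have "norm (of_int n :: complex) \<le> norm (z + of_int n) + norm z"
    using norm_triangle_ineq4 [of "z + of_int n" z] by simp
  ultimately show ?thesis
    by (simp add: ring_distribs)
qed

lemma summable_on_int_quadratic: "(\<lambda>n::int. 1 / (1 + \<bar>real_of_int n\<bar>)\<^sup>2) summable_on UNIV"
proof -
  have s: "summable (\<lambda>n. 1 / (1 + real n)\<^sup>2)"
    using inverse_power_summable [of 2, where ?'a = real] summable_Suc_iff [of "\<lambda>n. inverse (real n ^ 2)"]
    by (simp add: field_simps)
  have *: "(\<lambda>n::int. 1 / (1 + \<bar>real_of_int n\<bar>)\<^sup>2) summable_on range h"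
    if "inj h" "\<And>n. (1 + real n) \<le> (1 + \<bar>real_of_int (h n)\<bar>)" for h :: "nat \<Rightarrow> int"
  proof -
    have "summable (\<lambda>n. 1 / (1 + \<bar>real_of_int (h n)\<bar>)\<^sup>2)"
      by (rule summable_comparison_test' [OF s, of 0])
         (use that(2) in \<open>auto intro!: divide_left_mono power_mono mult_pos_pos\<close>)
    then have "(\<lambda>n. 1 / (1 + \<bar>real_of_int (h n)\<bar>)\<^sup>2) summable_on UNIV"
      by (intro summable_nonneg_imp_summable_on) auto
    then show ?thesis
      using summable_on_reindex [OF that(1), of "\<lambda>n. 1 / (1 + \<bar>real_of_int n\<bar>)\<^sup>2"] by (simp add: o_def)
  qed
  have "(\<lambda>n::int. 1 / (1 + \<bar>real_of_int n\<bar>)\<^sup>2) summable_on (range int \<union> range (\<lambda>n. - 1 - int n))"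
    by (intro summable_on_union *) (auto simp: inj_def)
  also have "range int \<union> range (\<lambda>n. - 1 - int n) = UNIV"
  proof -
    have "x \<in> range int \<union> range (\<lambda>n. - 1 - int n)" for x
      by (cases "x \<ge> 0") (auto simp: image_iff intro: exI [of _ "nat x"] exI [of _ "nat (- 1 - x)"])
    then show ?thesis by blast
  qed
  finally show ?thesis .
qed

lemma summable_on_inverse_shift_squared:
  assumes "Im z \<noteq> 0"
  shows "(\<lambda>n::int. 1 / norm (z + of_int n) ^ 2) summable_on UNIV"
proof (rule summable_on_comparison_test)
  define M where "M = 1 + (1 + norm z) / \<bar>Im z\<bar>"
  show "(\<lambda>n::int. M\<^sup>2 * (1 / (1 + \<bar>real_of_int n\<bar>)\<^sup>2)) summable_on UNIV"
    by (intro summable_on_cmult_right summable_on_int_quadratic)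
  show "1 / norm (z + of_int n) ^ 2 \<le> M\<^sup>2 * (1 / (1 + \<bar>real_of_int n\<bar>)\<^sup>2)" for n :: int
  proof -
    have "z + of_int n \<noteq> 0" using assms by (auto simp: complex_eq_iff)
    moreover have "(1 + \<bar>real_of_int n\<bar>)\<^sup>2 \<le> (norm (z + of_int n) * M)\<^sup>2"
      using one_plus_abs_le_norm_shift [OF assms, of n] unfolding M_def by (intro power_mono) auto
    moreover have "0 < (1 + \<bar>real_of_int n\<bar>)\<^sup>2"
      by (intro zero_less_power) simp
    ultimately show ?thesis by (simp add: divide_simps power_mult_distrib) (simp add: mult_ac)
  qed
qed auto

text \<open>Two powers are kept for summability over translates; all others are traded for powers of
  1 / |Im z|, which stay constant along the translates.\<close>

lemma norm_inverse_shift_power_le: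
  assumes "Im z \<noteq> 0" "P \<ge> 2"
  shows "norm (1 / z ^ P) \<le> (1 / \<bar>Im z\<bar>) ^ (P - 2) * (1 / norm z ^ 2)"
proof -
  have nz: "norm z > 0" using assms by auto
  have "norm (1 / z ^ P) = (1 / norm z) ^ (P - 2) * (1 / norm z ^ 2)"
    using le_add_diff_inverse2 [OF assms(2)] power_add [of "norm z" "P - 2" 2]
    by (simp add: norm_divide norm_power power_one_over)
  also have "\<dots> \<le> (1 / \<bar>Im z\<bar>) ^ (P - 2) * (1 / norm z ^ 2)"
    using assms nz by (intro mult_right_mono power_mono divide_left_mono abs_Im_le_cmod) auto
  finally show ?thesis .
qed

text \<open>The nonnegative and the negative n give polygamma values of order P - 1 at z and at 1 -
  z; the reflection formula combines them into a polylogarithm of \<open>ee z\<close>.\<close>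

lemma lipschitz_formula:
  assumes "Im z > 0" "P \<ge> 2"
  shows "((\<lambda>n::int. 1 / (z + of_int n) ^ P) has_sum
     ((- 2 * of_real pi * \<i>) ^ P / fact (P - 1) * polylog_neg (P - 1) (ee z))) UNIV"
proof -
  obtain p where P: "P = Suc p" "p > 0" using assms(2) by (cases P) auto
  have "z \<noteq> 0" "1 - z \<noteq> 0" using assms by (auto simp: complex_eq_iff)
  have s: "(\<lambda>n::int. 1 / (z + of_int n) ^ P) summable_on UNIV"
  proof (rule summable_on_norm_bound)
    show "(\<lambda>n::int. (1 / \<bar>Im z\<bar>) ^ (P - 2) * (1 / norm (z + of_int n) ^ 2)) summable_on UNIV"
      using assms by (intro summable_on_cmult_right summable_on_inverse_shift_squared) auto
    show "norm (1 / (z + of_int n) ^ P) \<le> (1 / \<bar>Im z\<bar>) ^ (P - 2) * (1 / norm (z + of_int n) ^ 2)" for n :: int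
      using norm_inverse_shift_power_le [of "z + of_int n" P] assms by simp
  qed
  have a: "(\<lambda>n. 1 / (z + of_int (int n)) ^ P) sums ((-1) ^ P * Polygamma p z / fact p)"
    using Polygamma_LIMSEQ [OF \<open>z \<noteq> 0\<close> \<open>p > 0\<close>] by (simp add: P inverse_eq_divide)
  have "(\<lambda>n. (-1) ^ P * inverse (((1 - z) + of_nat n) ^ Suc p)) sums
      ((-1) ^ P * ((-1) ^ Suc p * Polygamma p (1 - z) / fact p))"
    using Polygamma_LIMSEQ [OF \<open>1 - z \<noteq> 0\<close> \<open>p > 0\<close>] by (rule sums_mult)
  moreover have "(-1) ^ P * inverse (((1 - z) + of_nat n) ^ Suc p) = 1 / (z + of_int (- 1 - int n)) ^ P" for n
  proof -
    have "z + of_int (- 1 - int n) = - ((1 - z) + of_nat n)" by simp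
    then have "(z + of_int (- 1 - int n)) ^ P = (-1) ^ P * ((1 - z) + of_nat n) ^ P"
      by (metis mult_minus1 power_mult_distrib)
    then show ?thesis
      by (cases "even P") (simp_all add: P inverse_eq_divide)
  qed
  ultimately have b: "(\<lambda>n. 1 / (z + of_int (- 1 - int n)) ^ P) sums (Polygamma p (1 - z) / fact p)"
    by (cases "even p") (simp_all add: P)
  have "(-1) ^ P * Polygamma p z / fact p + Polygamma p (1 - z) / fact p =
      (- 1) ^ p / fact p * ((-1) ^ p * Polygamma p (1 - z) - Polygamma p z)"
    by (cases "even p") (simp_all add: P field_simps)
  also have "\<dots> = (- 1) ^ p / fact p * (- ((2 * of_real pi * \<i>) ^ Suc p * polylog_neg p (ee z)))"
    using Polygamma_reflection [OF assms(1), of p] \<open>p > 0\<close> by simp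
  also have "\<dots> = (- 2 * of_real pi * \<i>) ^ P / fact (P - 1) * polylog_neg (P - 1) (ee z)"
  proof -
    have "- 2 * of_real pi * \<i> = - (2 * of_real pi * \<i>)" by simp
    then have "(- 2 * of_real pi * \<i>) ^ P = (-1) ^ P * (2 * of_real pi * \<i>) ^ P"
      by (metis mult_minus1 power_mult_distrib)
    then show ?thesis by (simp add: P)
  qed
  finally show ?thesis
    using has_sum_int_sums [OF s a b] by simp
qed

lemma lipschitz_formula_cnj:
  assumes "Im z > 0" "P \<ge> 2"
  shows "((\<lambda>n::int. 1 / (cnj z + of_int n) ^ P) has_sum
     ((2 * of_real pi * \<i>) ^ P / fact (P - 1) * cnj (polylog_neg (P - 1) (ee z)))) UNIV"
  using has_sum_cnj_iff [THEN iffD2, OF lipschitz_formula [OF assms]] by simp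

text \<open>For P = 1 neither series converges absolutely, but the differences are O(1/n^2). The
  constants - \<pi> i of the two reflection formulas add up to - 2 \<pi> i, the origin of the
  constant term of the Maass-Poincare series.\<close>

lemma lipschitz_formula_difference:
  assumes "Im z > 0" "P \<ge> 1"
  shows "((\<lambda>n::int. 1 / (z + of_int n) ^ P - 1 / (cnj z + of_int n) ^ P) has_sum
     ((- 2 * of_real pi * \<i>) ^ P / fact (P - 1) * polylog_neg (P - 1) (ee z)
      - (2 * of_real pi * \<i>) ^ P / fact (P - 1) * cnj (polylog_neg (P - 1) (ee z))
      - (if P = 1 then 2 * of_real pi * \<i> else 0))) UNIV"
proof (cases "P = 1")
  case False
  then have "P \<ge> 2" using assms by auto
  then show ?thesis
    using has_sum_add [OF lipschitz_formula [OF assms(1)] has_sum_uminusI [OF lipschitz_formula_cnj [OF assms(1)]]] False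
    by simp
next
  case P: True
  let ?f = "\<lambda>n::int. 1 / (z + of_int n) - 1 / (cnj z + of_int n)"
  have nz: "z \<noteq> 0" "1 - z \<noteq> 0" "cnj z \<noteq> 0" "1 - cnj z \<noteq> 0" using assms by (auto simp: complex_eq_iff)
  have s: "?f summable_on UNIV"
  proof (rule summable_on_norm_bound)
    show "(\<lambda>n::int. 2 * Im z * (1 / norm (z + of_int n) ^ 2)) summable_on UNIV"
      using assms by (intro summable_on_cmult_right summable_on_inverse_shift_squared) auto
    show "norm (?f n) \<le> 2 * Im z * (1 / norm (z + of_int n) ^ 2)" for n :: int
    proof -
      have "z + of_int n \<noteq> 0" "cnj z + of_int n \<noteq> 0" using assms by (auto simp: complex_eq_iff)
      then have "?f n = (cnj z - z) / ((z + of_int n) * (cnj (z + of_int n)))"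
        by (simp add: divide_simps)
      moreover have "norm (cnj z - z) = 2 * Im z"
        using assms by (simp add: cmod_def real_sqrt_mult)
      ultimately show ?thesis
        by (simp only: norm_divide norm_mult complex_mod_cnj) (simp add: power2_eq_square)
    qed
  qed
  have D: "(\<lambda>k. inverse (of_nat (Suc k)) - inverse (w + of_nat k)) sums (Digamma w + euler_mascheroni)"
    if "w \<noteq> 0" for w :: complex
    using summable_sums [OF summable_Digamma [OF that]] by (simp add: Digamma_def)
  have a: "(\<lambda>n. ?f (int n)) sums (Digamma (cnj z) - Digamma z)"
    using sums_diff [OF D [OF nz(3)] D [OF nz(1)]] by (simp add: inverse_eq_divide)
  have "(\<lambda>n. ?f (- 1 - int n)) = (\<lambda>n. inverse (1 - cnj z + of_nat n) - inverse (1 - z + of_nat n))"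
  proof
    fix n
    have "inverse (w + of_int (- 1 - int n)) = - inverse (1 - w + of_nat n)" for w :: complex
    proof -
      have "w + of_int (- 1 - int n) = - (1 - w + of_nat n)" by simp
      then show ?thesis by (simp only: inverse_minus_eq)
    qed
    then show "?f (- 1 - int n) = inverse (1 - cnj z + of_nat n) - inverse (1 - z + of_nat n)"
      by (simp only: inverse_eq_divide [symmetric]) simp
  qed
  then have b: "(\<lambda>n. ?f (- 1 - int n)) sums (Digamma (1 - z) - Digamma (1 - cnj z))"
    using sums_diff [OF D [OF nz(2)] D [OF nz(4)]] by simp
  \<comment> \<open>The conjugate of z lies in the lower half-plane, so the reflection formula is
    applied at \<open>1 - cnj z\<close>, which lies in the upper one.\<close>
  have "ee (1 - cnj z) = cnj (ee z)"
    using ee_add_of_int [of "- cnj z" 1] by (simp add: cnj_ee)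
  moreover have "norm (ee z) < 1"
    using assms by (simp add: norm_ee)
  ultimately have "Digamma (cnj z) - Digamma (1 - cnj z) =
      - (of_real pi * \<i>) - 2 * of_real pi * \<i> * cnj (polylog_neg 0 (ee z))"
    using Polygamma_reflection [of "1 - cnj z" 0] assms by (simp add: polylog_neg_cnj)
  moreover have "Digamma (1 - z) - Digamma z = - (of_real pi * \<i>) - 2 * of_real pi * \<i> * polylog_neg 0 (ee z)"
    using Polygamma_reflection [of z 0] assms by simp
  moreover have "(Digamma (cnj z) - Digamma z) + (Digamma (1 - z) - Digamma (1 - cnj z)) =
      (Digamma (cnj z) - Digamma (1 - cnj z)) + (Digamma (1 - z) - Digamma z)"
    by simp
  ultimately have "(Digamma (cnj z) - Digamma z) + (Digamma (1 - z) - Digamma (1 - cnj z)) =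
      - 2 * of_real pi * \<i> * polylog_neg 0 (ee z) - 2 * of_real pi * \<i> * cnj (polylog_neg 0 (ee z)) - 2 * of_real pi * \<i>"
    by (simp only:) simp
  with has_sum_int_sums [OF s a b] P show ?thesis by simp
qed

section \<open>Bessel series and contour integrals\<close>

lemma power_over_fact_le_exp:
  fixes x :: real
  assumes "x \<ge> 0"
  shows "x ^ j / fact j \<le> exp x"
proof -
  have "(\<Sum>i\<in>{j}. inverse (fact i) * x ^ i) \<le> (\<Sum>i. inverse (fact i) * x ^ i)"
    using assms summable_exp [of x] by (intro sum_le_suminf) auto
  then show ?thesis by (simp add: exp_def field_simps scaleR_conv_of_real)
qed

text \<open>With a product as majorant, summability over the product set reduces to two single sums.
  Both iterated sums yield the same S, which is how two expansions of one quantity are matched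
  below.\<close>

lemma has_sum_exchange:
  fixes f :: "'a \<Rightarrow> 'b \<Rightarrow> complex"
  assumes g: "\<And>x. (f x has_sum g x) UNIV" and h: "\<And>y. ((\<lambda>x. f x y) has_sum h y) UNIV"
    and le: "\<And>x y. norm (f x y) \<le> u x * w y"
    and u: "u summable_on UNIV" and w: "w summable_on UNIV"
    and u0: "\<And>x. u x \<ge> (0 :: real)" and w0: "\<And>y. w y \<ge> (0 :: real)"
  obtains S where "(g has_sum S) UNIV" "(h has_sum S) UNIV"
proof -
  have "(\<lambda>(x, y). u x * w y) summable_on (UNIV \<times> UNIV)"
  proof (rule summable_on_SigmaI)
    show "((\<lambda>y. case (x, y) of (x, y) \<Rightarrow> u x * w y) has_sum (u x * infsum w UNIV)) UNIV" for x
      using has_sum_cmult_right [OF has_sum_infsum [OF w]] by simp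
    show "(\<lambda>x. u x * infsum w UNIV) summable_on UNIV"
      using u by (rule summable_on_cmult_left)
  qed (use u0 w0 in auto)
  then have s: "(\<lambda>(x, y). f x y) summable_on (UNIV \<times> UNIV)"
    by (rule summable_on_norm_bound) (use le in auto)
  define S where "S = infsum (\<lambda>(x, y). f x y) (UNIV \<times> UNIV)"
  have S: "((\<lambda>(x, y). f x y) has_sum S) (UNIV \<times> UNIV)"
    unfolding S_def using s by (rule has_sum_infsum)
  have "(g has_sum S) UNIV"
    using S by (rule has_sum_Sigma') (use g in auto)
  moreover have "((\<lambda>(y, x). f x y) has_sum S) (UNIV \<times> UNIV)"
    using S by (subst has_sum_swap) (simp add: case_prod_unfold)
  then have "(h has_sum S) UNIV"
    by (rule has_sum_Sigma') (use h in auto)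
  ultimately show ?thesis by (rule that)
qed

text \<open>(x/2)^w * bessel_series w (x^2/4) and (x/2)^w * bessel_series w (- x^2/4) are the Bessel functions
  I and J of order w at x.\<close>
definition bessel_series :: "nat \<Rightarrow> complex \<Rightarrow> complex" where
  "bessel_series w y = (\<Sum>j. y ^ j / (fact j * fact (j + w)))"

text \<open>Each of the two factorials absorbs one factor of (Y t)^j = (\<rho> t)^j (Y/\<rho>)^j.
  Thus the growth in t is exponential with an arbitrarily small rate \<rho>, and the bound does not
  depend on w.\<close>

lemma bessel_series_term_le:
  fixes y :: complex
  assumes "\<rho> > 0" "t \<ge> 0" "norm y \<le> Y * t" "Y \<ge> 0"
  shows "norm (y ^ j / (fact j * fact (j + w))) \<le> exp (\<rho> * t) * ((Y / \<rho>) ^ j / fact j)"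
proof -
  have "norm (y ^ j / (fact j * fact (j + w))) = norm y ^ j / (fact j * fact (j + w))"
    by (simp add: norm_divide norm_mult norm_power)
  also have "\<dots> \<le> (Y * t) ^ j / (fact j * fact (j + w))"
    using assms by (intro divide_right_mono power_mono) auto
  also have "\<dots> = ((\<rho> * t) ^ j / fact j) * ((Y / \<rho>) ^ j / fact (j + w))"
    using assms by (simp add: field_simps power_mult_distrib)
  also have "\<dots> \<le> exp (\<rho> * t) * ((Y / \<rho>) ^ j / fact j)"
    using assms fact_mono [of j "j + w", where ?'a = real]
    by (intro mult_mono power_over_fact_le_exp divide_left_mono) auto
  finally show ?thesis .
qed

lemma exp_sums_real: "(\<lambda>j. x ^ j / fact j) sums exp (x :: real)"
  using exp_converges [of x] by (simp add: field_simps scaleR_conv_of_real)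

lemma summable_bessel_series_norm: "summable (\<lambda>j. norm (y ^ j / (fact j * fact (j + w)) :: complex))"
proof (rule summable_comparison_test')
  show "summable (\<lambda>j. exp 1 * ((norm y) ^ j / fact j))"
    by (intro summable_mult sums_summable [OF exp_sums_real])
  show "norm (norm (y ^ j / (fact j * fact (j + w)))) \<le> exp 1 * ((norm y) ^ j / fact j)" for j
    using bessel_series_term_le [of 1 1 y "norm y" j w] by simp
qed

lemma bessel_series_has_sum:
  "((\<lambda>j. y ^ j / (fact j * fact (j + w))) has_sum bessel_series w y) UNIV"
  unfolding bessel_series_def
  by (intro norm_summable_imp_has_sum summable_bessel_series_norm summable_sums summable_norm_cancel)

lemma bessel_series_sums: "(\<lambda>j. y ^ j / (fact j * fact (j + w))) sums bessel_series w y"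
  using bessel_series_has_sum by (rule has_sum_imp_sums)

lemma bessel_series_0: "bessel_series w 0 = 1 / fact w"
proof -
  have "(\<lambda>j. if j = 0 then 1 / fact w else 0) sums (1 / fact w :: complex)"
    using sums_single [of 0 "\<lambda>_. 1 / fact w :: complex"] by simp
  moreover have "(\<lambda>j. if j = 0 then 1 / fact w else 0) = (\<lambda>j. 0 ^ j / (fact j * fact (j + w)) :: complex)"
    by (auto simp: fun_eq_iff)
  ultimately show ?thesis
    using bessel_series_sums [of 0 w] sums_unique2 by metis
qed

lemma norm_bessel_series_le:
  assumes "\<rho> > 0" "t \<ge> 0" "norm y \<le> Y * t" "Y \<ge> 0"
  shows "norm (bessel_series w y) \<le> exp (\<rho> * t) * exp (Y / \<rho>)"
proof -
  have s: "(\<lambda>j. exp (\<rho> * t) * ((Y / \<rho>) ^ j / fact j)) sums (exp (\<rho> * t) * exp (Y / \<rho>))"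
    by (intro sums_mult exp_sums_real)
  have "norm (bessel_series w y) \<le> (\<Sum>j. norm (y ^ j / (fact j * fact (j + w))))"
    unfolding bessel_series_def by (intro summable_norm summable_bessel_series_norm)
  also have "\<dots> \<le> (\<Sum>j. exp (\<rho> * t) * ((Y / \<rho>) ^ j / fact j))"
    using assms by (intro suminf_le bessel_series_term_le summable_bessel_series_norm sums_summable [OF s])
  also have "\<dots> = exp (\<rho> * t) * exp (Y / \<rho>)"
    using s by (simp add: sums_iff)
  finally show ?thesis .
qed

lemma cnj_bessel_series: "cnj (bessel_series w y) = bessel_series w (cnj y)"
proof -
  have "(\<lambda>j. cnj (y ^ j / (fact j * fact (j + w)))) sums cnj (bessel_series w y)"
    using bessel_series_sums by (simp only: sums_cnj)
  then show ?thesis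
    using bessel_series_sums [of "cnj y" w] by (simp add: sums_unique2)
qed

section \<open>Pairing Laurent series with exponentials on a circle\<close>

lemma contour_integral_circlepath_suminf:
  assumes "r > 0" and cont: "\<And>j. continuous_on (sphere 0 r) (f j)"
    and le: "\<And>j s. norm s = r \<Longrightarrow> norm (f j s) \<le> M j" and M: "summable M"
  shows "(\<lambda>j. contour_integral (circlepath 0 r) (f j)) sums contour_integral (circlepath 0 r) (\<lambda>s. \<Sum>j. f j s)"
proof -
  have int: "f j contour_integrable_on circlepath 0 r" for j
    using cont assms(1) by (intro contour_integrable_continuous_circlepath) simp
  have "(\<lambda>n. contour_integral (circlepath 0 r) (\<lambda>s. \<Sum>j<n. f j s)) \<longlonglongrightarrow> contour_integral (circlepath 0 r) (\<lambda>s. \<Sum>j. f j s)"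
  proof (rule contour_integral_uniform_limit_circlepath)
    show "uniform_limit (sphere 0 r) (\<lambda>n s. \<Sum>j<n. f j s) (\<lambda>s. \<Sum>j. f j s) sequentially"
      using le M by (intro Weierstrass_m_test) auto
  qed (use int assms(1) in \<open>auto intro!: contour_integrable_sum always_eventually\<close>)
  then show ?thesis
    unfolding sums_def using int by (simp add: contour_integral_sum)
qed

text \<open>The common form of \<alpha>+ (\<epsilon> = 1) and \<alpha>- (\<epsilon> = -1), with w =
  1 - k and X = 2 \<pi> sqrt(m) / c.\<close>

definition alpha_series :: "nat \<Rightarrow> real \<Rightarrow> real \<Rightarrow> complex \<Rightarrow> complex" where
  "alpha_series w \<epsilon> X s = (\<Sum>j. of_real (\<epsilon> ^ j / fact (j + w) * X ^ (2 * j + w)) / s ^ (j + 1))"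

lemma alpha_series_term_le:
  fixes s :: complex
  assumes "norm s = r" "r > 0" "\<bar>\<epsilon>\<bar> \<le> 1" "X \<ge> 0"
  shows "norm (of_real (\<epsilon> ^ j / fact (j + w) * X ^ (2 * j + w)) / s ^ (j + 1)) \<le> X ^ w / r * ((X\<^sup>2 / r) ^ j / fact j)"
proof -
  have "norm (of_real (\<epsilon> ^ j / fact (j + w) * X ^ (2 * j + w)) / s ^ (j + 1)) =
      \<bar>\<epsilon>\<bar> ^ j / fact (j + w) * (X ^ w / r * (X\<^sup>2 / r) ^ j)"
    using assms by (simp add: norm_divide norm_mult norm_power abs_mult power_abs [symmetric] power_add power_mult power_divide)
  also have "\<dots> \<le> 1 / fact j * (X ^ w / r * (X\<^sup>2 / r) ^ j)"
    using assms fact_mono [of j "j + w", where ?'a = real]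
    by (intro mult_right_mono frac_le power_le_one) auto
  finally show ?thesis by (simp add: mult.commute)
qed

lemma alpha_series_bound_sums: "(\<lambda>j. X ^ w / r * ((X\<^sup>2 / r) ^ j / fact j)) sums (X ^ w / r * exp (X\<^sup>2 / r :: real))"
  by (intro sums_mult exp_sums_real)

lemma norm_alpha_series_le:
  assumes "norm s = r" "r > 0" "\<bar>\<epsilon>\<bar> \<le> 1" "X \<ge> 0"
  shows "norm (alpha_series w \<epsilon> X s) \<le> X ^ w / r * exp (X\<^sup>2 / r)"
proof -
  have *: "summable (\<lambda>j. norm (of_real (\<epsilon> ^ j / fact (j + w) * X ^ (2 * j + w)) / s ^ (j + 1)))"
    by (rule summable_comparison_test' [OF sums_summable [OF alpha_series_bound_sums, of X w r], of 0])
       (use alpha_series_term_le [OF assms] in auto)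
  have "norm (alpha_series w \<epsilon> X s) \<le> (\<Sum>j. norm (of_real (\<epsilon> ^ j / fact (j + w) * X ^ (2 * j + w)) / s ^ (j + 1)))"
    unfolding alpha_series_def using * by (rule summable_norm)
  also have "\<dots> \<le> (\<Sum>j. X ^ w / r * ((X\<^sup>2 / r) ^ j / fact j))"
    by (intro suminf_le alpha_series_term_le [OF assms] * sums_summable [OF alpha_series_bound_sums])
  also have "\<dots> = X ^ w / r * exp (X\<^sup>2 / r)"
    using alpha_series_bound_sums [of X w r] by (simp add: sums_iff)
  finally show ?thesis .
qed

lemma continuous_on_alpha_series:
  assumes "r > 0" "\<bar>\<epsilon>\<bar> \<le> 1" "X \<ge> 0"
  shows "continuous_on (sphere 0 r) (alpha_series w \<epsilon> X)"
proof -
  have "uniform_limit (sphere 0 r) (\<lambda>n s. \<Sum>j<n. complex_of_real (\<epsilon> ^ j / fact (j + w) * X ^ (2 * j + w)) / s ^ (j + 1))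
     (\<lambda>s. \<Sum>j. of_real (\<epsilon> ^ j / fact (j + w) * X ^ (2 * j + w)) / s ^ (j + 1)) sequentially"
    using alpha_series_term_le [OF _ assms] alpha_series_bound_sums [of X w r, THEN sums_summable]
    by (intro Weierstrass_m_test) auto
  then show ?thesis
    unfolding alpha_series_def
    by (rule uniform_limit_theorem [rotated]) (use assms in \<open>auto intro!: continuous_intros always_eventually\<close>)
qed

text \<open>Cauchy's formula for the j-th derivative at 0. It supplies the second factorial that
  turns the coefficients of \<alpha> into those of a Bessel function.\<close>

lemma contour_integral_exp_over_power:
  assumes "r > 0"
  shows "((\<lambda>s. exp (a * s) / s ^ Suc j) has_contour_integral (2 * of_real pi * \<i> * a ^ j / fact j)) (circlepath 0 r)"
proof -
  have "(deriv ^^ j) (\<lambda>s. exp (a * s)) = (\<lambda>s. a ^ j * exp (a * s))"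
  proof (induction j)
    case (Suc j)
    have "((\<lambda>s. a ^ j * exp (a * s)) has_field_derivative a ^ Suc j * exp (a * s)) (at s)" for s
      by (auto intro!: derivative_eq_intros)
    then show ?case
      by (auto simp only: funpow.simps o_apply Suc fun_eq_iff DERIV_imp_deriv)
  qed simp
  moreover have "((\<lambda>s. exp (a * s) / (s - 0) ^ Suc j) has_contour_integral
      (2 * of_real pi * \<i> / fact j * (deriv ^^ j) (\<lambda>s. exp (a * s)) 0)) (circlepath 0 r)"
    using assms Cauchy_has_contour_integral_higher_derivative_circlepath [of 0 r "\<lambda>s. exp (a * s)" 0 j]
    by (simp add: continuous_intros holomorphic_intros)
  ultimately show ?thesis by simp
qed

lemma contour_integral_alpha_exp:
  assumes "r > 0" "\<bar>\<epsilon>\<bar> \<le> 1" "X \<ge> 0"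
  shows "contour_integral (circlepath 0 r) (\<lambda>s. alpha_series w \<epsilon> X s * exp (a * s)) =
    2 * of_real pi * \<i> * (of_real (X ^ w) * bessel_series w (of_real (\<epsilon> * X\<^sup>2) * a))"
proof -
  define f where "f j s = of_real (\<epsilon> ^ j / fact (j + w) * X ^ (2 * j + w)) / s ^ (j + 1) * exp (a * s)" for j s
  have "(\<lambda>j. contour_integral (circlepath 0 r) (f j)) sums contour_integral (circlepath 0 r) (\<lambda>s. \<Sum>j. f j s)"
  proof (rule contour_integral_circlepath_suminf)
    show "continuous_on (sphere 0 r) (f j)" for j
      unfolding f_def using assms by (auto intro!: continuous_intros)
    show "norm (f j s) \<le> (X ^ w / r * ((X\<^sup>2 / r) ^ j / fact j)) * exp (norm a * r)" if s: "norm s = r" for j s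
    proof -
      have "norm (exp (a * s)) \<le> exp (norm a * r)"
        using norm_exp [of "a * s"] s by (simp add: norm_mult)
      then show ?thesis
        unfolding f_def norm_mult using alpha_series_term_le [OF s assms, of j w] assms
        by (intro mult_mono) (auto intro: order_trans [OF norm_ge_zero])
    qed
    show "summable (\<lambda>j. (X ^ w / r * ((X\<^sup>2 / r) ^ j / fact j)) * exp (norm a * r))"
      by (intro summable_mult2 sums_summable [OF alpha_series_bound_sums])
  qed (use assms in auto)
  moreover have "contour_integral (circlepath 0 r) (f j) =
      2 * of_real pi * \<i> * (of_real (X ^ w) * ((of_real (\<epsilon> * X\<^sup>2) * a) ^ j / (fact j * fact (j + w))))" for j
  proof (rule contour_integral_unique)
    have "f j = (\<lambda>s. of_real (\<epsilon> ^ j / fact (j + w) * X ^ (2 * j + w)) * (exp (a * s) / s ^ Suc j))"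
      by (simp add: f_def fun_eq_iff)
    moreover have "of_real (\<epsilon> ^ j / fact (j + w) * X ^ (2 * j + w)) * (2 * of_real pi * \<i> * a ^ j / fact j) =
      2 * of_real pi * \<i> * (of_real (X ^ w) * ((of_real (\<epsilon> * X\<^sup>2) * a) ^ j / (fact j * fact (j + w))))"
      by (simp add: power_mult_distrib power_add mult_ac power_even_eq [of _ j] flip: power_mult)
    ultimately show "(f j has_contour_integral
        2 * of_real pi * \<i> * (of_real (X ^ w) * ((of_real (\<epsilon> * X\<^sup>2) * a) ^ j / (fact j * fact (j + w))))) (circlepath 0 r)"
      using has_contour_integral_lmul [OF contour_integral_exp_over_power [OF assms(1), of a j]] by metis
  qed
  moreover have "(\<lambda>j. 2 * of_real pi * \<i> * (of_real (X ^ w) * ((of_real (\<epsilon> * X\<^sup>2) * a) ^ j / (fact j * fact (j + w))))) sums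
     (2 * of_real pi * \<i> * (of_real (X ^ w) * bessel_series w (of_real (\<epsilon> * X\<^sup>2) * a)))"
    by (intro sums_mult bessel_series_sums)
  moreover have "contour_integral (circlepath 0 r) (\<lambda>s. \<Sum>j. f j s) =
      contour_integral (circlepath 0 r) (\<lambda>s. alpha_series w \<epsilon> X s * exp (a * s))"
  proof (rule contour_integral_eq)
    fix s assume "s \<in> path_image (circlepath 0 r)"
    then have s: "norm s = r" using assms by simp
    have "summable (\<lambda>j. of_real (\<epsilon> ^ j / fact (j + w) * X ^ (2 * j + w)) / s ^ (j + 1))"
      by (rule summable_comparison_test' [OF sums_summable [OF alpha_series_bound_sums, of X w r], of 0])
         (use alpha_series_term_le [OF s assms] in auto)
    then show "(\<Sum>j. f j s) = alpha_series w \<epsilon> X s * exp (a * s)"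
      unfolding f_def alpha_series_def by (rule suminf_mult2 [symmetric])
  qed
  ultimately show ?thesis by (simp add: sums_unique2)
qed

text \<open>G is a kernel expanded into exponentials. The weight \<open>exp (r * norm (a n))\<close>
  bounds the n-th exponential on the circle, so the summability hypothesis is a Weierstrass
  majorant. The summands of the result are free of r.\<close>

lemma contour_integral_alpha_kernel:
  assumes "r > 0" "\<bar>\<epsilon>\<bar> \<le> 1" "X \<ge> 0" and s: "summable (\<lambda>n. norm (b n) * exp (r * norm (a n)))"
    and G: "\<And>s. norm s = r \<Longrightarrow> (\<lambda>n. b n * exp (a n * s)) sums G s"
  shows "(\<lambda>n. b n * (of_real (X ^ w) * bessel_series w (of_real (\<epsilon> * X\<^sup>2) * a n))) sums
    (1 / (2 * of_real pi * \<i>) * contour_integral (circlepath 0 r) (\<lambda>s. alpha_series w \<epsilon> X s * G s))"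
proof -
  define f where "f n s = b n * (alpha_series w \<epsilon> X s * exp (a n * s))" for n s
  have "(\<lambda>n. contour_integral (circlepath 0 r) (f n)) sums contour_integral (circlepath 0 r) (\<lambda>s. \<Sum>n. f n s)"
  proof (rule contour_integral_circlepath_suminf)
    show "continuous_on (sphere 0 r) (f n)" for n
      unfolding f_def using assms by (auto intro!: continuous_intros continuous_on_alpha_series)
    show "norm (f n s) \<le> (X ^ w / r * exp (X\<^sup>2 / r)) * (norm (b n) * exp (r * norm (a n)))" if s: "norm s = r" for n s
    proof -
      have "norm (exp (a n * s)) \<le> exp (r * norm (a n))"
        using norm_exp [of "a n * s"] s by (simp add: norm_mult mult.commute)
      then have "norm (alpha_series w \<epsilon> X s) * norm (exp (a n * s)) \<le> (X ^ w / r * exp (X\<^sup>2 / r)) * exp (r * norm (a n))"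
        using norm_alpha_series_le [OF s assms(1,2,3), of w] assms by (intro mult_mono) auto
      then have "norm (b n) * (norm (alpha_series w \<epsilon> X s) * norm (exp (a n * s))) \<le>
          norm (b n) * ((X ^ w / r * exp (X\<^sup>2 / r)) * exp (r * norm (a n)))"
        by (rule mult_left_mono) auto
      then show ?thesis
        unfolding f_def norm_mult by (simp add: mult_ac)
    qed
  qed (use assms in \<open>auto intro!: summable_mult\<close>)
  moreover have "contour_integral (circlepath 0 r) (\<lambda>s. \<Sum>n. f n s) =
      contour_integral (circlepath 0 r) (\<lambda>s. alpha_series w \<epsilon> X s * G s)"
  proof (rule contour_integral_eq)
    fix s assume "s \<in> path_image (circlepath 0 r)"
    then have s: "norm s = r" using assms by simp
    show "(\<Sum>n. f n s) = alpha_series w \<epsilon> X s * G s"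
      using sums_mult [OF G [OF s], of "alpha_series w \<epsilon> X s"]
      unfolding f_def by (simp add: sums_iff mult_ac)
  qed
  moreover have "contour_integral (circlepath 0 r) (f n) =
      b n * (2 * of_real pi * \<i> * (of_real (X ^ w) * bessel_series w (of_real (\<epsilon> * X\<^sup>2) * a n)))" for n
  proof -
    have "(\<lambda>s. alpha_series w \<epsilon> X s * exp (a n * s)) contour_integrable_on circlepath 0 r"
      using assms by (intro contour_integrable_continuous_circlepath continuous_intros) (auto intro!: continuous_on_alpha_series)
    then show ?thesis
      unfolding f_def using contour_integral_alpha_exp [OF assms(1,2,3), of w "a n"]
      by (simp add: contour_integral_lmul)
  qed
  ultimately have "(\<lambda>n. b n * (2 * of_real pi * \<i> * (of_real (X ^ w) * bessel_series w (of_real (\<epsilon> * X\<^sup>2) * a n)))) sums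
     contour_integral (circlepath 0 r) (\<lambda>s. alpha_series w \<epsilon> X s * G s)"
    by simp
  from sums_mult [OF this, of "1 / (2 * of_real pi * \<i>)"] show ?thesis
    by (simp add: field_simps)
qed


section \<open>Incomplete gamma functions and the integral over t\<close>

text \<open>The derivative telescopes, leaving only the top term. Hence the truncated exponential is
  an antiderivative of the integrand of the incomplete gamma function, up to sign and K!.\<close>

lemma exp_truncated_deriv:
  "((\<lambda>u. exp (- u) * (\<Sum>j\<le>K. u ^ j / fact j)) has_real_derivative - (exp (- u) * u ^ K / fact K)) (at u)"
proof (induction K)
  case 0
  then show ?case by (auto intro!: derivative_eq_intros)
next
  case (Suc K)
  have "((\<lambda>u. exp (- u) * (u ^ Suc K / fact (Suc K))) has_real_derivative
      (- exp (- u) * (u ^ Suc K / fact (Suc K)) + exp (- u) * (real (Suc K) * u ^ K / fact (Suc K)))) (at u)"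
    by (auto intro!: derivative_eq_intros simp: diff_divide_distrib mult_ac simp del: fact_Suc power_Suc of_nat_Suc)
  moreover have "real (Suc K) * u ^ K / fact (Suc K) = u ^ K / fact K"
    by (simp del: of_nat_Suc)
  ultimately have "((\<lambda>u. exp (- u) * (u ^ Suc K / fact (Suc K))) has_real_derivative
      (- exp (- u) * (u ^ Suc K / fact (Suc K)) + exp (- u) * (u ^ K / fact K))) (at u)"
    by (simp only:)
  from DERIV_add [OF Suc this] show ?case
    by (simp add: ring_distribs del: fact_Suc power_Suc)
qed

lemma exp_truncated_tendsto_0: "((\<lambda>u::real. exp (- u) * (\<Sum>j\<le>K. u ^ j / fact j)) \<longlongrightarrow> 0) at_top"
proof -
  have "((\<lambda>u::real. \<Sum>j\<le>K. u ^ j / exp u / fact j) \<longlongrightarrow> (\<Sum>j\<le>K. 0 / fact j)) at_top"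
    by (intro tendsto_intros tendsto_power_div_exp_0) auto
  then show ?thesis
    by (simp add: sum_distrib_left exp_minus field_simps)
qed

text \<open>Stated as a Bochner integral because the later exchange of sum and integral rests on
  Lebesgue theory.\<close>

lemma gamma_tail_has_integral:
  fixes a b :: real
  assumes "a > 0" "b \<ge> 0"
  shows "has_bochner_integral lborel (\<lambda>t. indicator {b..} t *\<^sub>R (t ^ K * exp (- (a * t))))
     (fact K / a ^ Suc K * (exp (- (a * b)) * (\<Sum>j\<le>K. (a * b) ^ j / fact j)))"
proof (rule has_bochner_integral_nn_integral)
  define G where "G t = - (fact K / a ^ Suc K) * (exp (- (a * t)) * (\<Sum>j\<le>K. (a * t) ^ j / fact j))" for t
  have D: "DERIV G t :> t ^ K * exp (- (a * t))" for t
  proof -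
    have "DERIV G t :> - (fact K / a ^ Suc K) * (- (exp (- (a * t)) * (a * t) ^ K / fact K) * a)"
      unfolding G_def
      by (intro DERIV_cmult DERIV_chain2 [OF exp_truncated_deriv]) (auto intro!: derivative_eq_intros)
    moreover have "- (fact K / a ^ Suc K) * (- (exp (- (a * t)) * (a * t) ^ K / fact K) * a) = t ^ K * exp (- (a * t))"
      using assms by (simp add: field_simps)
    ultimately show ?thesis by simp
  qed
  have lim: "(G \<longlongrightarrow> 0) at_top"
  proof -
    have "filterlim (\<lambda>t. a * t) at_top at_top"
      using assms by (intro filterlim_tendsto_pos_mult_at_top [OF tendsto_const]) (auto intro: filterlim_ident)
    from filterlim_compose [OF exp_truncated_tendsto_0 this, of K]
    have "((\<lambda>t. - (fact K / a ^ Suc K) * (exp (- (a * t)) * (\<Sum>j\<le>K. (a * t) ^ j / fact j))) \<longlongrightarrow> - (fact K / a ^ Suc K) * 0) at_top"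
      by (intro tendsto_mult tendsto_const)
    then show ?thesis unfolding G_def by simp
  qed
  have "(\<integral>\<^sup>+x. ennreal (x ^ K * exp (- (a * x))) * indicator {b ..} x \<partial>lborel) = ennreal (0 - G b)"
    using assms by (intro nn_integral_FTC_atLeast D lim) auto
  moreover have "ennreal (x ^ K * exp (- (a * x))) * indicator {b ..} x = ennreal (indicator {b..} x *\<^sub>R (x ^ K * exp (- (a * x))))" for x
    by (auto split: split_indicator)
  ultimately show "(\<integral>\<^sup>+x. ennreal (indicator {b..} x *\<^sub>R (x ^ K * exp (- (a * x)))) \<partial>lborel) =
      ennreal (fact K / a ^ Suc K * (exp (- (a * b)) * (\<Sum>j\<le>K. (a * b) ^ j / fact j)))"
    by (simp add: G_def)
qed (use assms in \<open>auto intro!: mult_nonneg_nonneg divide_nonneg_nonneg sum_nonneg split: split_indicator\<close>)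

text \<open>The two branches of the definition agree in closed form, so the sign of y is immaterial
  from here on. Negative y does occur, in the lower half-plane.\<close>

lemma inc_gamma_eq: "inc_gamma (Suc K) y = fact K * exp (- y) * (\<Sum>j\<le>K. y ^ j / fact j)"
proof (cases "y > 0")
  case True
  have *: "has_bochner_integral lborel (\<lambda>t. indicator {y..} t *\<^sub>R (t ^ K * exp (- t)))
     (fact K * (exp (- y) * (\<Sum>j\<le>K. y ^ j / fact j)))"
    using gamma_tail_has_integral [of 1 y K] True by simp
  then have "set_integrable lborel {y..} (\<lambda>t. t ^ K * exp (- t))"
    unfolding set_integrable_def by (rule integrable.intros)
  then have "(LINT t : {y..} | lborel. t ^ K * exp (- t)) = integral {y..} (\<lambda>t. t ^ K * exp (- t))"
    by (rule set_borel_integral_eq_integral)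
  then show ?thesis
    using True * by (simp add: inc_gamma_def set_lebesgue_integral_def has_bochner_integral_iff)
next
  case False
  then show ?thesis by (simp add: inc_gamma_def lessThan_Suc_atMost)
qed

lemma gamma_tail_inc_gamma:
  fixes a :: real
  assumes "a > 0"
  shows "has_bochner_integral lborel (\<lambda>t. indicator {1..} t *\<^sub>R (t ^ K * exp (- (a * t)))) (inc_gamma (Suc K) a / a ^ Suc K)"
  using gamma_tail_has_integral [OF assms, of 1 K] by (simp add: inc_gamma_eq mult_ac)

lemma inc_gamma_nonneg: "y \<ge> 0 \<Longrightarrow> inc_gamma (Suc K) y \<ge> 0"
  by (auto simp: inc_gamma_eq intro!: mult_nonneg_nonneg sum_nonneg)

text \<open>The polynomial factor is traded for exp(y/8). With y = 4 \<pi> v n the remaining rate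
  7/8 exceeds the 1/2 lost to the growth of q^(-n), and leaves room for the Bessel growth.\<close>

lemma inc_gamma_le:
  assumes "y \<ge> 0"
  shows "inc_gamma (Suc K) y \<le> fact K * 8 ^ K * exp (- (7 / 8 * y))"
proof -
  have "(\<Sum>j\<le>K. y ^ j / fact j) \<le> (\<Sum>j\<le>K. 8 ^ K * ((y / 8) ^ j / fact j))"
  proof (rule sum_mono)
    fix j assume "j \<in> {..K}"
    then have "(8::real) ^ j \<le> 8 ^ K" by (intro power_increasing) auto
    then have "8 ^ j * ((y / 8) ^ j / fact j) \<le> 8 ^ K * ((y / 8) ^ j / fact j)"
      using assms by (intro mult_right_mono) auto
    then show "y ^ j / fact j \<le> 8 ^ K * ((y / 8) ^ j / fact j)"
      by (simp add: power_divide)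
  qed
  also have "\<dots> \<le> 8 ^ K * exp (y / 8)"
    unfolding sum_distrib_left [symmetric]
    using sum_le_suminf [OF sums_summable [OF exp_sums_real [of "y / 8"]], of "{..K}"] exp_sums_real [of "y / 8"] assms
    by (intro mult_left_mono) (auto simp: sums_iff)
  finally have "fact K * exp (- y) * (\<Sum>j\<le>K. y ^ j / fact j) \<le> fact K * exp (- y) * (8 ^ K * exp (y / 8))"
    by (intro mult_left_mono) auto
  also have "\<dots> = fact K * 8 ^ K * (exp (- y) * exp (y / 8))"
    by simp
  also have "exp (- y) * exp (y / 8) = exp (- (7 / 8 * y))"
    by (simp flip: exp_add)
  finally show ?thesis by (simp add: inc_gamma_eq)
qed

lemma summable_power_times_geometric:
  fixes y :: real
  assumes "0 \<le> y" "y < 1"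
  shows "summable (\<lambda>n. real (Suc n) ^ p * y ^ Suc n)"
proof -
  have "summable (\<lambda>l. of_nat (Suc l) ^ p * (of_real y :: complex) ^ Suc l)"
    using assms by (intro sums_summable [OF polylog_neg_sums]) simp
  also have "(\<lambda>l. of_nat (Suc l) ^ p * (of_real y :: complex) ^ Suc l) = (\<lambda>n. of_real (real (Suc n) ^ p * y ^ Suc n))"
    by simp
  finally show ?thesis
    by (simp only: summable_of_real_iff)
qed

text \<open>Both half-planes at once: \<omega> is the inverse of e(d/c + \<tau>) with \<sigma> = 1
  above the real axis, and e(d/c + \<tau>) itself with \<sigma> = -1 below it, where x = 4 \<pi>
  |v|. After expanding the polylogarithm, the integral over s gives a Bessel series and the integral
  over t an incomplete gamma value.\<close>

lemma laplace_contour_series: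
  fixes F :: "real \<Rightarrow> complex"
  assumes x: "x > 0" and r: "0 < r" "r < x / 2" and \<omega>: "norm \<omega> = exp (x / 2)" and \<sigma>: "norm \<sigma> = 1" and X: "X \<ge> 0"
    and F: "\<And>t. t \<ge> 1 \<Longrightarrow> F t = of_real (t ^ K) * contour_integral (circlepath 0 r)
       (\<lambda>s. alpha_series (Suc K) (-1) X s * polylog_neg (Suc K) (exp (\<sigma> * s) * (of_real (exp (- (x * t))) * \<omega>)))"
  shows "F integrable_on {1..}"
    and "(\<lambda>n. \<omega> ^ Suc n * (of_real (X ^ Suc K) * bessel_series (Suc K) (- of_real (X\<^sup>2) * (\<sigma> * of_nat (Suc n))))
            * of_real (inc_gamma (Suc K) (x * real (Suc n)))) sums
          (of_real (x ^ Suc K) * (1 / (2 * of_real pi * \<i>) * integral {1..} F))"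
proof -
  define B where "B n = of_real (X ^ Suc K) * bessel_series (Suc K) (- of_real (X\<^sup>2) * (\<sigma> * of_nat (Suc n)))" for n
  define C where "C n = of_nat (Suc n) ^ Suc K * \<omega> ^ Suc n * (2 * of_real pi * \<i> * B n)" for n
  define f where "f n t = indicator {1..} t *\<^sub>R (C n * of_real (t ^ K * exp (- (x * real (Suc n) * t))))" for n t
  define M where "M = X ^ Suc K * exp (X\<^sup>2 / (x / 8))"
  have M0: "M \<ge> 0" using X by (simp add: M_def)
  \<comment> \<open>The rate \<rho> = x/8 is chosen such that, together with x/2 from \<omega>, the
    growth 5x/8 stays below the decay rates x (for fixed t) and 7x/8 (after integration).\<close>
  have B: "norm (B n) \<le> M * exp (x / 8 * real (Suc n))" for n
    using norm_bessel_series_le [of "x / 8" "real (Suc n)" "- of_real (X\<^sup>2) * (\<sigma> * of_nat (Suc n))" "X\<^sup>2" "Suc K"] x \<sigma> X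
    unfolding B_def M_def by (simp add: norm_mult norm_power mult_ac mult_left_mono del: of_nat_Suc)
  have C: "norm (C n) \<le> 2 * pi * M * (real (Suc n) ^ Suc K * exp (5 / 8 * x * real (Suc n)))" for n
  proof -
    have "norm (C n) = 2 * pi * real (Suc n) ^ Suc K * exp (x / 2 * real (Suc n)) * norm (B n)"
      unfolding C_def by (simp add: norm_mult norm_power \<omega> exp_of_nat_mult [symmetric] mult_ac del: of_nat_Suc power_Suc)
    also have "\<dots> \<le> 2 * pi * real (Suc n) ^ Suc K * exp (x / 2 * real (Suc n)) * (M * exp (x / 8 * real (Suc n)))"
      by (intro mult_left_mono B) auto
    also have "\<dots> = 2 * pi * M * (real (Suc n) ^ Suc K * (exp (x / 2 * real (Suc n)) * exp (x / 8 * real (Suc n))))"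
      by (simp only: mult_ac)
    also have "exp (x / 2 * real (Suc n)) * exp (x / 8 * real (Suc n)) = exp (5 / 8 * x * real (Suc n))"
      unfolding exp_add [symmetric] by (rule arg_cong [where f = exp]) (simp add: field_simps)
    finally show ?thesis .
  qed
  have integral_f: "has_bochner_integral lborel (f n) (C n * of_real (inc_gamma (Suc K) (x * real (Suc n)) / (x * real (Suc n)) ^ Suc K))" for n
  proof -
    have "has_bochner_integral lborel (\<lambda>t. C n * of_real (indicator {1..} t *\<^sub>R (t ^ K * exp (- (x * real (Suc n) * t)))))
       (C n * of_real (inc_gamma (Suc K) (x * real (Suc n)) / (x * real (Suc n)) ^ Suc K))"
      using x by (intro has_bochner_integral_mult_right has_bochner_integral_of_real gamma_tail_inc_gamma) auto
    moreover have "(\<lambda>t. C n * of_real (indicator {1..} t *\<^sub>R (t ^ K * exp (- (x * real (Suc n) * t))))) = f n"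
      unfolding f_def by (auto simp: fun_eq_iff split: split_indicator)
    ultimately show ?thesis by simp
  qed
  have norm_f: "norm (f n t) = indicator {1..} t *\<^sub>R (norm (C n) * (t ^ K * exp (- (x * real (Suc n) * t))))" for n t
    unfolding f_def by (auto simp: norm_mult norm_power split: split_indicator)
  have integral_norm_f: "(\<integral>t. norm (f n t) \<partial>lborel) = norm (C n) * (inc_gamma (Suc K) (x * real (Suc n)) / (x * real (Suc n)) ^ Suc K)" for n
  proof -
    have "has_bochner_integral lborel (\<lambda>t. norm (C n) * (indicator {1..} t *\<^sub>R (t ^ K * exp (- (x * real (Suc n) * t)))))
       (norm (C n) * (inc_gamma (Suc K) (x * real (Suc n)) / (x * real (Suc n)) ^ Suc K))"
      using x by (intro has_bochner_integral_mult_right gamma_tail_inc_gamma) auto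
    moreover have "(\<lambda>t. norm (C n) * (indicator {1..} t *\<^sub>R (t ^ K * exp (- (x * real (Suc n) * t))))) = (\<lambda>t. norm (f n t))"
      unfolding norm_f by (auto simp: fun_eq_iff)
    ultimately show ?thesis by (simp only: has_bochner_integral_iff)
  qed
  have sum_pt: "summable (\<lambda>n. norm (f n t))" for t
  proof (cases "t \<ge> 1")
    case True
    have "summable (\<lambda>n. 2 * pi * M * t ^ K * (real (Suc n) ^ Suc K * exp (- (3 / 8 * x)) ^ Suc n))"
      using x by (intro summable_mult summable_power_times_geometric) auto
    then show ?thesis
    proof (rule summable_comparison_test')
      fix n
      have "norm (f n t) = norm (C n) * (t ^ K * exp (- (x * real (Suc n) * t)))"
        using True by (simp add: norm_f)
      also have "\<dots> \<le> (2 * pi * M * (real (Suc n) ^ Suc K * exp (5 / 8 * x * real (Suc n)))) * (t ^ K * exp (- (x * real (Suc n) * 1)))"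
        using True M0 x C by (intro mult_mono mult_left_mono) (auto intro!: mult_nonneg_nonneg simp del: of_nat_Suc)
      also have "\<dots> = 2 * pi * M * t ^ K * (real (Suc n) ^ Suc K * (exp (5 / 8 * x * real (Suc n)) * exp (- (x * real (Suc n) * 1))))"
        by (simp add: mult_ac)
      also have "exp (5 / 8 * x * real (Suc n)) * exp (- (x * real (Suc n) * 1)) = exp (- (3 / 8 * x)) ^ Suc n"
        unfolding exp_add [symmetric] exp_of_nat_mult [symmetric] by (rule arg_cong [where f = exp]) (simp add: field_simps)
      finally show "norm (norm (f n t)) \<le> 2 * pi * M * t ^ K * (real (Suc n) ^ Suc K * exp (- (3 / 8 * x)) ^ Suc n)"
        by simp
    qed
  qed (simp add: norm_f)
  have sum_int: "summable (\<lambda>n. \<integral>t. norm (f n t) \<partial>lborel)"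
  proof -
    have "summable (\<lambda>n. 2 * pi * M * (fact K * 8 ^ K) / x ^ Suc K * (real (Suc n) ^ 0 * exp (- (1 / 4 * x)) ^ Suc n))"
      using x by (intro summable_mult summable_power_times_geometric) auto
    then show ?thesis
    proof (rule summable_comparison_test')
      fix n
      have g: "inc_gamma (Suc K) (x * real (Suc n)) \<le> fact K * 8 ^ K * exp (- (7 / 8 * (x * real (Suc n))))"
        "inc_gamma (Suc K) (x * real (Suc n)) \<ge> 0"
        using x inc_gamma_le [of "x * real (Suc n)" K] inc_gamma_nonneg [of "x * real (Suc n)" K]
        by (auto simp del: of_nat_Suc)
      have "norm (\<integral>t. norm (f n t) \<partial>lborel) = norm (C n) * (inc_gamma (Suc K) (x * real (Suc n)) / (x * real (Suc n)) ^ Suc K)"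
        using g x by (simp add: integral_norm_f del: of_nat_Suc)
      also have "\<dots> \<le> (2 * pi * M * (real (Suc n) ^ Suc K * exp (5 / 8 * x * real (Suc n)))) *
          (fact K * 8 ^ K * exp (- (7 / 8 * (x * real (Suc n)))) / (x * real (Suc n)) ^ Suc K)"
        using g x C M0 by (intro mult_mono divide_right_mono) (auto intro!: mult_nonneg_nonneg divide_nonneg_nonneg simp del: of_nat_Suc)
      also have "\<dots> = 2 * pi * M * (fact K * 8 ^ K) / x ^ Suc K * (exp (5 / 8 * x * real (Suc n)) * exp (- (7 / 8 * (x * real (Suc n)))))"
        using x by (simp add: power_mult_distrib divide_simps del: of_nat_Suc power_Suc)
      also have "exp (5 / 8 * x * real (Suc n)) * exp (- (7 / 8 * (x * real (Suc n)))) = exp (- (1 / 4 * x)) ^ Suc n"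
        unfolding exp_add [symmetric] exp_of_nat_mult [symmetric] by (rule arg_cong [where f = exp]) (simp add: field_simps)
      finally show "norm (\<integral>t. norm (f n t) \<partial>lborel) \<le> 2 * pi * M * (fact K * 8 ^ K) / x ^ Suc K * (real (Suc n) ^ 0 * exp (- (1 / 4 * x)) ^ Suc n)"
        by simp
    qed
  qed
  have F_eq: "indicator {1..} t *\<^sub>R F t = (\<Sum>n. f n t)" for t
  proof (cases "t \<ge> 1")
    case True
    define y where "y = of_real (exp (- (x * t))) * \<omega>"
    have ny: "norm y \<le> exp (- (x / 2))"
    proof -
      have "norm y = exp (x / 2 - x * t)"
        unfolding y_def norm_mult \<omega> norm_of_real by (simp flip: exp_add)
      also have "\<dots> \<le> exp (- (x / 2))"
        using True x mult_left_mono [of 1 t x] by simp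
      finally show ?thesis .
    qed
    \<comment> \<open>Here t \<ge> 1 and r < x/2 keep the argument of the polylogarithm inside the
      unit disc on the whole circle.\<close>
    have ey: "exp r * norm y < 1"
    proof -
      have "exp r * norm y \<le> exp r * exp (- (x / 2))"
        using ny by (intro mult_left_mono) auto
      also have "\<dots> < 1" using r by (simp flip: exp_add)
      finally show ?thesis .
    qed
    have "(\<lambda>n. (of_nat (Suc n) ^ Suc K * y ^ Suc n) * (of_real (X ^ Suc K) * bessel_series (Suc K) (of_real (-1 * X\<^sup>2) * (\<sigma> * of_nat (Suc n))))) sums
       (1 / (2 * of_real pi * \<i>) * contour_integral (circlepath 0 r) (\<lambda>s. alpha_series (Suc K) (-1) X s * polylog_neg (Suc K) (exp (\<sigma> * s) * y)))"
    proof (rule contour_integral_alpha_kernel)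
      have "summable (\<lambda>n. real (Suc n) ^ Suc K * (exp r * norm y) ^ Suc n)"
        using ey by (intro summable_power_times_geometric) auto
      also have "(\<lambda>n. real (Suc n) ^ Suc K * (exp r * norm y) ^ Suc n) =
          (\<lambda>n. norm (of_nat (Suc n) ^ Suc K * y ^ Suc n) * exp (r * norm (\<sigma> * of_nat (Suc n))))"
        by (simp add: norm_mult norm_power \<sigma> power_mult_distrib exp_of_nat2_mult mult_ac del: of_nat_Suc power_Suc)
      finally show "summable (\<lambda>n. norm (of_nat (Suc n) ^ Suc K * y ^ Suc n) * exp (r * norm (\<sigma> * of_nat (Suc n))))" .
      fix s :: complex assume s: "norm s = r"
      have "norm (exp (\<sigma> * s)) \<le> exp r"
        using norm_exp [of "\<sigma> * s"] s \<sigma> by (simp add: norm_mult)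
      then have "norm (exp (\<sigma> * s) * y) \<le> exp r * norm y"
        by (simp add: norm_mult mult_right_mono)
      with ey have "norm (exp (\<sigma> * s) * y) < 1" by linarith
      from polylog_neg_sums [OF this, of "Suc K"]
      have "(\<lambda>l. of_nat (Suc l) ^ Suc K * (exp (\<sigma> * s) * y) ^ Suc l) sums polylog_neg (Suc K) (exp (\<sigma> * s) * y)" .
      moreover have "of_nat (Suc l) ^ Suc K * (exp (\<sigma> * s) * y) ^ Suc l =
          of_nat (Suc l) ^ Suc K * y ^ Suc l * exp (\<sigma> * of_nat (Suc l) * s)" for l
      proof -
        have "exp (\<sigma> * of_nat (Suc l) * s) = exp (\<sigma> * s) ^ Suc l"
          unfolding exp_of_nat_mult [symmetric] by (simp add: mult_ac del: of_nat_Suc)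
        then show ?thesis by (simp add: power_mult_distrib mult_ac del: of_nat_Suc power_Suc)
      qed
      ultimately show "(\<lambda>n. of_nat (Suc n) ^ Suc K * y ^ Suc n * exp (\<sigma> * of_nat (Suc n) * s)) sums
          polylog_neg (Suc K) (exp (\<sigma> * s) * y)"
        by (simp only:)
    qed (use r X in auto)
    then have "(\<lambda>n. of_real (t ^ K) * (2 * of_real pi * \<i>) * ((of_nat (Suc n) ^ Suc K * y ^ Suc n) * B n)) sums
       (of_real (t ^ K) * (2 * of_real pi * \<i>) * (1 / (2 * of_real pi * \<i>) * contour_integral (circlepath 0 r) (\<lambda>s. alpha_series (Suc K) (-1) X s * polylog_neg (Suc K) (exp (\<sigma> * s) * y))))"
      unfolding B_def by (intro sums_mult) (simp del: of_nat_Suc power_Suc)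
    also have "of_real (t ^ K) * (2 * of_real pi * \<i>) * (1 / (2 * of_real pi * \<i>) * contour_integral (circlepath 0 r) (\<lambda>s. alpha_series (Suc K) (-1) X s * polylog_neg (Suc K) (exp (\<sigma> * s) * y))) = F t"
    proof -
      have "a * u * (1 / u * z) = a * z" if "u \<noteq> 0" for a u z :: complex
        using that by simp
      from this [of "2 * of_real pi * \<i>"] show ?thesis
        unfolding F [OF True] y_def by simp
    qed
    also have "(\<lambda>n. of_real (t ^ K) * (2 * of_real pi * \<i>) * ((of_nat (Suc n) ^ Suc K * y ^ Suc n) * B n)) = (\<lambda>n. f n t)"
    proof
      fix n
      have "y ^ Suc n = of_real (exp (- (x * real (Suc n) * t))) * \<omega> ^ Suc n"
      proof -
        have "exp (- (x * t)) ^ Suc n = exp (- (x * real (Suc n) * t))"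
          unfolding exp_of_nat_mult [symmetric] by (simp add: mult_ac del: of_nat_Suc)
        then show ?thesis
          unfolding y_def power_mult_distrib by (simp only: of_real_power [symmetric])
      qed
      then show "of_real (t ^ K) * (2 * of_real pi * \<i>) * ((of_nat (Suc n) ^ Suc K * y ^ Suc n) * B n) = f n t"
        using True unfolding f_def C_def by (simp add: mult_ac del: of_nat_Suc power_Suc)
    qed
    finally show ?thesis using True by (simp add: sums_iff)
  qed (simp add: f_def)
  have int: "integrable lborel (\<lambda>t. \<Sum>n. f n t)"
    using integral_f sum_pt sum_int by (intro integrable_suminf) (auto simp: has_bochner_integral_iff)
  then have si: "set_integrable lborel {1..} F"
    unfolding set_integrable_def F_eq .
  then show "F integrable_on {1..}"
    by (rule set_borel_integral_eq_integral)
  have "(\<lambda>n. integral\<^sup>L lborel (f n)) sums (\<integral>t. (\<Sum>n. f n t) \<partial>lborel)"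
    using integral_f sum_pt sum_int by (intro sums_integral) (auto simp: has_bochner_integral_iff)
  also have "(\<integral>t. (\<Sum>n. f n t) \<partial>lborel) = integral {1..} F"
    using set_borel_integral_eq_integral(2) [OF si] unfolding set_lebesgue_integral_def F_eq .
  finally have "(\<lambda>n. of_real (x ^ Suc K) * (1 / (2 * of_real pi * \<i>) * integral\<^sup>L lborel (f n))) sums
     (of_real (x ^ Suc K) * (1 / (2 * of_real pi * \<i>) * integral {1..} F))"
    by (intro sums_mult)
  \<comment> \<open>The power of \<open>Suc n\<close> coming from the polylogarithm cancels the one
    in the denominator of the gamma integral.\<close>
  moreover have "of_real (x ^ Suc K) * (1 / (2 * of_real pi * \<i>) * integral\<^sup>L lborel (f n)) =
     \<omega> ^ Suc n * B n * of_real (inc_gamma (Suc K) (x * real (Suc n)))" for n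
    using integral_f [of n] x unfolding C_def has_bochner_integral_iff
    by (simp add: power_mult_distrib divide_simps del: of_nat_Suc power_Suc) (simp only: mult_ac)
  ultimately show "(\<lambda>n. \<omega> ^ Suc n * (of_real (X ^ Suc K) * bessel_series (Suc K) (- of_real (X\<^sup>2) * (\<sigma> * of_nat (Suc n))))
            * of_real (inc_gamma (Suc K) (x * real (Suc n)))) sums
          (of_real (x ^ Suc K) * (1 / (2 * of_real pi * \<i>) * integral {1..} F))"
    unfolding B_def by simp
qed


section \<open>Expansions of the kernels in both half-planes\<close>

text \<open>Times sqrt n, this is half the Bessel argument 4 \<pi> sqrt(m n) / c.\<close>

definition bessel_scale :: "nat \<Rightarrow> nat \<Rightarrow> real" where
  "bessel_scale m c = 2 * pi * sqrt (real m) / real c"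

lemma bessel_scale_nonneg [simp]: "bessel_scale m c \<ge> 0"
  by (simp add: bessel_scale_def)

lemma bessel_scale_squared: "(bessel_scale m c)\<^sup>2 = 4 * pi\<^sup>2 * real m / (real c)\<^sup>2"
  by (simp add: bessel_scale_def power_divide power_mult_distrib)

lemma nat_weight_simps:
  "nat (int j + 1 - - int K) = j + Suc K" "nat (2 * int j + 1 - - int K) = 2 * j + Suc K"
  by auto

lemma alpha_plus_eq: "alpha_plus (- int K) m c = alpha_series (Suc K) 1 (bessel_scale m c)"
  unfolding fun_eq_iff alpha_plus_def alpha_series_def bessel_scale_def nat_weight_simps by simp

lemma alpha_minus_eq: "alpha_minus (- int K) m c = alpha_series (Suc K) (-1) (bessel_scale m c)"
  unfolding fun_eq_iff alpha_minus_def alpha_series_def bessel_scale_def nat_weight_simps by simp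

lemma zeta_qq: "zeta c d * qq \<tau> = ee (of_int d / of_nat c + \<tau>)"
  by (simp add: zeta_def qq_def ee_add)

lemma zeta_qq_inverse: "zeta c (- d) * inverse (qq \<tau>) = inverse (ee (of_int d / of_nat c + \<tau>))"
  by (simp add: zeta_def qq_def ee_add ee_minus)

lemma norm_ee_shift: "norm (ee (of_int d / of_nat c + \<tau>)) = exp (- (2 * pi * Im \<tau>))"
  by (simp add: norm_ee)

text \<open>The factor \<omega> is the part e(d/c + \<tau>) of the exponential that accompanies
  \<phi>+ in H+. With it the kernel is a geometric series in exp(s) \<omega> starting at exponent
  1.\<close>

lemma phi_plus_upper:
  assumes "0 < r" "r < 2 * pi * Im \<tau>"
  defines "\<omega> \<equiv> \<lambda>c d. ee (of_int d / of_nat c + \<tau>)"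
  shows "(\<lambda>n. \<omega> c d ^ Suc n * (of_real (bessel_scale m c ^ Suc K) * bessel_series (Suc K) (of_real ((bessel_scale m c)\<^sup>2) * of_nat (Suc n))))
     sums (\<omega> c d * phi_plus (- int K) m r c d \<tau>)"
proof -
  let ?w = "\<omega> c d"
  have w: "exp r * norm ?w < 1"
    using assms by (simp add: norm_ee_shift flip: exp_add)
  have 1: "(\<lambda>n. ?w ^ Suc n * (of_real (bessel_scale m c ^ Suc K) * bessel_series (Suc K) (of_real (1 * (bessel_scale m c)\<^sup>2) * of_nat (Suc n)))) sums
     (1 / (2 * of_real pi * \<i>) * contour_integral (circlepath 0 r) (\<lambda>s. alpha_series (Suc K) 1 (bessel_scale m c) s * (exp s * ?w / (1 - exp s * ?w))))"
  proof (rule contour_integral_alpha_kernel)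
    have "summable (\<lambda>n. real (Suc n) ^ 0 * (exp r * norm ?w) ^ Suc n)"
      using w by (intro summable_power_times_geometric) auto
    then show "summable (\<lambda>n. norm (?w ^ Suc n) * exp (r * norm (of_nat (Suc n) :: complex)))"
      by (simp add: norm_power norm_mult power_mult_distrib exp_of_nat2_mult mult_ac del: of_nat_Suc power_Suc)
    fix s :: complex assume s: "norm s = r"
    have "norm (exp s * ?w) \<le> exp r * norm ?w"
      using norm_exp [of s] s by (simp add: norm_mult mult_right_mono)
    with w have "norm (exp s * ?w) < 1" by linarith
    from polylog_neg_sums [OF this, of 0]
    have "(\<lambda>n. (exp s * ?w) ^ Suc n) sums (exp s * ?w / (1 - exp s * ?w))"
      by (simp add: polylog_neg_0)
    then show "(\<lambda>n. ?w ^ Suc n * exp (of_nat (Suc n) * s)) sums (exp s * ?w / (1 - exp s * ?w))"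
      by (simp only: power_mult_distrib exp_of_nat_mult) (simp only: mult.commute)
  qed (use assms in auto)
  have eq: "contour_integral (circlepath 0 r) (\<lambda>s. alpha_series (Suc K) 1 (bessel_scale m c) s * (exp s * ?w / (1 - exp s * ?w))) =
     contour_integral (circlepath 0 r) (\<lambda>s. ?w * (alpha_plus (- int K) m c s * exp s / (1 - exp s * zeta c d * qq \<tau>)))"
    by (rule contour_integral_eq) (simp add: alpha_plus_eq \<omega>_def mult_ac flip: zeta_qq)
  have int: "(\<lambda>s. alpha_plus (- int K) m c s * exp s / (1 - exp s * zeta c d * qq \<tau>)) contour_integrable_on circlepath 0 r"
  proof (rule contour_integrable_continuous_circlepath)
    have "1 - exp s * zeta c d * qq \<tau> \<noteq> 0" if "norm s = r" for s
    proof
      assume "1 - exp s * zeta c d * qq \<tau> = 0"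
      then have "norm (exp s * ?w) = 1"
        by (simp add: \<omega>_def mult.assoc flip: zeta_qq)
      moreover have "norm (exp s * ?w) \<le> exp r * norm ?w"
        using norm_exp [of s] that by (simp add: norm_mult mult_right_mono)
      ultimately show False using w by simp
    qed
    then show "continuous_on (path_image (circlepath 0 r)) (\<lambda>s. alpha_plus (- int K) m c s * exp s / (1 - exp s * zeta c d * qq \<tau>))"
      using assms unfolding alpha_plus_eq by (auto intro!: continuous_intros continuous_on_alpha_series)
  qed
  have 2: "1 / (2 * of_real pi * \<i>) * contour_integral (circlepath 0 r) (\<lambda>s. alpha_series (Suc K) 1 (bessel_scale m c) s * (exp s * ?w / (1 - exp s * ?w))) =
     ?w * phi_plus (- int K) m r c d \<tau>"
    unfolding phi_plus_def eq contour_integral_lmul [OF int] by simp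
  from 1 show ?thesis unfolding 2 by (simp del: of_nat_Suc power_Suc)
qed

text \<open>Now |q| > 1 and the geometric series runs over inverse powers. It carries a minus sign
  and starts at n = 0: the extra term is the one that cancels the constant term of H+. The Bessel
  arguments change sign, so J replaces I.\<close>

lemma phi_plus_lower:
  assumes "0 < r" "r < - (2 * pi * Im \<tau>)"
  defines "\<omega> \<equiv> \<lambda>c d. ee (of_int d / of_nat c + \<tau>)"
  shows "(\<lambda>n. - (inverse (\<omega> c d) ^ n * (of_real (bessel_scale m c ^ Suc K) * bessel_series (Suc K) (- of_real ((bessel_scale m c)\<^sup>2) * of_nat n))))
     sums (\<omega> c d * phi_plus (- int K) m r c d \<tau>)"
proof -
  let ?w = "\<omega> c d"
  have w0: "?w \<noteq> 0" by (simp add: \<omega>_def)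
  have w: "exp r * norm (inverse ?w) < 1"
    using assms by (simp add: norm_ee_shift norm_inverse flip: exp_add exp_minus)
  have gt: "norm (exp (- s) * inverse ?w) < 1" if "norm s = r" for s
  proof -
    have "norm (exp (- s) * inverse ?w) \<le> exp r * norm (inverse ?w)"
      using norm_exp [of "- s"] that by (simp add: norm_mult mult_right_mono del: norm_exp_eq_Re)
    with w show ?thesis by linarith
  qed
  have nz: "1 - exp s * ?w \<noteq> 0" if "norm s = r" for s
  proof
    assume "1 - exp s * ?w = 0"
    then have "exp s * ?w = 1" by simp
    then have "exp (- s) * inverse ?w = 1"
      by (simp add: exp_minus flip: inverse_mult_distrib)
    with gt [OF that] show False by simp
  qed
  have 1: "(\<lambda>n. (- (inverse ?w ^ n)) * (of_real (bessel_scale m c ^ Suc K) * bessel_series (Suc K) (of_real (1 * (bessel_scale m c)\<^sup>2) * (- of_nat n)))) sums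
     (1 / (2 * of_real pi * \<i>) * contour_integral (circlepath 0 r) (\<lambda>s. alpha_series (Suc K) 1 (bessel_scale m c) s * (exp s * ?w / (1 - exp s * ?w))))"
  proof (rule contour_integral_alpha_kernel)
    have "summable (\<lambda>n. (exp r * norm (inverse ?w)) ^ n)"
      using w by (intro summable_geometric) auto
    then show "summable (\<lambda>n. norm (- (inverse ?w ^ n)) * exp (r * norm (- of_nat n :: complex)))"
      by (simp add: norm_power norm_mult power_mult_distrib exp_of_nat2_mult mult_ac norm_inverse)
    fix s :: complex assume s: "norm s = r"
    have "(\<lambda>n. - ((exp (- s) * inverse ?w) ^ n)) sums (- (1 / (1 - exp (- s) * inverse ?w)))"
      using gt [OF s] by (intro sums_minus geometric_sums)
    also have "- (1 / (1 - exp (- s) * inverse ?w)) = exp s * ?w / (1 - exp s * ?w)"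
      using nz [OF s] w0 by (simp add: exp_minus divide_simps) (simp add: algebra_simps)
    finally show "(\<lambda>n. - (inverse ?w ^ n) * exp (- of_nat n * s)) sums (exp s * ?w / (1 - exp s * ?w))"
      using exp_of_nat_mult [of _ "- s"] by (simp add: power_mult_distrib mult.commute)
  qed (use assms in auto)
  have eq: "contour_integral (circlepath 0 r) (\<lambda>s. alpha_series (Suc K) 1 (bessel_scale m c) s * (exp s * ?w / (1 - exp s * ?w))) =
     contour_integral (circlepath 0 r) (\<lambda>s. ?w * (alpha_plus (- int K) m c s * exp s / (1 - exp s * zeta c d * qq \<tau>)))"
    by (rule contour_integral_eq) (simp add: alpha_plus_eq \<omega>_def mult_ac flip: zeta_qq)
  have int: "(\<lambda>s. alpha_plus (- int K) m c s * exp s / (1 - exp s * zeta c d * qq \<tau>)) contour_integrable_on circlepath 0 r"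
  proof (rule contour_integrable_continuous_circlepath)
    have "1 - exp s * zeta c d * qq \<tau> \<noteq> 0" if "norm s = r" for s
      using nz [OF that] by (simp add: \<omega>_def mult.assoc flip: zeta_qq)
    then show "continuous_on (path_image (circlepath 0 r)) (\<lambda>s. alpha_plus (- int K) m c s * exp s / (1 - exp s * zeta c d * qq \<tau>))"
      using assms unfolding alpha_plus_eq by (auto intro!: continuous_intros continuous_on_alpha_series)
  qed
  have 2: "1 / (2 * of_real pi * \<i>) * contour_integral (circlepath 0 r) (\<lambda>s. alpha_series (Suc K) 1 (bessel_scale m c) s * (exp s * ?w / (1 - exp s * ?w))) =
     ?w * phi_plus (- int K) m r c d \<tau>"
    unfolding phi_plus_def eq contour_integral_lmul [OF int] by simp
  from 1 show ?thesis unfolding 2 by (simp del: power_Suc)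
qed

lemma exp_diff_of_real: "exp (s - of_real y) = exp s * of_real (exp (- y) :: real)" for s :: complex
  by (simp add: exp_diff exp_minus exp_of_real field_simps)

text \<open>Although 1/q is large, exp(-4 \<pi> v t) with t \<ge> 1 outweighs it, and the
  polylogarithm can be expanded at 0.\<close>

lemma phi_minus_upper:
  assumes "0 < r" "r < 2 * pi * Im \<tau>"
  defines "\<omega> \<equiv> \<lambda>c d. ee (of_int d / of_nat c + \<tau>)"
  shows "phi_minus_integrand (- int K) m r c d \<tau> integrable_on {1..}"
    and "(\<lambda>n. inverse (\<omega> c d) ^ Suc n * (of_real (bessel_scale m c ^ Suc K) * bessel_series (Suc K) (- of_real ((bessel_scale m c)\<^sup>2) * of_nat (Suc n)))
           * of_real (inc_gamma (Suc K) (4 * pi * Im \<tau> * real (Suc n)))) sums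
         (of_real ((4 * pi * Im \<tau>) ^ Suc K) * phi_minus (- int K) m r c d \<tau>)"
proof -
  let ?F = "phi_minus_integrand (- int K) m r c d \<tau>"
  have F: "?F t = of_real (t ^ K) * contour_integral (circlepath 0 r)
       (\<lambda>s. alpha_series (Suc K) (-1) (bessel_scale m c) s * polylog_neg (Suc K) (exp (1 * s) * (of_real (exp (- (4 * pi * Im \<tau> * t))) * inverse (\<omega> c d))))" for t
  proof -
    have "exp (s - of_real (4 * pi * Im \<tau> * t)) * zeta c (- d) * inverse (qq \<tau>) =
        exp (1 * s) * (of_real (exp (- (4 * pi * Im \<tau> * t))) * inverse (\<omega> c d))" for s
      unfolding \<omega>_def zeta_qq_inverse [symmetric] by (simp only: exp_diff_of_real mult_1 mult.assoc)
    moreover have "nat (1 - - int K) = Suc K" by auto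
    ultimately show ?thesis
      unfolding phi_minus_integrand_def alpha_minus_eq by simp
  qed
  have *: "0 < 4 * pi * Im \<tau>" "0 < r" "r < 4 * pi * Im \<tau> / 2" "norm (inverse (\<omega> c d)) = exp (4 * pi * Im \<tau> / 2)"
    using assms by (auto simp: norm_inverse norm_ee_shift exp_minus)
  show "?F integrable_on {1..}"
    by (rule laplace_contour_series(1) [OF * _ _ F]) auto
  show "(\<lambda>n. inverse (\<omega> c d) ^ Suc n * (of_real (bessel_scale m c ^ Suc K) * bessel_series (Suc K) (- of_real ((bessel_scale m c)\<^sup>2) * of_nat (Suc n)))
           * of_real (inc_gamma (Suc K) (4 * pi * Im \<tau> * real (Suc n)))) sums
         (of_real ((4 * pi * Im \<tau>) ^ Suc K) * phi_minus (- int K) m r c d \<tau>)"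
    using laplace_contour_series(2) [OF * _ _ F] unfolding phi_minus_def by (simp del: of_nat_Suc power_Suc)
qed

text \<open>The argument of the polylogarithm lies outside the unit disc; inversion brings it back
  inside. The sign (-1)^(K + 2) of the inversion formula is 1 because K is even.\<close>

lemma phi_minus_lower:
  assumes "even K" "0 < r" "r < - (2 * pi * Im \<tau>)"
  defines "\<omega> \<equiv> \<lambda>c d. ee (of_int d / of_nat c + \<tau>)"
  shows "phi_minus_integrand (- int K) m r c d \<tau> integrable_on {1..}"
    and "(\<lambda>n. \<omega> c d ^ Suc n * (of_real (bessel_scale m c ^ Suc K) * bessel_series (Suc K) (of_real ((bessel_scale m c)\<^sup>2) * of_nat (Suc n)))
           * of_real (inc_gamma (Suc K) (- (4 * pi * Im \<tau>) * real (Suc n)))) sums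
         (of_real ((- (4 * pi * Im \<tau>)) ^ Suc K) * phi_minus (- int K) m r c d \<tau>)"
proof -
  let ?F = "phi_minus_integrand (- int K) m r c d \<tau>"
  define x where "x = - (4 * pi * Im \<tau>)"
  have *: "0 < x" "0 < r" "r < x / 2" "norm (\<omega> c d) = exp (x / 2)"
    using assms by (auto simp: norm_inverse norm_ee_shift x_def)
  have F: "?F t = of_real (t ^ K) * contour_integral (circlepath 0 r)
       (\<lambda>s. alpha_series (Suc K) (-1) (bessel_scale m c) s * polylog_neg (Suc K) (exp (- 1 * s) * (of_real (exp (- (x * t))) * \<omega> c d)))"
    if t: "t \<ge> 1" for t
  proof -
    have eq: "polylog_neg (Suc K) (exp (s - of_real (4 * pi * Im \<tau> * t)) * zeta c (- d) * inverse (qq \<tau>)) =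
        polylog_neg (Suc K) (exp (- 1 * s) * (of_real (exp (- (x * t))) * \<omega> c d))" if s: "norm s = r" for s
    proof -
      define y where "y = exp (- 1 * s) * (of_real (exp (- (x * t))) * \<omega> c d)"
      have y0: "y \<noteq> 0" by (simp add: y_def \<omega>_def)
      have inv: "exp (s - of_real (4 * pi * Im \<tau> * t)) * zeta c (- d) * inverse (qq \<tau>) = inverse y"
      proof -
        have "exp (s - of_real (4 * pi * Im \<tau> * t)) = inverse (exp (- 1 * s) * of_real (exp (- (x * t))))"
          unfolding exp_diff_of_real x_def by (simp add: exp_minus)
        then show ?thesis
          unfolding mult.assoc zeta_qq_inverse by (simp add: y_def \<omega>_def)
      qed
      have "norm y = norm (exp (- s)) * exp (x / 2 - x * t)"
        unfolding y_def norm_mult *(4) norm_of_real by (simp flip: exp_add)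
      also have "\<dots> \<le> exp r * exp (- (x / 2))"
        using norm_exp [of "- s"] s t *(1) mult_left_mono [of 1 t x] by (intro mult_mono) auto
      also have "\<dots> < 1" using * by (simp flip: exp_add)
      finally have "inverse y \<noteq> 1" by auto
      then have "polylog_neg (Suc K) (inverse y) = (-1) ^ Suc (Suc K) * polylog_neg (Suc K) y"
        using polylog_neg_inverse [of "inverse y" "Suc K"] y0 by simp
      then show ?thesis
        unfolding inv y_def [symmetric] using assms(1) by simp
    qed
    have n: "nat (1 - - int K) = Suc K" "nat (- (- int K)) = K" by auto
    show ?thesis
      unfolding phi_minus_integrand_def alpha_minus_eq n
      by (rule arg_cong2 [where f = times], rule refl, rule contour_integral_eq) (use eq assms in simp)
  qed
  show "?F integrable_on {1..}"
    by (rule laplace_contour_series(1) [OF * _ _ F]) auto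
  show "(\<lambda>n. \<omega> c d ^ Suc n * (of_real (bessel_scale m c ^ Suc K) * bessel_series (Suc K) (of_real ((bessel_scale m c)\<^sup>2) * of_nat (Suc n)))
           * of_real (inc_gamma (Suc K) (- (4 * pi * Im \<tau>) * real (Suc n)))) sums
         (of_real ((- (4 * pi * Im \<tau>)) ^ Suc K) * phi_minus (- int K) m r c d \<tau>)"
    using laplace_contour_series(2) [OF * _ _ F] unfolding phi_minus_def x_def by (simp del: of_nat_Suc power_Suc)
qed

section \<open>Unfolding Poincare series\<close>

lemma minv_correct:
  assumes "coprime d c"
  shows "c dvd d * minv c d - 1"
proof -
  obtain u v where "u * d + v * c = gcd d c"
    using bezout_int by blast
  then have "d * u = 1 + (- v) * c"
    using assms by (simp add: algebra_simps)
  then have "(d * u) mod c = 1 mod c"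
    by (metis mod_mult_self1 mult.commute)
  then have "(d * minv c d) mod c = 1 mod c"
    unfolding minv_def by (rule someI [where P = "\<lambda>x. (d * x) mod c = 1 mod c"])
  then show ?thesis
    by (simp add: mod_eq_dvd_iff)
qed

definition cusp_coset :: "mat2 \<Rightarrow> mat2 set" where
  "cusp_coset \<gamma> = {mmul g \<gamma> | g. g \<in> Gamma_inf}"

lemma cusp_coset_iff:
  "x \<in> cusp_coset (a, b, c, d) \<longleftrightarrow>
     (\<exists>n. x = (a + n * c, b + n * d, c, d) \<or> x = (- (a + n * c), - (b + n * d), - c, - d))"
proof -
  have "(\<exists>n. x = mmul (1, n, 0, 1) (a, b, c, d)) \<longleftrightarrow> (\<exists>n. x = (a + n * c, b + n * d, c, d))"
    by simp
  moreover have "(\<exists>n. x = mmul (-1, - n, 0, -1) (a, b, c, d)) \<longleftrightarrow> (\<exists>n. x = (- (a + n * c), - (b + n * d), - c, - d))"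
    by simp
  ultimately show ?thesis
    unfolding cusp_coset_def Gamma_inf_def by blast
qed

lemma cusp_coset_self: "\<gamma> \<in> cusp_coset \<gamma>"
  by (cases \<gamma>) (auto simp: cusp_coset_iff intro: exI [of _ 0])

lemma cusp_coset_eq:
  assumes "\<gamma>' \<in> cusp_coset \<gamma>"
  shows "cusp_coset \<gamma>' = cusp_coset \<gamma>"
proof -
  obtain a b c d where \<gamma>: "\<gamma> = (a, b, c, d)" by (cases \<gamma>)
  from assms obtain n where "\<gamma>' = (a + n * c, b + n * d, c, d) \<or> \<gamma>' = (- (a + n * c), - (b + n * d), - c, - d)"
    unfolding \<gamma> cusp_coset_iff by blast
  then show ?thesis
  proof
    assume g: "\<gamma>' = (a + n * c, b + n * d, c, d)"
    show ?thesis
    proof (intro set_eqI iffI)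
      fix x assume "x \<in> cusp_coset \<gamma>'"
      then obtain p where "x = (a + n * c + p * c, b + n * d + p * d, c, d) \<or>
          x = (- (a + n * c + p * c), - (b + n * d + p * d), - c, - d)"
        unfolding g cusp_coset_iff by blast
      then show "x \<in> cusp_coset \<gamma>"
        unfolding \<gamma> cusp_coset_iff by (intro exI [of _ "n + p"]) (auto simp: algebra_simps)
    next
      fix x assume "x \<in> cusp_coset \<gamma>"
      then obtain p where "x = (a + p * c, b + p * d, c, d) \<or> x = (- (a + p * c), - (b + p * d), - c, - d)"
        unfolding \<gamma> cusp_coset_iff by blast
      then show "x \<in> cusp_coset \<gamma>'"
        unfolding g cusp_coset_iff by (intro exI [of _ "p - n"]) (auto simp: algebra_simps)
    qed
  next
    assume g: "\<gamma>' = (- (a + n * c), - (b + n * d), - c, - d)"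
    show ?thesis
    proof (intro set_eqI iffI)
      fix x assume "x \<in> cusp_coset \<gamma>'"
      then obtain p where "x = (- (a + n * c) + p * - c, - (b + n * d) + p * - d, - c, - d) \<or>
          x = (- (- (a + n * c) + p * - c), - (- (b + n * d) + p * - d), - (- c), - (- d))"
        unfolding g cusp_coset_iff by blast
      then show "x \<in> cusp_coset \<gamma>"
        unfolding \<gamma> cusp_coset_iff by (intro exI [of _ "n + p"]) (auto simp: algebra_simps)
    next
      fix x assume "x \<in> cusp_coset \<gamma>"
      then obtain p where "x = (a + p * c, b + p * d, c, d) \<or> x = (- (a + p * c), - (b + p * d), - c, - d)"
        unfolding \<gamma> cusp_coset_iff by blast
      then show "x \<in> cusp_coset \<gamma>'"
        unfolding g cusp_coset_iff by (intro exI [of _ "p - n"]) (auto simp: algebra_simps)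
    qed
  qed
qed

lemma cusp_coset_same_row:
  assumes "a * d - b * c = 1" "a' * d - b' * c = 1"
  shows "cusp_coset (a', b', c, d) = cusp_coset (a, b, c, d)"
proof (rule cusp_coset_eq)
  \<comment> \<open>The translation amount solves both row equations at once; eliminating with the
    two determinants gives it.\<close>
  have "a' = a + (a * b' - a' * b) * c" "b' = b + (a * b' - a' * b) * d"
    using assms by algebra+
  then show "(a', b', c, d) \<in> cusp_coset (a, b, c, d)"
    unfolding cusp_coset_iff by blast
qed

text \<open>Makes the arbitrary choice of a representative harmless: translations are absorbed by
  the period of f and the sign by the even weight.\<close>

lemma slash_cusp_coset:
  assumes "\<gamma>' \<in> cusp_coset (a, b, c, d)" "even \<kappa>" and per: "\<And>z n. f (z + of_int n) = f z"
    and nz: "of_int c * \<tau> + of_int d \<noteq> 0"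
  shows "slash \<kappa> f \<gamma>' \<tau> = slash \<kappa> f (a, b, c, d) \<tau>"
proof -
  from assms(1) obtain n where "\<gamma>' = (a + n * c, b + n * d, c, d) \<or> \<gamma>' = (- (a + n * c), - (b + n * d), - c, - d)"
    unfolding cusp_coset_iff by blast
  then have "mobius \<gamma>' \<tau> = mobius (a, b, c, d) \<tau> + of_int n \<and>
      slash \<kappa> f \<gamma>' \<tau> = (of_int c * \<tau> + of_int d) powi (- \<kappa>) * f (mobius \<gamma>' \<tau>)"
  proof
    assume g: "\<gamma>' = (a + n * c, b + n * d, c, d)"
    then show ?thesis using nz by (simp add: field_simps)
  next
    assume g: "\<gamma>' = (- (a + n * c), - (b + n * d), - c, - d)"
    have m: "of_int (- c) * \<tau> + of_int (- d) = - (of_int c * \<tau> + of_int d)" by simp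
    have "mobius \<gamma>' \<tau> = - (of_int (a + n * c) * \<tau> + of_int (b + n * d)) / - (of_int c * \<tau> + of_int d)"
    proof -
      have "of_int (- (a + n * c)) * \<tau> + of_int (- (b + n * d)) = - (of_int (a + n * c) * \<tau> + of_int (b + n * d))"
        by (simp add: algebra_simps)
      then show ?thesis by (simp only: g mobius.simps m)
    qed
    also have "\<dots> = (of_int (a + n * c) * \<tau> + of_int (b + n * d)) / (of_int c * \<tau> + of_int d)"
      by (rule minus_divide_divide)
    also have "\<dots> = mobius (a, b, c, d) \<tau> + of_int n"
      using nz by (simp add: field_simps)
    finally have 1: "mobius \<gamma>' \<tau> = mobius (a, b, c, d) \<tau> + of_int n" .
    have "slash \<kappa> f \<gamma>' \<tau> = (of_int (- c) * \<tau> + of_int (- d)) powi (- \<kappa>) * f (mobius \<gamma>' \<tau>)"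
      by (simp only: g slash.simps)
    also have "(of_int (- c) * \<tau> + of_int (- d)) powi (- \<kappa>) = (of_int c * \<tau> + of_int d) powi (- \<kappa>)"
      unfolding m using assms(2) by (intro power_int_minus_left_even) simp
    finally show ?thesis using 1 by blast
  qed
  then show ?thesis by (simp add: per)
qed

text \<open>An index ((i, d), n) stands for the coset whose bottom row is, up to sign, (c, d + c n) with c = N (i + 1).\<close>
definition bruhat_index :: "nat \<Rightarrow> ((nat \<times> int) \<times> int) set" where
  "bruhat_index N = (SIGMA i:UNIV. units_mod (N * Suc i)) \<times> UNIV"

fun bruhat_matrix :: "nat \<Rightarrow> (nat \<times> int) \<times> int \<Rightarrow> mat2" where
  "bruhat_matrix N ((i, d), n) =
     (let c = int (N * Suc i); a = minv c d in (a, (a * (d + c * n) - 1) div c, c, d + c * n))"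

text \<open>The inverse of d modulo c also inverts d + c n, so one upper left entry serves all n,
  and the division defining the upper right entry is exact.\<close>

lemma bruhat_matrix_det:
  assumes "d \<in> units_mod (N * Suc i)"
  defines "c \<equiv> int (N * Suc i)"
  shows "minv c d * (d + c * n) - ((minv c d * (d + c * n) - 1) div c) * c = 1"
proof -
  have "c dvd d * minv c d - 1"
    using assms by (intro minv_correct) (simp add: units_mod_def)
  then have "c dvd (d * minv c d - 1) + c * (n * minv c d)"
    by simp
  then have "c dvd minv c d * (d + c * n) - 1"
    by (simp add: algebra_simps)
  then show ?thesis by simp
qed

text \<open>Positivity of c fixes the sign of the bottom row; then d and n are remainder and
  quotient of its second entry modulo c.\<close>

lemma bruhat_coset_inj:
  assumes "N > 0"
  shows "inj_on (\<lambda>x. cusp_coset (bruhat_matrix N x)) (bruhat_index N)"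
proof (rule inj_onI)
  fix x y assume x: "x \<in> bruhat_index N" and y: "y \<in> bruhat_index N"
    and eq: "cusp_coset (bruhat_matrix N x) = cusp_coset (bruhat_matrix N y)"
  obtain i d n where x': "x = ((i, d), n)" by (cases x) auto
  obtain j e p where y': "y = ((j, e), p)" by (cases y) auto
  note xy = x' y'
  define c c' where "c = int (N * Suc i)" and "c' = int (N * Suc j)"
  have pos: "c > 0" "c' > 0" using assms by (auto simp: c_def c'_def simp del: of_nat_mult)
  have de: "0 \<le> d" "d < c" "0 \<le> e" "e < c'"
    using x y unfolding xy bruhat_index_def units_mod_def c_def c'_def by auto
  have "bruhat_matrix N x \<in> cusp_coset (bruhat_matrix N y)"
    using cusp_coset_self eq by blast
  then have "(c = c' \<and> d + c * n = e + c' * p) \<or> (c = - c' \<and> d + c * n = - (e + c' * p))"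
    unfolding xy bruhat_matrix.simps Let_def cusp_coset_iff c_def c'_def by auto
  then have c: "c = c'" and *: "d + c * n = e + c * p" using pos by auto
  have "d = (d + c * n) mod c" "e = (e + c * p) mod c"
    using de c by auto
  then have "d = e" using * by simp
  moreover from this * pos have "n = p" by simp
  moreover have "i = j" using c assms by (simp add: c_def c'_def)
  ultimately show "x = y" by (simp add: xy)
qed

text \<open>The bottom row determines the coset. Rows with c = 0 are (0, 1) up to sign and form the
  identity coset; the others are normalised to c > 0 and split by division with remainder.\<close>

lemma cosets_bruhat:
  assumes "N > 0"
  shows "cosets N = insert (cusp_coset (1, 0, 0, 1)) ((\<lambda>x. cusp_coset (bruhat_matrix N x)) ` bruhat_index N)"
proof -
  have N: "cosets N = cusp_coset ` Gamma0 N"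
    unfolding cosets_def cusp_coset_def ..
  have "cusp_coset \<gamma> \<in> insert (cusp_coset (1, 0, 0, 1)) ((\<lambda>x. cusp_coset (bruhat_matrix N x)) ` bruhat_index N)"
    if \<gamma>: "\<gamma> \<in> Gamma0 N" for \<gamma>
  proof -
    obtain a b c d where g: "\<gamma> = (a, b, c, d)" by (cases \<gamma>)
    have det: "a * d - b * c = 1" and dvd: "int N dvd c"
      using \<gamma> by (auto simp: g Gamma0_def)
    have pos: "cusp_coset (a, b, c, d) \<in> (\<lambda>x. cusp_coset (bruhat_matrix N x)) ` bruhat_index N"
      if det: "a * d - b * c = 1" and dvd: "int N dvd c" and c: "c > 0" for a b c d
    proof -
      obtain t where t: "c = int N * t" using dvd by blast
      then have "t > 0" using c assms by (simp add: zero_less_mult_iff)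
      define i where "i = nat t - 1"
      have ci: "c = int (N * Suc i)"
        using \<open>t > 0\<close> by (simp add: i_def t nat_diff_distrib of_nat_diff)
      have "coprime d c"
      proof (rule coprimeI)
        fix x assume "x dvd d" "x dvd c"
        then have "x dvd a * d - b * c" by (intro dvd_diff dvd_mult)
        then show "is_unit x" by (simp add: det)
      qed
      then have "coprime (d mod c) c"
        by (simp add: coprime_iff_gcd_eq_1 gcd.commute flip: gcd_red_int)
      then have u: "d mod c \<in> units_mod (N * Suc i)"
        using c unfolding units_mod_def ci [symmetric] by simp
      have 1: "bruhat_matrix N ((i, d mod c), d div c) =
          (minv c (d mod c), (minv c (d mod c) * (d mod c + c * (d div c)) - 1) div c, c, d)"
        unfolding bruhat_matrix.simps Let_def ci [symmetric] by simp
      have 2: "minv c (d mod c) * d - ((minv c (d mod c) * (d mod c + c * (d div c)) - 1) div c) * c = 1"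
        using bruhat_matrix_det [OF u, of "d div c"] unfolding ci [symmetric] by simp
      have "cusp_coset (bruhat_matrix N ((i, d mod c), d div c)) = cusp_coset (a, b, c, d)"
        unfolding 1 using det 2 by (rule cusp_coset_same_row)
      moreover have "((i, d mod c), d div c) \<in> bruhat_index N"
        using u by (simp add: bruhat_index_def)
      ultimately show ?thesis by (metis image_eqI)
    qed
    have neg: "cusp_coset (- a, - b, - c, - d) = cusp_coset (a, b, c, d)"
      by (rule cusp_coset_eq) (auto simp: cusp_coset_iff intro!: exI [of _ 0])
    consider "c > 0" | "c < 0" | "c = 0" by linarith
    then show ?thesis
    proof cases
      case 1
      then show ?thesis using pos [OF det dvd] by (simp add: g)
    next
      case 2
      then show ?thesis using pos [of "- a" "- d" "- b" "- c"] det dvd by (simp add: g neg)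
    next
      case 3
      then have "a * d = 1" using det by simp
      then have "(a = 1 \<and> d = 1) \<or> (a = -1 \<and> d = -1)"
        by (simp add: zmult_eq_1_iff)
      then have "(a, b, c, d) \<in> cusp_coset (1, 0, 0, 1)"
        using 3 unfolding cusp_coset_iff by (auto intro: exI [of _ b] exI [of _ "- b"])
      then show ?thesis using cusp_coset_eq by (simp add: g)
    qed
  qed
  moreover have "(1, 0, 0, 1) \<in> Gamma0 N" by (simp add: Gamma0_def)
  moreover have "bruhat_matrix N x \<in> Gamma0 N" if "x \<in> bruhat_index N" for x
  proof -
    obtain i d n where x: "x = ((i, d), n)" by (cases x) auto
    then have "d \<in> units_mod (N * Suc i)" using that by (simp add: bruhat_index_def)
    from bruhat_matrix_det [OF this, of n] show ?thesis
      unfolding x bruhat_matrix.simps Let_def Gamma0_def by simp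
  qed
  ultimately show ?thesis
    unfolding N by blast
qed

lemma identity_coset_notin_bruhat:
  assumes "N > 0"
  shows "cusp_coset (1, 0, 0, 1) \<notin> (\<lambda>x. cusp_coset (bruhat_matrix N x)) ` bruhat_index N"
proof
  assume "cusp_coset (1, 0, 0, 1) \<in> (\<lambda>x. cusp_coset (bruhat_matrix N x)) ` bruhat_index N"
  then obtain x where "cusp_coset (1, 0, 0, 1) = cusp_coset (bruhat_matrix N x)"
    by blast
  then have "bruhat_matrix N x \<in> cusp_coset (1, 0, 0, 1)"
    by (simp add: cusp_coset_self)
  moreover obtain i d n where "x = ((i, d), n)" by (cases x) auto
  ultimately have "bruhat_matrix N ((i, d), n) \<in> cusp_coset (1, 0, 0, 1)"
    by simp
  then show False
    using assms by (auto simp: cusp_coset_iff Let_def add_nonneg_eq_0_iff)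
qed


section \<open>Absolute convergence and the sum over cosets\<close>

lemma card_units_mod_le: "card (units_mod c) \<le> c"
proof -
  have "card (units_mod c) \<le> card {0..<int c}"
    by (intro card_mono) (auto simp: units_mod_def)
  then show ?thesis by simp
qed

lemma finite_units_mod [simp]: "finite (units_mod c)"
  by (rule finite_subset [of _ "{0..<int c}"]) (auto simp: units_mod_def)

lemma summable_inverse_multiples:
  assumes "N > 0" "p \<ge> 2"
  shows "summable (\<lambda>i. 1 / real (N * Suc i) ^ p)"
proof (rule summable_comparison_test')
  show "summable (\<lambda>i. 1 / real (Suc i) ^ p)"
    using inverse_power_summable [of p, where ?'a = real] summable_Suc_iff [of "\<lambda>n. inverse (real n ^ p)"] assms(2)
    by (simp add: field_simps)
  show "norm (1 / real (N * Suc i) ^ p) \<le> 1 / real (Suc i) ^ p" for i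
  proof -
    have "Suc i \<le> N * Suc i" using assms(1) by (cases N) auto
    then have "real (Suc i) \<le> real (N * Suc i)" by (simp only: of_nat_le_iff)
    then have "real (Suc i) ^ p \<le> real (N * Suc i) ^ p" by (intro power_mono) auto
    then show ?thesis using assms(1) by (simp add: frac_le del: of_nat_Suc of_nat_mult)
  qed
qed

text \<open>The residues d number at most c and cost one power of c, which leaves 1/c^3. The
  exponent 4 is the smallest weight K + 2 that occurs.\<close>

lemma bruhat_summable:
  assumes "N > 0"
  shows "(\<lambda>((i, d), n). 1 / real (N * Suc i) ^ 4 * (1 / (1 + \<bar>real_of_int n\<bar>)\<^sup>2)) summable_on bruhat_index N"
  unfolding bruhat_index_def
proof (rule summable_on_SigmaI)
  let ?w = "\<lambda>n::int. 1 / (1 + \<bar>real_of_int n\<bar>)\<^sup>2"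
  let ?u = "\<lambda>(i, d::int). 1 / real (N * Suc i) ^ 4"
  show "((\<lambda>n. (\<lambda>((i, d), n). 1 / real (N * Suc i) ^ 4 * ?w n) (x, n)) has_sum (?u x * infsum ?w UNIV)) UNIV" for x
    using has_sum_cmult_right [OF has_sum_infsum [OF summable_on_int_quadratic], of "?u x"]
    by (simp add: case_prod_unfold)
  have "?u summable_on (SIGMA i:UNIV. units_mod (N * Suc i))"
  proof (rule summable_on_SigmaI)
    show "((\<lambda>d. ?u (i, d)) has_sum (real (card (units_mod (N * Suc i))) / real (N * Suc i) ^ 4)) (units_mod (N * Suc i))" for i
      by (intro has_sum_finiteI) simp_all
    show "(\<lambda>i. real (card (units_mod (N * Suc i))) / real (N * Suc i) ^ 4) summable_on UNIV"
    proof (rule summable_on_comparison_test)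
      show "(\<lambda>i. 1 / real (N * Suc i) ^ 3) summable_on UNIV"
        using assms by (intro summable_nonneg_imp_summable_on summable_inverse_multiples) auto
      show "real (card (units_mod (N * Suc i))) / real (N * Suc i) ^ 4 \<le> 1 / real (N * Suc i) ^ 3" for i
      proof -
        have "real (card (units_mod (N * Suc i))) \<le> real (N * Suc i)"
          using card_units_mod_le by (simp only: of_nat_le_iff)
        then have "real (card (units_mod (N * Suc i))) / real (N * Suc i) ^ 4 \<le> real (N * Suc i) / real (N * Suc i) ^ 4"
          by (intro divide_right_mono) auto
        also have "\<dots> = 1 / real (N * Suc i) ^ 3"
          using assms by (simp add: eval_nat_numeral del: of_nat_Suc of_nat_mult)
        finally show ?thesis .
      qed
    qed auto
  qed auto
  then show "(\<lambda>x. ?u x * infsum ?w UNIV) summable_on (SIGMA i:UNIV. units_mod (N * Suc i))"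
    by (rule summable_on_cmult_left)
qed auto

text \<open>Rests on \<gamma>\<tau> = a/c - 1/(c^2 z) with z = \<tau> + d/c + n. The real shift a/c
  comes out of f as a root of unity.\<close>

lemma slash_bruhat:
  fixes f :: "complex \<Rightarrow> complex" and d n l :: int and N i :: nat and \<tau> :: complex
  assumes shift: "\<And>x z. f (z + of_real x) = ee (of_int l * of_real x) * f z"
    and d: "d \<in> units_mod (N * Suc i)" and N: "N > 0" and \<tau>: "Im \<tau> > 0"
  defines "c \<equiv> N * Suc i"
  defines "z \<equiv> \<tau> + of_int d / of_nat c + of_int n"
  shows "slash \<kappa> f (bruhat_matrix N ((i, d), n)) \<tau> =
    ee (of_int (l * minv (int c) d) / of_nat c) * ((of_nat c * z) powi (- \<kappa>) * f (- 1 / ((of_nat c)\<^sup>2 * z)))"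
proof -
  define a where "a = minv (int c) d"
  define b where "b = (a * (d + int c * n) - 1) div int c"
  have c: "c > 0" using N by (simp add: c_def)
  have det: "a * (d + int c * n) - b * int c = 1"
    using bruhat_matrix_det [OF d, of n] by (simp add: a_def b_def c_def)
  have z0: "z \<noteq> 0" using \<tau> by (auto simp: z_def complex_eq_iff)
  have cz: "of_int (int c) * \<tau> + of_int (d + int c * n) = of_nat c * z"
    using c by (simp add: z_def field_simps)
  have "mobius (a, b, int c, d + int c * n) \<tau> = (of_int a * \<tau> + of_int b) / (of_nat c * z)"
    using cz by simp
  also have "\<dots> = - 1 / ((of_nat c)\<^sup>2 * z) + of_real (real_of_int a / real c)"
  proof -
    have "of_int (a * (d + int c * n) - b * int c) = (1 :: complex)"
      using det by simp
    then have "(of_int a * (of_int (d + int c * n)) - of_int b * of_nat c :: complex) = 1"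
      by simp
    then have "(of_int a * \<tau> + of_int b) * of_nat c = of_int a * (of_nat c * z) - 1"
      unfolding cz [symmetric] by (simp add: algebra_simps)
    then show ?thesis
      using c z0 by (simp add: divide_simps power2_eq_square)
  qed
  finally have "mobius (a, b, int c, d + int c * n) \<tau> = - 1 / ((of_nat c)\<^sup>2 * z) + of_real (real_of_int a / real c)" .
  moreover have "bruhat_matrix N ((i, d), n) = (a, b, int c, d + int c * n)"
    by (simp add: a_def b_def c_def Let_def)
  moreover have "of_int l * of_real (real_of_int a / real c) = (of_int (l * a) / of_nat c :: complex)"
    by simp
  ultimately show ?thesis
    using cz unfolding a_def [symmetric] by (simp only: slash.simps shift) simp
qed

text \<open>Serves the holomorphic and the Maass-Poincare series alike: \<open>bound\<close> gives
  absolute convergence over all cosets and \<open>inner\<close> evaluates the sum over n.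
  Subtracting f \<tau> removes the identity coset.\<close>

lemma poincare_sum_expand:
  assumes N: "N > 0" and \<kappa>: "even \<kappa>" and \<tau>: "Im \<tau> > 0"
    and shift: "\<And>x z. f (z + of_real x) = ee (of_int l * of_real x) * f z"
    and bound: "\<And>c z. c > 0 \<Longrightarrow> Im z = Im \<tau> \<Longrightarrow>
       norm ((of_nat c * z) powi (- \<kappa>) * f (- 1 / ((of_nat c)\<^sup>2 * z))) \<le> B / (real c * norm z) ^ 4"
    and inner: "\<And>c d. c > 0 \<Longrightarrow> ((\<lambda>n::int. (of_nat c * (\<tau> + of_int d / of_nat c + of_int n)) powi (- \<kappa>)
       * f (- 1 / ((of_nat c)\<^sup>2 * (\<tau> + of_int d / of_nat c + of_int n)))) has_sum G c d) UNIV"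
  shows "((\<lambda>i. \<Sum>d\<in>units_mod (N * Suc i). ee (of_int (l * minv (int (N * Suc i)) d) / of_nat (N * Suc i)) * G (N * Suc i) d)
    has_sum (poincare_sum N \<kappa> f \<tau> - f \<tau>)) UNIV"
proof -
  define A where "A = (SIGMA i:UNIV. units_mod (N * Suc i))"
  define z where "z c d n = \<tau> + of_int d / of_nat c + of_int n" for c :: nat and d n :: int
  define g where "g c w = (of_nat c * w) powi (- \<kappa>) * f (- 1 / ((of_nat c)\<^sup>2 * w))" for c :: nat and w
  define E where "E c d = ee (of_int (l * minv (int c) d) / of_nat c)" for c d
  define T where "T x = slash \<kappa> f (bruhat_matrix N x) \<tau>" for x
  have per: "f (w + of_int n) = f w" for w n
    using shift [of w "of_int n"] ee_of_int [of "l * n"] by simp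
  have T: "T ((i, d), n) = E (N * Suc i) d * g (N * Suc i) (z (N * Suc i) d n)"
    if "d \<in> units_mod (N * Suc i)" for i d n
    unfolding T_def E_def g_def z_def by (rule slash_bruhat [OF shift that N \<tau>])
  \<comment> \<open>Nonnegativity follows from \<open>bound\<close> itself, evaluated at c = 1 and z
    = \<tau>.\<close>
  have B0: "B \<ge> 0"
  proof -
    have "0 \<le> B / (real 1 * norm \<tau>) ^ 4"
      using bound [of 1 \<tau>] by (rule order_trans [OF norm_ge_zero]) auto
    moreover have "norm \<tau> > 0" using \<tau> by auto
    ultimately show ?thesis by (simp add: zero_le_divide_iff)
  qed
  \<comment> \<open>Since |d/c| \<le> 1, this replaces the constant of
    \<open>one_plus_abs_le_norm_shift\<close> uniformly in c and d.\<close>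
  define Q where "Q = 1 + (2 + norm \<tau>) / Im \<tau>"
  have sumT: "T summable_on bruhat_index N"
  proof (rule summable_on_norm_bound)
    show "(\<lambda>x. (B * Q\<^sup>2 / (Im \<tau>)\<^sup>2) * (\<lambda>((i, d), n). 1 / real (N * Suc i) ^ 4 * (1 / (1 + \<bar>real_of_int n\<bar>)\<^sup>2)) x) summable_on bruhat_index N"
      by (intro summable_on_cmult_right bruhat_summable N)
    fix x assume "x \<in> bruhat_index N"
    then obtain i d n where x: "x = ((i, d), n)" and d: "d \<in> units_mod (N * Suc i)"
      by (auto simp: bruhat_index_def)
    define c where "c = N * Suc i"
    have c: "c > 0" using N by (simp add: c_def)
    define w where "w = z c d n"
    have Imw: "Im w = Im \<tau>" by (simp add: w_def z_def)
    have "norm (of_int d / of_nat c :: complex) \<le> 1"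
    proof -
      have "0 \<le> d" "d < int c" using d by (auto simp: units_mod_def c_def)
      then have "\<bar>real_of_int d\<bar> \<le> real c" by linarith
      then show ?thesis using c by (simp add: norm_divide)
    qed
    then have n0: "norm (\<tau> + of_int d / of_nat c) \<le> norm \<tau> + 1"
      using norm_triangle_ineq [of \<tau> "of_int d / of_nat c"] by linarith
    have "1 + \<bar>real_of_int n\<bar> \<le> norm w * (1 + (1 + norm (\<tau> + of_int d / of_nat c)) / \<bar>Im \<tau>\<bar>)"
      using one_plus_abs_le_norm_shift [of "\<tau> + of_int d / of_nat c" n] \<tau> by (simp add: w_def z_def)
    also have "\<dots> \<le> norm w * Q"
      using n0 \<tau> by (intro mult_left_mono) (auto simp: Q_def divide_right_mono)
    finally have "(1 + \<bar>real_of_int n\<bar>)\<^sup>2 \<le> (norm w * Q)\<^sup>2"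
      by (intro power_mono) auto
    moreover have "(Im \<tau>)\<^sup>2 \<le> (norm w)\<^sup>2"
      using abs_Im_le_cmod [of w] Imw \<tau> by (intro power_mono) auto
    \<comment> \<open>Of the four powers of |w|, two control n and two are bounded below by Im
      \<tau>.\<close>
    ultimately have le: "(1 + \<bar>real_of_int n\<bar>)\<^sup>2 * (Im \<tau>)\<^sup>2 \<le> (norm w * Q)\<^sup>2 * (norm w)\<^sup>2"
      by (intro mult_mono) auto
    have nw: "norm w > 0" using Imw \<tau> by auto
    have "norm (E c d) = 1"
      by (simp add: E_def norm_ee)
    then have "norm (T x) = norm (g c w)"
      using T [OF d, of n] by (simp add: x c_def w_def norm_mult)
    also have "\<dots> \<le> B / (real c * norm w) ^ 4"
      unfolding g_def by (rule bound [OF c Imw])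
    also have "\<dots> = B / real c ^ 4 * (1 / ((norm w)\<^sup>2 * (norm w)\<^sup>2))"
      by (simp add: power_mult_distrib flip: power_add)
    also have "\<dots> \<le> B / real c ^ 4 * (Q\<^sup>2 / ((1 + \<bar>real_of_int n\<bar>)\<^sup>2 * (Im \<tau>)\<^sup>2))"
    proof (rule mult_left_mono)
      have "0 < (1 + \<bar>real_of_int n\<bar>)\<^sup>2 * (Im \<tau>)\<^sup>2"
        using \<tau> by (intro mult_pos_pos zero_less_power) auto
      then show "1 / ((norm w)\<^sup>2 * (norm w)\<^sup>2) \<le> Q\<^sup>2 / ((1 + \<bar>real_of_int n\<bar>)\<^sup>2 * (Im \<tau>)\<^sup>2)"
        using le nw by (simp add: divide_simps power_mult_distrib mult_ac)
    qed (use B0 in auto)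
    finally show "norm (T x) \<le> (B * Q\<^sup>2 / (Im \<tau>)\<^sup>2) * (\<lambda>((i, d), n). 1 / real (N * Suc i) ^ 4 * (1 / (1 + \<bar>real_of_int n\<bar>)\<^sup>2)) x"
      by (simp add: x c_def mult_ac del: of_nat_Suc of_nat_mult)
  qed
  define S where "S = infsum T (bruhat_index N)"
  have S: "(T has_sum S) (bruhat_index N)"
    unfolding S_def using sumT by (rule has_sum_infsum)
  have rep: "slash \<kappa> f (SOME \<gamma>. \<gamma> \<in> cusp_coset (a, b, c, d)) \<tau> = slash \<kappa> f (a, b, c, d) \<tau>"
    if "c \<noteq> 0 \<or> d \<noteq> 0" for a b c d
  proof (rule slash_cusp_coset [OF _ \<kappa> per])
    show "(SOME \<gamma>. \<gamma> \<in> cusp_coset (a, b, c, d)) \<in> cusp_coset (a, b, c, d)"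
      using cusp_coset_self by (rule someI)
    show "of_int c * \<tau> + of_int d \<noteq> 0"
      using that \<tau> by (auto simp: complex_eq_iff)
  qed
  have "((\<lambda>C. slash \<kappa> f (SOME \<gamma>. \<gamma> \<in> C) \<tau>) has_sum S) ((\<lambda>x. cusp_coset (bruhat_matrix N x)) ` bruhat_index N)"
    unfolding has_sum_reindex [OF bruhat_coset_inj [OF N]]
  proof (rule has_sum_cong [THEN iffD2, OF _ S])
    fix x assume "x \<in> bruhat_index N"
    obtain i d n where x: "x = ((i, d), n)" by (cases x) auto
    show "((\<lambda>C. slash \<kappa> f (SOME \<gamma>. \<gamma> \<in> C) \<tau>) \<circ> (\<lambda>x. cusp_coset (bruhat_matrix N x))) x = T x"
      unfolding T_def o_apply x bruhat_matrix.simps Let_def by (rule rep) (use N in \<open>auto simp: add_nonneg_eq_0_iff\<close>)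
  qed
  from has_sum_insert [OF identity_coset_notin_bruhat [OF N] this]
  have "poincare_sum N \<kappa> f \<tau> = slash \<kappa> f (SOME \<gamma>. \<gamma> \<in> cusp_coset (1, 0, 0, 1)) \<tau> + S"
    unfolding poincare_sum_def cosets_bruhat [OF N] by (rule infsumI)
  then have P: "S = poincare_sum N \<kappa> f \<tau> - f \<tau>"
    using rep [of 0 1 1 0] by simp
  have "((\<lambda>(i, d). E (N * Suc i) d * G (N * Suc i) d) has_sum S) A"
  proof (rule has_sum_SigmaD [OF S [unfolded bruhat_index_def, folded A_def]])
    fix x assume "x \<in> A"
    then obtain i d where x: "x = (i, d)" and d: "d \<in> units_mod (N * Suc i)"
      by (auto simp: A_def)
    have "((\<lambda>n. E (N * Suc i) d * g (N * Suc i) (z (N * Suc i) d n)) has_sum (E (N * Suc i) d * G (N * Suc i) d)) UNIV"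
      unfolding g_def z_def using N by (intro has_sum_cmult_right inner) simp
    then show "((\<lambda>n. T (x, n)) has_sum (case x of (i, d) \<Rightarrow> E (N * Suc i) d * G (N * Suc i) d)) UNIV"
      using T [OF d] by (simp add: x)
  qed
  then have "((\<lambda>i. \<Sum>d\<in>units_mod (N * Suc i). E (N * Suc i) d * G (N * Suc i) d) has_sum S) UNIV"
    unfolding A_def by (rule has_sum_SigmaD) (auto intro!: has_sum_finiteI)
  then show ?thesis
    unfolding E_def P .
qed

section \<open>Sums over integer translates\<close>

text \<open>Turns a sum of Bessel values at the frequencies into a power series whose coefficients
  are the moments s j. The exponential weight on b pays for the Bessel growth.\<close>

lemma bessel_series_exchange:
  assumes \<rho>: "\<rho> > 0" and b: "(\<lambda>l. norm (b l) * exp (\<rho> * real (Suc l))) summable_on UNIV"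
    and s: "\<And>j. ((\<lambda>l. b l * of_nat (Suc l) ^ j) has_sum s j) UNIV"
  obtains S where "((\<lambda>l. b l * bessel_series w (Y * of_nat (Suc l))) has_sum S) UNIV"
    "((\<lambda>j. Y ^ j / (fact j * fact (j + w)) * s j) has_sum S) UNIV"
proof (rule has_sum_exchange)
  let ?f = "\<lambda>l j. b l * ((Y * of_nat (Suc l)) ^ j / (fact j * fact (j + w)))"
  show "(?f l has_sum (b l * bessel_series w (Y * of_nat (Suc l)))) UNIV" for l
    by (intro has_sum_cmult_right bessel_series_has_sum)
  have "((\<lambda>l. Y ^ j / (fact j * fact (j + w)) * (b l * of_nat (Suc l) ^ j)) has_sum (Y ^ j / (fact j * fact (j + w)) * s j)) UNIV" for j
    by (intro has_sum_cmult_right s)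
  then show "((\<lambda>l. ?f l j) has_sum (Y ^ j / (fact j * fact (j + w)) * s j)) UNIV" for j
    by (simp add: power_mult_distrib mult_ac del: of_nat_Suc)
  show "norm (?f l j) \<le> (norm (b l) * exp (\<rho> * real (Suc l))) * ((norm Y / \<rho>) ^ j / fact j)" for l j
  proof -
    have "norm ((Y * of_nat (Suc l)) ^ j / (fact j * fact (j + w))) \<le> exp (\<rho> * real (Suc l)) * ((norm Y / \<rho>) ^ j / fact j)"
      by (rule bessel_series_term_le) (use \<rho> in \<open>simp_all add: norm_mult del: of_nat_Suc\<close>)
    then show ?thesis
      unfolding norm_mult [of "b l"] mult.assoc by (rule mult_left_mono) simp
  qed
  show "(\<lambda>j. (norm Y / \<rho>) ^ j / fact j) summable_on UNIV"
    using \<rho> by (intro summable_nonneg_imp_summable_on sums_summable [OF exp_sums_real]) auto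
qed (use b \<rho> that in auto)

lemma polylog_neg_has_sum:
  assumes "norm w < 1"
  shows "((\<lambda>l. of_nat (Suc l) ^ n * w ^ Suc l) has_sum polylog_neg n w) UNIV"
proof (rule norm_summable_imp_has_sum)
  show "summable (\<lambda>l. norm (of_nat (Suc l) ^ n * w ^ Suc l))"
    using summable_power_times_geometric [of "norm w" n] assms
    by (simp add: norm_mult norm_power del: of_nat_Suc power_Suc)
qed (rule polylog_neg_sums [OF assms])

lemma summable_on_ee_power:
  assumes "Im z > 0"
  shows "(\<lambda>l. norm (of_nat (Suc l) ^ n * ee z ^ Suc l) * exp (pi * Im z * real (Suc l))) summable_on UNIV"
proof -
  have "summable (\<lambda>l. real (Suc l) ^ n * exp (- (pi * Im z)) ^ Suc l)"
    using assms by (intro summable_power_times_geometric) auto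
  moreover have "norm (of_nat (Suc l) ^ n * ee z ^ Suc l) * exp (pi * Im z * real (Suc l)) = real (Suc l) ^ n * exp (- (pi * Im z)) ^ Suc l" for l
  proof -
    have "norm (ee z) ^ Suc l * exp (pi * Im z * real (Suc l)) = exp (- (pi * Im z)) ^ Suc l"
      unfolding norm_ee exp_of_nat_mult [symmetric] exp_add [symmetric]
      by (rule arg_cong [where f = exp]) (simp add: algebra_simps)
    then show ?thesis
      unfolding norm_mult norm_power by (simp add: mult.assoc del: of_nat_Suc power_Suc)
  qed
  ultimately show ?thesis
    by (intro summable_nonneg_imp_summable_on) (auto simp del: of_nat_Suc power_Suc)
qed

lemma exp_has_sum: "((\<lambda>j. x ^ j / fact j) has_sum exp x) UNIV" for x :: complex
proof (rule norm_summable_imp_has_sum)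
  show "summable (\<lambda>j. norm (x ^ j / fact j))"
    using sums_summable [OF exp_sums_real [of "norm x"]] by (simp add: norm_divide norm_power)
  show "(\<lambda>j. x ^ j / fact j) sums exp x"
    using exp_converges [of x] by (simp add: scaleR_conv_of_real divide_inverse mult.commute)
qed

text \<open>The exponential is expanded in powers of A, the Lipschitz formula sums each power of
  1/(z + n), and the resulting polylogarithms are the moments of a Bessel series.\<close>

lemma holomorphic_inner_sum:
  assumes z: "Im z > 0" and w: "w \<ge> 1"
  obtains S where
    "((\<lambda>l. of_nat (Suc l) ^ w * ee z ^ Suc l * bessel_series w (- 2 * of_real pi * \<i> * A * of_nat (Suc l))) has_sum S) UNIV"
    "((\<lambda>n::int. exp (A / (z + of_int n)) / (z + of_int n) ^ Suc w) has_sum ((- 2 * of_real pi * \<i>) ^ Suc w * S)) UNIV"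
proof -
  let ?Y = "- 2 * of_real pi * \<i> * A"
  have q: "norm (ee z) < 1" using z by (simp add: norm_ee)
  obtain S where S1: "((\<lambda>l. of_nat (Suc l) ^ w * ee z ^ Suc l * bessel_series w (?Y * of_nat (Suc l))) has_sum S) UNIV"
    and S2: "((\<lambda>j. ?Y ^ j / (fact j * fact (j + w)) * polylog_neg (w + j) (ee z)) has_sum S) UNIV"
  proof (rule bessel_series_exchange)
    show "0 < pi * Im z" using z by simp
    show "(\<lambda>l. norm (of_nat (Suc l) ^ w * ee z ^ Suc l) * exp (pi * Im z * real (Suc l))) summable_on UNIV"
      using z by (rule summable_on_ee_power)
    show "((\<lambda>l. of_nat (Suc l) ^ w * ee z ^ Suc l * of_nat (Suc l) ^ j) has_sum polylog_neg (w + j) (ee z)) UNIV" for j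
      using polylog_neg_has_sum [OF q, of "w + j"] by (simp add: power_add mult_ac del: of_nat_Suc power_Suc)
  qed
  obtain S' where S'1: "((\<lambda>n::int. exp (A / (z + of_int n)) / (z + of_int n) ^ Suc w) has_sum S') UNIV"
    and S'2: "((\<lambda>j. A ^ j / fact j * ((- 2 * of_real pi * \<i>) ^ (Suc w + j) / fact (Suc w + j - 1) * polylog_neg (Suc w + j - 1) (ee z))) has_sum S') UNIV"
  proof (rule has_sum_exchange)
    let ?f = "\<lambda>(n::int) j. A ^ j / fact j * (1 / (z + of_int n) ^ (Suc w + j))"
    have "((\<lambda>j. 1 / (z + of_int n) ^ Suc w * ((A / (z + of_int n)) ^ j / fact j)) has_sum
        (1 / (z + of_int n) ^ Suc w * exp (A / (z + of_int n)))) UNIV" for n :: int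
      by (intro has_sum_cmult_right exp_has_sum)
    then show "(?f n has_sum (exp (A / (z + of_int n)) / (z + of_int n) ^ Suc w)) UNIV" for n
      by (simp add: power_add power_divide mult_ac)
    show "((\<lambda>n. ?f n j) has_sum (A ^ j / fact j * ((- 2 * of_real pi * \<i>) ^ (Suc w + j) / fact (Suc w + j - 1) * polylog_neg (Suc w + j - 1) (ee z)))) UNIV" for j
      using w by (intro has_sum_cmult_right lipschitz_formula z) auto
    show "norm (?f n j) \<le> 1 / norm (z + of_int n) ^ 2 * ((1 / Im z) ^ (w - 1) * ((norm A / Im z) ^ j / fact j))" for n j
    proof -
      have "norm (1 / (z + of_int n) ^ (Suc w + j)) \<le> (1 / Im z) ^ (Suc w + j - 2) * (1 / norm (z + of_int n) ^ 2)"
        using norm_inverse_shift_power_le [of "z + of_int n" "Suc w + j"] z w by simp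
      then have "norm (A ^ j / fact j) * norm (1 / (z + of_int n) ^ (Suc w + j)) \<le>
          norm (A ^ j / fact j) * ((1 / Im z) ^ (Suc w + j - 2) * (1 / norm (z + of_int n) ^ 2))"
        by (rule mult_left_mono) simp
      moreover have "Suc w + j - 2 = (w - 1) + j" using w by simp
      then have "(1 / Im z) ^ (Suc w + j - 2) = (1 / Im z) ^ (w - 1) * (1 / Im z) ^ j"
        by (simp only: power_add)
      ultimately show ?thesis
        unfolding norm_mult by (simp add: norm_divide norm_power power_divide mult_ac)
    qed
    show "(\<lambda>n::int. 1 / norm (z + of_int n) ^ 2) summable_on UNIV"
      using z by (intro summable_on_inverse_shift_squared) auto
    show "(\<lambda>j. (1 / Im z) ^ (w - 1) * ((norm A / Im z) ^ j / fact j)) summable_on UNIV"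
      using z by (intro summable_on_cmult_right summable_nonneg_imp_summable_on sums_summable [OF exp_sums_real]) auto
  qed (use z in auto)
  \<comment> \<open>Both double sums are reduced to series over j with the same terms, which
    identifies S' with a multiple of S.\<close>
  have "((\<lambda>j. (- 2 * of_real pi * \<i>) ^ Suc w * (?Y ^ j / (fact j * fact (j + w)) * polylog_neg (w + j) (ee z))) has_sum ((- 2 * of_real pi * \<i>) ^ Suc w * S)) UNIV"
    by (intro has_sum_cmult_right S2)
  moreover have "(- 2 * of_real pi * \<i>) ^ Suc w * (?Y ^ j / (fact j * fact (j + w)) * polylog_neg (w + j) (ee z)) =
     A ^ j / fact j * ((- 2 * of_real pi * \<i>) ^ (Suc w + j) / fact (Suc w + j - 1) * polylog_neg (Suc w + j - 1) (ee z))" for j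
    by (simp only: power_mult_distrib [of _ A] power_add diff_Suc_1 add_Suc) (simp add: add.commute [of j w] power_add mult_ac)
  ultimately have "S' = (- 2 * of_real pi * \<i>) ^ Suc w * S"
    using S'2 has_sum_unique by (simp only:)
  with S1 S'1 that show ?thesis by simp
qed

section \<open>Taylor remainders and the inner sum of the Maass-Poincare series\<close>

text \<open>For purely imaginary A the number A (1/z - 1/conj z) is real, and the subtracted term is
  exp(A/z) times the normalized incomplete gamma function there. This is the slashed Maass seed up
  to the factor c^K; see \<open>maass_seed_inversion\<close>.\<close>

definition maass_term :: "nat \<Rightarrow> complex \<Rightarrow> complex \<Rightarrow> complex" where
  "maass_term K A z = z ^ K * (exp (A / z) - exp (A / cnj z) * (\<Sum>j\<le>K. (A * (1 / z - 1 / cnj z)) ^ j / fact j))"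

text \<open>The remainder at z of the Taylor polynomial of degree K of the function 1 / z^P around the conjugate of z.\<close>
definition taylor_remainder :: "nat \<Rightarrow> nat \<Rightarrow> complex \<Rightarrow> complex" where
  "taylor_remainder K P z = (1 / z ^ P - 1 / cnj z ^ P)
     - (\<Sum>i=1..K. of_nat ((P - 1 + i) choose i) * (cnj z - z) ^ i * (1 / cnj z ^ (P + i)))"

text \<open>Multiplication by z^K turns a truncated binomial expansion of (1/z)^(P + K) around
  1/conj z into a truncated Taylor expansion of z^(-P) around conj z. This finite identity is what
  makes Bol's identity visible coefficientwise.\<close>

lemma taylor_remainder_eq:
  assumes "z \<noteq> 0" "P \<ge> 1"
  shows "z ^ K * ((1 / z) ^ (P + K) - (\<Sum>j\<le>K. of_nat ((P + K) choose j) * (1 / z - 1 / cnj z) ^ j * (1 / cnj z) ^ (P + K - j)))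
     = taylor_remainder K P z"
proof -
  define a b y where "a = 1 / z" and "b = 1 / cnj z" and "y = a - b"
  have nz: "cnj z \<noteq> 0" using assms by simp
  have za: "z * a = 1" "cnj z * b = 1" using assms nz by (auto simp: a_def b_def)
  \<comment> \<open>Converts powers of the difference of reciprocals into powers of conj z -
    z.\<close>
  have yz: "y * z = (cnj z - z) * b"
    using za by (simp add: y_def algebra_simps)
  have "(\<Sum>j\<le>K. of_nat ((P + K) choose j) * y ^ j * b ^ (P + K - j)) =
      b ^ P * (\<Sum>j\<le>K. of_nat ((K + P) choose j) * y ^ j * b ^ (K - j))"
    unfolding sum_distrib_left
  proof (rule sum.cong)
    fix j assume "j \<in> {..K}"
    then have "P + K - j = P + (K - j)" by simp
    then show "of_nat ((P + K) choose j) * y ^ j * b ^ (P + K - j) = b ^ P * (of_nat ((K + P) choose j) * y ^ j * b ^ (K - j))"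
      by (simp only: power_add add.commute [of P K]) (simp only: mult_ac)
  qed simp
  also have "(\<Sum>j\<le>K. of_nat ((K + P) choose j) * y ^ j * b ^ (K - j)) =
      (\<Sum>j\<le>K. (of_nat K + of_nat P gchoose j) * y ^ j * b ^ (K - j))"
    by (simp add: binomial_gbinomial)
  \<comment> \<open>The partial binomial sum in y and b is rewritten in y and y + b = a; the powers
    of a then cancel against z^K.\<close>
  also have "\<dots> = (\<Sum>j\<le>K. (of_nat j + of_nat P - 1 gchoose j) * y ^ j * (y + b) ^ (K - j))"
    by (rule gbinomial_partial_sum_poly_xpos)
  also have "\<dots> = (\<Sum>j\<le>K. of_nat ((P - 1 + j) choose j) * y ^ j * a ^ (K - j))"
  proof (rule sum.cong)
    fix j
    have "of_nat j + of_nat P - 1 = (of_nat (P - 1 + j) :: complex)"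
      using assms(2) by (simp add: of_nat_diff)
    then show "(of_nat j + of_nat P - 1 gchoose j) * y ^ j * (y + b) ^ (K - j) = of_nat ((P - 1 + j) choose j) * y ^ j * a ^ (K - j)"
      by (simp only: binomial_gbinomial y_def diff_add_cancel)
  qed simp
  finally have "z ^ K * (\<Sum>j\<le>K. of_nat ((P + K) choose j) * y ^ j * b ^ (P + K - j)) =
      z ^ K * (b ^ P * (\<Sum>j\<le>K. of_nat ((P - 1 + j) choose j) * y ^ j * a ^ (K - j)))"
    by simp
  also have "\<dots> = (\<Sum>j\<le>K. of_nat ((P - 1 + j) choose j) * (cnj z - z) ^ j * b ^ (P + j))"
    unfolding sum_distrib_left
  proof (rule sum.cong)
    fix j assume j: "j \<in> {..K}"
    have "z ^ K = z ^ j * z ^ (K - j)"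
      using j by (simp flip: power_add)
    moreover have "z ^ (K - j) * a ^ (K - j) = 1"
      by (simp add: za flip: power_mult_distrib)
    ultimately have "z ^ K * (b ^ P * (of_nat ((P - 1 + j) choose j) * y ^ j * a ^ (K - j))) =
        b ^ P * of_nat ((P - 1 + j) choose j) * (y * z) ^ j"
      by (simp add: power_mult_distrib mult_ac)
    then show "z ^ K * (b ^ P * (of_nat ((P - 1 + j) choose j) * y ^ j * a ^ (K - j))) =
        of_nat ((P - 1 + j) choose j) * (cnj z - z) ^ j * b ^ (P + j)"
      by (simp add: yz power_mult_distrib power_add mult_ac)
  qed simp
  also have "\<dots> = b ^ P + (\<Sum>i=1..K. of_nat ((P - 1 + i) choose i) * (cnj z - z) ^ i * b ^ (P + i))"
  proof -
    have "{..K} = insert 0 {1..K}" by auto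
    then show ?thesis by simp
  qed
  finally have "z ^ K * (\<Sum>j\<le>K. of_nat ((P + K) choose j) * y ^ j * b ^ (P + K - j)) =
      b ^ P + (\<Sum>i=1..K. of_nat ((P - 1 + i) choose i) * (cnj z - z) ^ i * b ^ (P + i))" .
  moreover have "z ^ K * a ^ (P + K) = a ^ P"
  proof -
    have "z ^ K * a ^ (P + K) = a ^ P * (z * a) ^ K"
      by (simp add: power_add power_mult_distrib mult_ac)
    then show ?thesis by (simp add: za)
  qed
  ultimately have "z ^ K * (a ^ (P + K) - (\<Sum>j\<le>K. of_nat ((P + K) choose j) * y ^ j * b ^ (P + K - j))) =
      a ^ P - (b ^ P + (\<Sum>i=1..K. of_nat ((P - 1 + i) choose i) * (cnj z - z) ^ i * b ^ (P + i)))"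
    by (simp only: right_diff_distrib)
  also have "\<dots> = taylor_remainder K P z"
    unfolding taylor_remainder_def by (simp add: a_def b_def power_one_over)
  finally show ?thesis by (simp only: a_def b_def y_def)
qed

text \<open>Collects by powers of A the j-th term in the expansion of exp(A (b + y)) in y; the terms
  with p < j vanish with the binomial coefficient.\<close>

lemma exp_binomial_sums:
  fixes A b y :: complex
  shows "(\<lambda>p. A ^ p / fact p * (of_nat (p choose j) * y ^ j * b ^ (p - j))) sums (exp (A * b) * ((A * y) ^ j / fact j))"
proof -
  have "(\<lambda>p. (A * b) ^ p / fact p * ((A * y) ^ j / fact j)) sums (exp (A * b) * ((A * y) ^ j / fact j))"
    by (intro sums_mult2 has_sum_imp_sums exp_has_sum)
  moreover have "(A * b) ^ p / fact p * ((A * y) ^ j / fact j) =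
      A ^ (p + j) / fact (p + j) * (of_nat ((p + j) choose j) * y ^ j * b ^ (p + j - j))" for p
  proof -
    have "of_nat ((p + j) choose j) / fact (p + j) = (1 / (fact p * fact j) :: complex)"
      using binomial_fact [of j "p + j", where ?'a = complex] by simp
    then have "A ^ (p + j) / fact (p + j) * (of_nat ((p + j) choose j) * y ^ j * b ^ (p + j - j)) =
        A ^ (p + j) * (1 / (fact p * fact j)) * y ^ j * b ^ p"
      by (metis (no_types, opaque_lifting) add_diff_cancel_right' mult.assoc times_divide_eq_left times_divide_eq_right)
    then show ?thesis
      by (simp add: power_add power_mult_distrib mult_ac)
  qed
  ultimately have "(\<lambda>p. A ^ (p + j) / fact (p + j) * (of_nat ((p + j) choose j) * y ^ j * b ^ (p + j - j))) sums (exp (A * b) * ((A * y) ^ j / fact j))"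
    by simp
  then show ?thesis
    by (subst sums_zero_iff_shift [of j, symmetric]) auto
qed

lemma maass_term_sums:
  assumes "z \<noteq> 0"
  shows "(\<lambda>j. A ^ (j + Suc K) / fact (j + Suc K) * taylor_remainder K (Suc j) z) sums maass_term K A z"
proof -
  define a b y where "a = 1 / z" and "b = 1 / cnj z" and "y = a - b"
  define f where "f p = z ^ K * (A ^ p / fact p * a ^ p - (\<Sum>j\<le>K. A ^ p / fact p * (of_nat (p choose j) * y ^ j * b ^ (p - j))))" for p
  have "(\<lambda>p. A ^ p / fact p * a ^ p) sums exp (A * a)"
    using has_sum_imp_sums [OF exp_has_sum [of "A * a"]] by (simp add: power_mult_distrib)
  then have "f sums (z ^ K * (exp (A * a) - (\<Sum>j\<le>K. exp (A * b) * ((A * y) ^ j / fact j))))"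
    unfolding f_def by (intro sums_mult sums_diff sums_sum exp_binomial_sums)
  also have "z ^ K * (exp (A * a) - (\<Sum>j\<le>K. exp (A * b) * ((A * y) ^ j / fact j))) = maass_term K A z"
    unfolding maass_term_def sum_distrib_left [symmetric] by (simp add: a_def b_def y_def)
  finally have f: "f sums maass_term K A z" .
  have f_eq: "f p = A ^ p / fact p * (z ^ K * (a ^ p - (\<Sum>j\<le>K. of_nat (p choose j) * y ^ j * b ^ (p - j))))" for p
    unfolding f_def sum_distrib_left [symmetric] by (simp add: algebra_simps)
  \<comment> \<open>For p \<le> K the truncated binomial sum is complete and equals (y + b)^p = a^p.
    The first surviving power is A^(K + 1), which gives P = 1.\<close>
  have "f p = 0" if "p < Suc K" for p
  proof -
    have "(\<Sum>j\<le>K. of_nat (p choose j) * y ^ j * b ^ (p - j)) = (\<Sum>j\<le>p. of_nat (p choose j) * y ^ j * b ^ (p - j))"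
      using that by (intro sum.mono_neutral_right) auto
    also have "\<dots> = (y + b) ^ p"
      by (rule binomial_ring [symmetric])
    also have "\<dots> = a ^ p" by (simp add: y_def)
    finally show ?thesis by (simp add: f_eq)
  qed
  then have "(\<lambda>j. f (j + Suc K)) sums maass_term K A z"
    using f by (subst sums_zero_iff_shift) auto
  moreover have "f (j + Suc K) = A ^ (j + Suc K) / fact (j + Suc K) * taylor_remainder K (Suc j) z" for j
    using taylor_remainder_eq [OF assms, of "Suc j" K]
    unfolding f_eq by (simp add: a_def b_def y_def del: power_Suc fact_Suc binomial_Suc_Suc)
  ultimately show ?thesis by simp
qed


text \<open>Scaling by |z| moves both reciprocals to the unit circle, where |x^P - y^P| \<le> P |x -
  y|. One power of |z| is gained, which makes P = 1 summable over translates.\<close>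

lemma norm_power_difference_cnj_le:
  assumes "z \<noteq> 0"
  shows "norm (1 / z ^ P - 1 / cnj z ^ P) \<le> real P * (2 * \<bar>Im z\<bar>) / norm z ^ Suc P"
proof -
  define R where "R = complex_of_real (norm z)"
  have R: "R \<noteq> 0" "norm R = norm z" using assms by (auto simp: R_def)
  have 1: "1 / z ^ P - 1 / cnj z ^ P = ((R / z) ^ P - (R / cnj z) ^ P) / R ^ P"
    using R assms by (simp add: power_divide diff_divide_distrib)
  have 2: "norm ((R / z) ^ P - (R / cnj z) ^ P) \<le> real P * norm (R / z - R / cnj z)"
    using R assms by (intro norm_power_diff) (auto simp: norm_divide)
  have 3: "norm (R / z - R / cnj z) = 2 * \<bar>Im z\<bar> / norm z"
  proof -
    have "R / z - R / cnj z = R * (cnj z - z) / (z * cnj z)"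
      using assms by (simp add: divide_simps) (simp add: algebra_simps)
    moreover have "cnj z - z = of_real (- 2 * Im z) * \<i>"
      by (simp add: complex_eq_iff)
    ultimately show ?thesis
      using R by (simp only: norm_divide norm_mult complex_mod_cnj norm_of_real) (simp add: abs_mult)
  qed
  have "norm (1 / z ^ P - 1 / cnj z ^ P) = norm ((R / z) ^ P - (R / cnj z) ^ P) / norm z ^ P"
    unfolding 1 norm_divide norm_power R(2) ..
  also have "\<dots> \<le> real P * (2 * \<bar>Im z\<bar> / norm z) / norm z ^ P"
    using 2 unfolding 3 by (rule divide_right_mono) simp
  finally show ?thesis by simp
qed

text \<open>The bound must be summable over translates and geometric in P, so that the factorials in
  the A-expansion win. P and the binomial coefficients are absorbed in powers of 2.\<close>

lemma norm_taylor_remainder_le: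
  assumes v: "Im z > 0" and P: "P \<ge> 1"
  shows "norm (taylor_remainder K P z) \<le> ((Im z)\<^sup>2 * (2 + real K * 4 ^ K)) * (2 / Im z) ^ P * (1 / norm z ^ 2)"
proof -
  let ?v = "Im z"
  have nz: "z \<noteq> 0" "norm z > 0" using v by auto
  have vz: "?v \<le> norm z" using abs_Im_le_cmod [of z] v by simp
  \<comment> \<open>As before, two powers of |z| are kept and the rest becomes powers of 1 / Im
    z.\<close>
  have inv: "1 / norm z ^ p \<le> ?v\<^sup>2 * (1 / ?v) ^ p * (1 / norm z ^ 2)" if "p \<ge> 2" for p
  proof -
    have "1 / norm z ^ p \<le> (1 / ?v) ^ (p - 2) * (1 / norm z ^ 2)"
      using norm_inverse_shift_power_le [of z p] v that by (simp add: norm_divide norm_power)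
    also have "(1 / ?v) ^ (p - 2) = ?v\<^sup>2 * (1 / ?v) ^ p"
      using v that le_add_diff_inverse2 [OF that] power_add [of ?v "p - 2" 2] by (simp add: power_one_over field_simps)
    finally show ?thesis .
  qed
  have "norm (1 / z ^ P - 1 / cnj z ^ P) \<le> real P * (2 * ?v) * (1 / norm z ^ Suc P)"
    using norm_power_difference_cnj_le [OF nz(1), of P] v by simp
  also have "\<dots> \<le> real P * (2 * ?v) * (?v\<^sup>2 * (1 / ?v) ^ Suc P * (1 / norm z ^ 2))"
    using v P by (intro mult_left_mono inv) auto
  also have "\<dots> = 2 * real P * (?v\<^sup>2 * (1 / ?v) ^ P * (1 / norm z ^ 2))"
    using v by simp
  also have "\<dots> \<le> 2 * 2 ^ P * (?v\<^sup>2 * (1 / ?v) ^ P * (1 / norm z ^ 2))"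
    using v by (intro mult_right_mono) (auto intro!: mult_nonneg_nonneg simp: of_nat_less_two_power less_imp_le)
  finally have 1: "norm (1 / z ^ P - 1 / cnj z ^ P) \<le> 2 * (?v\<^sup>2 * (2 / ?v) ^ P * (1 / norm z ^ 2))"
    by (simp add: power_divide mult_ac)
  have "norm (\<Sum>i=1..K. of_nat ((P - 1 + i) choose i) * (cnj z - z) ^ i * (1 / cnj z ^ (P + i))) \<le>
      (\<Sum>i=1..K. 4 ^ K * (?v\<^sup>2 * (2 / ?v) ^ P * (1 / norm z ^ 2)))"
  proof (rule sum_norm_le)
    fix i assume i: "i \<in> {1..K}"
    have "cnj z - z = of_real (- 2 * ?v) * \<i>"
      by (simp add: complex_eq_iff)
    then have n: "norm (cnj z - z) = 2 * ?v"
      using v by (simp only: norm_mult norm_of_real) simp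
    have "real ((P - 1 + i) choose i) \<le> 2 ^ (P - 1 + i)"
      using binomial_le_pow2 [of "P - 1 + i" i] by (metis numeral_power_le_of_nat_cancel_iff of_nat_le_iff of_nat_numeral of_nat_power)
    also have "\<dots> \<le> 2 ^ (P + K)"
      using i by (intro power_increasing) auto
    finally have b: "real ((P - 1 + i) choose i) \<le> 2 ^ (P + K)" .
    have "norm (of_nat ((P - 1 + i) choose i) * (cnj z - z) ^ i * (1 / cnj z ^ (P + i))) =
        real ((P - 1 + i) choose i) * ((2 * ?v) ^ i * (1 / norm z ^ (P + i)))"
      by (simp add: norm_mult norm_power norm_divide n)
    also have "\<dots> \<le> 2 ^ (P + K) * ((2 * ?v) ^ i * (?v\<^sup>2 * (1 / ?v) ^ (P + i) * (1 / norm z ^ 2)))"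
      using v b i P by (intro mult_mono mult_left_mono inv) auto
    also have "\<dots> = 2 ^ (P + K) * 2 ^ i * (?v\<^sup>2 * (1 / ?v) ^ P * (1 / norm z ^ 2))"
      using v by (simp add: power_mult_distrib power_add power_one_over)
    also have "\<dots> \<le> 2 ^ (P + K) * 2 ^ K * (?v\<^sup>2 * (1 / ?v) ^ P * (1 / norm z ^ 2))"
      using v i by (intro mult_right_mono mult_left_mono power_increasing) auto
    also have "\<dots> = 4 ^ K * (?v\<^sup>2 * (2 / ?v) ^ P * (1 / norm z ^ 2))"
      using power_mult_distrib [of "2::real" 2 K] by (simp add: power_add power_divide)
    finally show "norm (of_nat ((P - 1 + i) choose i) * (cnj z - z) ^ i * (1 / cnj z ^ (P + i))) \<le>
        4 ^ K * (?v\<^sup>2 * (2 / ?v) ^ P * (1 / norm z ^ 2))" .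
  qed
  then have 2: "norm (\<Sum>i=1..K. of_nat ((P - 1 + i) choose i) * (cnj z - z) ^ i * (1 / cnj z ^ (P + i))) \<le>
      real K * (4 ^ K * (?v\<^sup>2 * (2 / ?v) ^ P * (1 / norm z ^ 2)))"
    by simp
  have "norm (taylor_remainder K P z) \<le> 2 * (?v\<^sup>2 * (2 / ?v) ^ P * (1 / norm z ^ 2)) +
      real K * (4 ^ K * (?v\<^sup>2 * (2 / ?v) ^ P * (1 / norm z ^ 2)))"
    unfolding taylor_remainder_def by (rule order_trans [OF norm_triangle_ineq4 add_mono [OF 1 2]])
  then show ?thesis by (simp add: algebra_simps)
qed

lemma has_sum_sum_finite:
  fixes f :: "'i \<Rightarrow> 'a \<Rightarrow> complex"
  assumes "finite I" "\<And>i. i \<in> I \<Longrightarrow> (f i has_sum s i) A"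
  shows "((\<lambda>x. \<Sum>i\<in>I. f i x) has_sum (\<Sum>i\<in>I. s i)) A"
  using assms by (induction I rule: finite_induct) (auto intro!: has_sum_add)

lemma ninc_gamma_eq: "ninc_gamma (Suc K) y = exp (- y) * (\<Sum>j\<le>K. y ^ j / fact j)"
  by (simp add: ninc_gamma_def inc_gamma_eq)

lemma ninc_gamma_nonneg: "y \<ge> 0 \<Longrightarrow> ninc_gamma (Suc K) y \<ge> 0"
  by (simp add: ninc_gamma_def inc_gamma_nonneg)

text \<open>The rate is 7/8 of 4 \<pi> v minus the 2 \<pi> v by which q^(-1) grows. A Bessel growth
  of rate \<pi> v still leaves \<pi> v / 2.\<close>

lemma norm_ninc_gamma_ee_le:
  assumes "Im z > 0"
  shows "norm (of_real (ninc_gamma (Suc K) (4 * pi * Im z * real (Suc l))) * inverse (ee z) ^ Suc l) \<le>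
    8 ^ K * exp (- (3 / 2 * pi * Im z)) ^ Suc l"
proof -
  let ?y = "4 * pi * Im z * real (Suc l)"
  have y: "?y \<ge> 0" using assms by (simp del: of_nat_Suc)
  have "norm (of_real (ninc_gamma (Suc K) ?y) * inverse (ee z) ^ Suc l) = ninc_gamma (Suc K) ?y * exp (2 * pi * Im z * real (Suc l))"
  proof -
    have "norm (inverse (ee z) ^ Suc l) = exp (2 * pi * Im z) ^ Suc l"
      by (simp only: norm_power norm_inverse norm_ee exp_minus inverse_inverse_eq)
    also have "\<dots> = exp (2 * pi * Im z * real (Suc l))"
      by (simp only: exp_of_nat_mult [symmetric] mult.commute)
    finally show ?thesis
      using ninc_gamma_nonneg [OF y, of K] by (simp add: norm_mult del: of_nat_Suc power_Suc)
  qed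
  also have "\<dots> \<le> (8 ^ K * exp (- (7 / 8 * ?y))) * exp (2 * pi * Im z * real (Suc l))"
    using inc_gamma_le [OF y, of K] by (intro mult_right_mono) (simp_all add: ninc_gamma_def divide_simps mult_ac del: of_nat_Suc)
  also have "\<dots> = 8 ^ K * (exp (- (7 / 8 * ?y)) * exp (2 * pi * Im z * real (Suc l)))"
    by simp
  also have "exp (- (7 / 8 * ?y)) * exp (2 * pi * Im z * real (Suc l)) = exp (- (3 / 2 * pi * Im z)) ^ Suc l"
    unfolding exp_add [symmetric] exp_of_nat_mult [symmetric] by (rule arg_cong [where f = exp]) (simp add: field_simps)
  finally show ?thesis .
qed

lemma summable_on_ninc_gamma:
  assumes "Im z > 0"
  shows "(\<lambda>l. of_real (ninc_gamma (Suc K) (4 * pi * Im z * real (Suc l))) * inverse (ee z) ^ Suc l * of_nat (Suc l) ^ j) summable_on UNIV"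
proof (rule summable_on_norm_bound)
  show "(\<lambda>l. 8 ^ K * (real (Suc l) ^ j * exp (- (3 / 2 * pi * Im z)) ^ Suc l)) summable_on UNIV"
    using assms by (intro summable_on_cmult_right summable_nonneg_imp_summable_on summable_power_times_geometric) (auto simp del: of_nat_Suc)
  show "norm (of_real (ninc_gamma (Suc K) (4 * pi * Im z * real (Suc l))) * inverse (ee z) ^ Suc l * of_nat (Suc l) ^ j) \<le>
      8 ^ K * (real (Suc l) ^ j * exp (- (3 / 2 * pi * Im z)) ^ Suc l)" for l
    using mult_right_mono [OF norm_ninc_gamma_ee_le [OF assms, of K l], of "real (Suc l) ^ j"]
    by (simp only: norm_mult norm_power norm_of_nat) (simp add: mult_ac del: of_nat_Suc power_Suc)
qed

lemma summable_on_ninc_gamma_exp: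
  assumes "Im z > 0"
  shows "(\<lambda>l. norm (of_real (ninc_gamma (Suc K) (4 * pi * Im z * real (Suc l))) * inverse (ee z) ^ Suc l) * exp (pi * Im z * real (Suc l))) summable_on UNIV"
proof (rule summable_on_comparison_test)
  show "(\<lambda>l. 8 ^ K * (real (Suc l) ^ 0 * exp (- (pi * Im z / 2)) ^ Suc l)) summable_on UNIV"
    using assms by (intro summable_on_cmult_right summable_nonneg_imp_summable_on summable_power_times_geometric) (auto simp del: of_nat_Suc)
  show "norm (of_real (ninc_gamma (Suc K) (4 * pi * Im z * real (Suc l))) * inverse (ee z) ^ Suc l) * exp (pi * Im z * real (Suc l)) \<le>
      8 ^ K * (real (Suc l) ^ 0 * exp (- (pi * Im z / 2)) ^ Suc l)" for l
  proof -
    have "exp (- (3 / 2 * pi * Im z)) ^ Suc l * exp (pi * Im z * real (Suc l)) = exp (- (pi * Im z / 2)) ^ Suc l"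
      unfolding exp_of_nat_mult [symmetric] exp_add [symmetric] by (rule arg_cong [where f = exp]) (simp add: field_simps)
    then show ?thesis
      using mult_right_mono [OF norm_ninc_gamma_ee_le [OF assms, of K l], of "exp (pi * Im z * real (Suc l))"]
      by (simp only: mult.assoc power_0 mult_1 exp_ge_zero)
  qed
qed (auto simp del: of_nat_Suc)

text \<open>All terms at conj z are summed by the conjugate Lipschitz formula. On the l-th power of
  conj q their coefficients are (4 \<pi> v l)^i / i! for i \<le> K, apart from a common factor: this
  truncated exponential is the incomplete gamma function.\<close>

lemma taylor_remainder_has_sum:
  assumes z: "Im z > 0"
    and s: "((\<lambda>l. of_real (ninc_gamma (Suc K) (4 * pi * Im z * real (Suc l))) * inverse (ee z) ^ Suc l * of_nat (Suc l) ^ j) has_sum s) UNIV"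
  shows "((\<lambda>n::int. taylor_remainder K (Suc j) (z + of_int n)) has_sum
     ((- 2 * of_real pi * \<i>) ^ Suc j / fact j * polylog_neg j (ee z) - (2 * of_real pi * \<i>) ^ Suc j / fact j * s
      - (if j = 0 then 2 * of_real pi * \<i> else 0))) UNIV"
proof -
  let ?I = "2 * of_real pi * \<i>"
  have q: "norm (ee z) < 1" using z by (simp add: norm_ee)
  define t where "t i = of_nat ((j + i) choose i) * (cnj z - z) ^ i * (?I ^ (Suc j + i) / fact (j + i) * cnj (polylog_neg (j + i) (ee z)))" for i
  have "((\<lambda>n::int. (1 / (z + of_int n) ^ Suc j - 1 / (cnj z + of_int n) ^ Suc j)
      + - (\<Sum>i=1..K. of_nat ((j + i) choose i) * (cnj z - z) ^ i * (1 / (cnj z + of_int n) ^ (Suc j + i)))) has_sum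
     (((- 2 * of_real pi * \<i>) ^ Suc j / fact (Suc j - 1) * polylog_neg (Suc j - 1) (ee z)
      - ?I ^ Suc j / fact (Suc j - 1) * cnj (polylog_neg (Suc j - 1) (ee z)) - (if Suc j = 1 then ?I else 0))
      + - (\<Sum>i=1..K. of_nat ((j + i) choose i) * (cnj z - z) ^ i * (?I ^ (Suc j + i) / fact (Suc j + i - 1) * cnj (polylog_neg (Suc j + i - 1) (ee z)))))) UNIV"
    by (intro has_sum_add has_sum_uminusI has_sum_sum_finite has_sum_cmult_right lipschitz_formula_difference lipschitz_formula_cnj z) auto
  moreover have "taylor_remainder K (Suc j) (z + of_int n) = (1 / (z + of_int n) ^ Suc j - 1 / (cnj z + of_int n) ^ Suc j)
      + - (\<Sum>i=1..K. of_nat ((j + i) choose i) * (cnj z - z) ^ i * (1 / (cnj z + of_int n) ^ (Suc j + i)))" for n :: int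
    unfolding taylor_remainder_def by simp
  moreover have "((- 2 * of_real pi * \<i>) ^ Suc j / fact (Suc j - 1) * polylog_neg (Suc j - 1) (ee z)
      - ?I ^ Suc j / fact (Suc j - 1) * cnj (polylog_neg (Suc j - 1) (ee z)) - (if Suc j = 1 then ?I else 0))
      + - (\<Sum>i=1..K. of_nat ((j + i) choose i) * (cnj z - z) ^ i * (?I ^ (Suc j + i) / fact (Suc j + i - 1) * cnj (polylog_neg (Suc j + i - 1) (ee z))))
     = (- 2 * of_real pi * \<i>) ^ Suc j / fact j * polylog_neg j (ee z) - (t 0 + (\<Sum>i=1..K. t i)) - (if j = 0 then ?I else 0)"
    unfolding t_def by (simp del: power_Suc)
  ultimately have 1: "((\<lambda>n::int. taylor_remainder K (Suc j) (z + of_int n)) has_sum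
     ((- 2 * of_real pi * \<i>) ^ Suc j / fact j * polylog_neg j (ee z) - (t 0 + (\<Sum>i=1..K. t i))
      - (if j = 0 then ?I else 0))) UNIV"
    by (simp only:)
  have "{..K} = insert 0 {1..K}" by auto
  \<comment> \<open>The term i = 0 is the conjugate half of the difference formula; it completes the
    truncated exponential.\<close>
  then have t: "t 0 + (\<Sum>i=1..K. t i) = (\<Sum>i\<le>K. t i)" by simp
  have conj_q: "((\<lambda>l. of_nat (Suc l) ^ (j + i) * cnj (ee z) ^ Suc l) has_sum cnj (polylog_neg (j + i) (ee z))) UNIV" for i
    using has_sum_cnj_iff [THEN iffD2, OF polylog_neg_has_sum [OF q, of "j + i"]] by simp
  have "((\<lambda>l. \<Sum>i\<le>K. of_nat ((j + i) choose i) * (cnj z - z) ^ i * (?I ^ (Suc j + i) / fact (j + i) * (of_nat (Suc l) ^ (j + i) * cnj (ee z) ^ Suc l)))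
      has_sum (\<Sum>i\<le>K. t i)) UNIV"
    unfolding t_def by (intro has_sum_sum_finite has_sum_cmult_right conj_q) auto
  moreover have "(\<Sum>i\<le>K. of_nat ((j + i) choose i) * (cnj z - z) ^ i * (?I ^ (Suc j + i) / fact (j + i) * (of_nat (Suc l) ^ (j + i) * cnj (ee z) ^ Suc l)))
     = ?I ^ Suc j / fact j * (of_real (ninc_gamma (Suc K) (4 * pi * Im z * real (Suc l))) * inverse (ee z) ^ Suc l * of_nat (Suc l) ^ j)" for l
  proof -
    let ?y = "4 * pi * Im z * real (Suc l)"
    have cz: "(cnj z - z) * ?I = of_real (4 * pi * Im z)"
      by (simp add: complex_eq_iff)
    have "of_nat ((j + i) choose i) * (cnj z - z) ^ i * (?I ^ (Suc j + i) / fact (j + i) * (of_nat (Suc l) ^ (j + i) * cnj (ee z) ^ Suc l))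
        = ?I ^ Suc j / fact j * of_nat (Suc l) ^ j * cnj (ee z) ^ Suc l * of_real (?y ^ i / fact i)" for i
    proof -
      have "of_nat ((j + i) choose i) / fact (j + i) = (1 / (fact j * fact i) :: complex)"
        using binomial_fact [of i "j + i", where ?'a = complex] by simp
      moreover have "((cnj z - z) * ?I * of_nat (Suc l)) ^ i = of_real (?y ^ i)"
        unfolding cz by simp
      moreover have "of_nat ((j + i) choose i) * (cnj z - z) ^ i * (?I ^ (Suc j + i) / fact (j + i) * (of_nat (Suc l) ^ (j + i) * cnj (ee z) ^ Suc l))
         = (of_nat ((j + i) choose i) / fact (j + i)) * ((cnj z - z) * ?I * of_nat (Suc l)) ^ i * (?I ^ Suc j * of_nat (Suc l) ^ j * cnj (ee z) ^ Suc l)"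
        unfolding power_mult_distrib power_add by (simp only: times_divide_eq_left times_divide_eq_right mult_ac)
      ultimately show ?thesis
        by (simp add: mult_ac del: of_nat_Suc power_Suc)
    qed
    then have "(\<Sum>i\<le>K. of_nat ((j + i) choose i) * (cnj z - z) ^ i * (?I ^ (Suc j + i) / fact (j + i) * (of_nat (Suc l) ^ (j + i) * cnj (ee z) ^ Suc l)))
       = ?I ^ Suc j / fact j * of_nat (Suc l) ^ j * (cnj (ee z) ^ Suc l * of_real (\<Sum>i\<le>K. ?y ^ i / fact i))"
      by (simp only: of_real_sum sum_distrib_left mult.assoc)
    also have "cnj (ee z) ^ Suc l * of_real (\<Sum>i\<le>K. ?y ^ i / fact i) = of_real (ninc_gamma (Suc K) ?y) * inverse (ee z) ^ Suc l"
    proof -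
      have "exp (- (4 * pi * Im z)) ^ Suc l = exp (- ?y)"
        unfolding exp_of_nat_mult [symmetric] by (simp add: mult_ac del: of_nat_Suc)
      then show ?thesis
        unfolding cnj_ee' power_mult_distrib of_real_power [symmetric] ninc_gamma_eq by (simp only: of_real_mult mult_ac)
    qed
    finally show ?thesis by (simp only: mult_ac)
  qed
  ultimately have "((\<lambda>l. ?I ^ Suc j / fact j * (of_real (ninc_gamma (Suc K) (4 * pi * Im z * real (Suc l))) * inverse (ee z) ^ Suc l * of_nat (Suc l) ^ j))
     has_sum (\<Sum>i\<le>K. t i)) UNIV"
    by (simp only:)
  then have eq: "(\<Sum>i\<le>K. t i) = ?I ^ Suc j / fact j * s"
    using has_sum_cmult_right [OF s, of "?I ^ Suc j / fact j"] by (rule has_sum_unique)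
  show ?thesis using 1 unfolding t eq .
qed

text \<open>Summing the A-expansion over translates leaves three series in j. They are the constant
  from P = 1, a holomorphic Bessel sum and a gamma-weighted one, whose arguments have opposite
  signs.\<close>

lemma maass_inner_sum:
  assumes z: "Im z > 0"
  obtains S1 S2 where
    "((\<lambda>l. ee z ^ Suc l * bessel_series (Suc K) (- 2 * of_real pi * \<i> * A * of_nat (Suc l))) has_sum S1) UNIV"
    "((\<lambda>l. of_real (ninc_gamma (Suc K) (4 * pi * Im z * real (Suc l))) * inverse (ee z) ^ Suc l
        * bessel_series (Suc K) (2 * of_real pi * \<i> * A * of_nat (Suc l))) has_sum S2) UNIV"
    "((\<lambda>n::int. maass_term K A (z + of_int n)) has_sum
       (- 2 * of_real pi * \<i> * A ^ Suc K * (1 / fact (Suc K) + S1 + S2))) UNIV"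
proof -
  let ?I = "2 * of_real pi * \<i>"
  let ?Y = "- 2 * of_real pi * \<i> * A" and ?Z = "2 * of_real pi * \<i> * A"
  define b where "b l = of_real (ninc_gamma (Suc K) (4 * pi * Im z * real (Suc l))) * inverse (ee z) ^ Suc l" for l
  define s where "s j = infsum (\<lambda>l. b l * of_nat (Suc l) ^ j) UNIV" for j
  have s: "((\<lambda>l. b l * of_nat (Suc l) ^ j) has_sum s j) UNIV" for j
    unfolding s_def b_def by (intro has_sum_infsum summable_on_ninc_gamma z)
  have q: "norm (ee z) < 1" using z by (simp add: norm_ee)
  obtain S1 where S1: "((\<lambda>l. ee z ^ Suc l * bessel_series (Suc K) (?Y * of_nat (Suc l))) has_sum S1) UNIV"
    and S1': "((\<lambda>j. ?Y ^ j / (fact j * fact (j + Suc K)) * polylog_neg j (ee z)) has_sum S1) UNIV"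
  proof (rule bessel_series_exchange)
    show "0 < pi * Im z" using z by simp
    show "(\<lambda>l. norm (ee z ^ Suc l) * exp (pi * Im z * real (Suc l))) summable_on UNIV"
      using summable_on_ee_power [OF z, of 0] by simp
    show "((\<lambda>l. ee z ^ Suc l * of_nat (Suc l) ^ j) has_sum polylog_neg j (ee z)) UNIV" for j
      using polylog_neg_has_sum [OF q, of j] by (simp only: mult.commute)
  qed
  obtain S2 where S2: "((\<lambda>l. b l * bessel_series (Suc K) (?Z * of_nat (Suc l))) has_sum S2) UNIV"
    and S2': "((\<lambda>j. ?Z ^ j / (fact j * fact (j + Suc K)) * s j) has_sum S2) UNIV"
  proof (rule bessel_series_exchange)
    show "0 < pi * Im z" using z by simp
    show "(\<lambda>l. norm (b l) * exp (pi * Im z * real (Suc l))) summable_on UNIV"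
      unfolding b_def by (rule summable_on_ninc_gamma_exp [OF z])
  qed (rule s)
  define h where "h j = A ^ (j + Suc K) / fact (j + Suc K) * ((- 2 * of_real pi * \<i>) ^ Suc j / fact j * polylog_neg j (ee z)
      - ?I ^ Suc j / fact j * s j - (if j = 0 then ?I else 0))" for j
  define C where "C = norm A ^ Suc K * (((Im z)\<^sup>2 * (2 + real K * 4 ^ K)) * (2 / Im z))"
  have bd: "norm (A ^ (j + Suc K) / fact (j + Suc K) * taylor_remainder K (Suc j) (z + of_int n)) \<le>
      1 / norm (z + of_int n) ^ 2 * (C * ((2 * norm A / Im z) ^ j / fact j))" for n :: int and j
  proof -
    let ?B = "((Im z)\<^sup>2 * (2 + real K * 4 ^ K)) * (2 / Im z) ^ Suc j"
    have "norm (A ^ (j + Suc K) / fact (j + Suc K)) = norm A ^ (j + Suc K) / fact (j + Suc K)"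
      by (simp add: norm_divide norm_power del: fact_Suc power_Suc)
    also have "\<dots> \<le> norm A ^ (j + Suc K) / fact j"
      by (intro divide_left_mono fact_mono) auto
    finally have 1: "norm (A ^ (j + Suc K) / fact (j + Suc K)) \<le> norm A ^ (j + Suc K) / fact j" .
    have 2: "norm (taylor_remainder K (Suc j) (z + of_int n)) \<le> ?B * (1 / norm (z + of_int n) ^ 2)"
      using norm_taylor_remainder_le [of "z + of_int n" "Suc j" K] z by (simp del: power_Suc)
    have "norm (A ^ (j + Suc K) / fact (j + Suc K) * taylor_remainder K (Suc j) (z + of_int n)) \<le>
        (norm A ^ (j + Suc K) / fact j) * (?B * (1 / norm (z + of_int n) ^ 2))"
      unfolding norm_mult by (intro mult_mono 1 2) auto
    also have "\<dots> = 1 / norm (z + of_int n) ^ 2 * (C * ((2 * norm A / Im z) ^ j / fact j))"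
      unfolding C_def by (simp add: power_add power_divide power_mult_distrib mult_ac)
    finally show ?thesis .
  qed
  have C0: "C \<ge> 0" using z by (simp add: C_def)
  have se: "summable (\<lambda>j. C * ((2 * norm A / Im z) ^ j / fact j))"
    by (intro summable_mult sums_summable [OF exp_sums_real])
  obtain S where S: "((\<lambda>n::int. maass_term K A (z + of_int n)) has_sum S) UNIV" and S': "(h has_sum S) UNIV"
  proof (rule has_sum_exchange)
    let ?f = "\<lambda>(n::int) j. A ^ (j + Suc K) / fact (j + Suc K) * taylor_remainder K (Suc j) (z + of_int n)"
    show "(?f n has_sum maass_term K A (z + of_int n)) UNIV" for n
    proof (rule norm_summable_imp_has_sum)
      have "summable (\<lambda>j. 1 / norm (z + of_int n) ^ 2 * (C * ((2 * norm A / Im z) ^ j / fact j)))"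
        by (rule summable_mult [OF se])
      then show "summable (\<lambda>j. norm (?f n j))"
        by (rule summable_comparison_test') (use bd in auto)
      show "?f n sums maass_term K A (z + of_int n)"
        using z by (intro maass_term_sums) (auto simp: complex_eq_iff)
    qed
    show "((\<lambda>n. ?f n j) has_sum h j) UNIV" for j
      unfolding h_def by (intro has_sum_cmult_right taylor_remainder_has_sum z s [unfolded b_def])
    show "norm (?f n j) \<le> 1 / norm (z + of_int n) ^ 2 * (C * ((2 * norm A / Im z) ^ j / fact j))" for n j
      by (rule bd)
    show "(\<lambda>n::int. 1 / norm (z + of_int n) ^ 2) summable_on UNIV"
      using z by (intro summable_on_inverse_shift_squared) auto
    show "(\<lambda>j. C * ((2 * norm A / Im z) ^ j / fact j)) summable_on UNIV"
      using se C0 z by (intro summable_nonneg_imp_summable_on) auto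
  qed (use z C0 in auto)
  \<comment> \<open>The Lipschitz constant occurs only for P = 1, that is at j = 0, with coefficient
    1 / (K + 1)!.\<close>
  have "((\<lambda>j. if j = 0 then 1 / fact (Suc K) else 0) has_sum (1 / fact (Suc K) :: complex)) (UNIV :: nat set)"
    by (rule has_sum_finite_neutralI [of "{0}"]) auto
  then have "((\<lambda>j. - ?I * A ^ Suc K * ((if j = 0 then 1 / fact (Suc K) else 0) + ?Y ^ j / (fact j * fact (j + Suc K)) * polylog_neg j (ee z)
     + ?Z ^ j / (fact j * fact (j + Suc K)) * s j)) has_sum (- ?I * A ^ Suc K * (1 / fact (Suc K) + S1 + S2))) UNIV"
    by (intro has_sum_cmult_right has_sum_add S1' S2')
  moreover have "- ?I * A ^ Suc K * ((if j = 0 then 1 / fact (Suc K) else 0) + ?Y ^ j / (fact j * fact (j + Suc K)) * polylog_neg j (ee z)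
     + ?Z ^ j / (fact j * fact (j + Suc K)) * s j) = h j" for j
  proof -
    have "- 2 * of_real pi * \<i> = - ?I" by simp
    then have pY: "?Y ^ j = (- ?I) ^ j * A ^ j" and pZ: "?Z ^ j = ?I ^ j * A ^ j"
      and pI: "(- 2 * of_real pi * \<i>) ^ Suc j = - ?I * (- ?I) ^ j"
      by (simp_all only: power_mult_distrib power_Suc)
    show ?thesis
      unfolding h_def pY pZ pI power_add [of A j] by (cases "j = 0") (simp_all add: field_simps del: fact_Suc)
  qed
  ultimately have "(h has_sum (- ?I * A ^ Suc K * (1 / fact (Suc K) + S1 + S2))) UNIV"
    by (simp only:)
  then have "S = - ?I * A ^ Suc K * (1 / fact (Suc K) + S1 + S2)"
    using S' has_sum_unique by blast
  with S have "((\<lambda>n::int. maass_term K A (z + of_int n)) has_sum (- 2 * of_real pi * \<i> * A ^ Suc K * (1 / fact (Suc K) + S1 + S2))) UNIV"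
    by simp
  with S1 S2 that show ?thesis unfolding b_def by blast
qed

section \<open>Kloosterman sums and Fourier coefficients\<close>

lemma ee_cong_mod:
  assumes "c > 0" "int c dvd x - y"
  shows "ee (of_int x / of_nat c) = ee (of_int y / of_nat c)"
proof -
  obtain t where "x - y = int c * t" using assms(2) by blast
  then have "x = y + int c * t" by simp
  then have "of_int x / of_nat c = (of_int y / of_nat c + of_int t :: complex)"
    using assms(1) by (simp add: field_simps)
  then show ?thesis by (simp add: ee_add_of_int)
qed

text \<open>Substitution of -d for d. The inverse of -d is minus the inverse of d only modulo c, so
  the summands agree by periodicity of the exponential.\<close>

lemma kloosterman_minus:
  assumes c: "c > 0"
  shows "kloosterman (- a) (- b) c = kloosterman a b c"
  unfolding kloosterman_def
proof (rule sum.reindex_bij_witness [of _ "\<lambda>d. (- d) mod int c" "\<lambda>d. (- d) mod int c"])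
  have closed: "(- d) mod int c \<in> units_mod c" if "d \<in> units_mod c" for d
  proof -
    have "coprime (- d) (int c)" using that by (simp add: units_mod_def)
    then have "coprime ((- d) mod int c) (int c)"
      by (simp add: coprime_iff_gcd_eq_1 gcd.commute flip: gcd_red_int)
    then show ?thesis using c by (simp add: units_mod_def)
  qed
  have invol: "(- ((- d) mod int c)) mod int c = d" if "d \<in> units_mod c" for d
    using that by (simp add: mod_minus_eq units_mod_def)
  fix d assume d: "d \<in> units_mod c"
  show "(- ((- d) mod int c)) mod int c = d" "(- d) mod int c \<in> units_mod c" using closed invol d by auto
  define d' where "d' = (- d) mod int c"
  have "d' \<in> units_mod c" using closed [OF d] by (simp add: d'_def)
  then have inv: "int c dvd d * minv (int c) d - 1" "int c dvd d' * minv (int c) d' - 1"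
    using d by (auto intro!: minv_correct simp: units_mod_def)
  have dd: "int c dvd d + d'"
    unfolding d'_def by (metis add.commute diff_minus_eq_add dvd_minus_mod dvd_minus_iff minus_add_distrib minus_minus uminus_add_conv_diff)
  \<comment> \<open>This combination of multiples of c simplifies to the sum of the two
    inverses.\<close>
  have "int c dvd minv (int c) d * minv (int c) d' * (d + d')
      - minv (int c) d' * (d * minv (int c) d - 1) - minv (int c) d * (d' * minv (int c) d' - 1)"
    by (rule dvd_diff [OF dvd_diff [OF dvd_mult [OF dd] dvd_mult [OF inv(1)]] dvd_mult [OF inv(2)]])
  then have mm: "int c dvd minv (int c) d + minv (int c) d'"
    by (simp add: algebra_simps)
  have "int c dvd (a * (minv (int c) d + minv (int c) d') + b * (d + d'))"
    by (rule dvd_add [OF dvd_mult [OF mm] dvd_mult [OF dd]])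
  then have "int c dvd (a * minv (int c) d' + b * d') - (- a * minv (int c) d + - b * d)"
    by (simp add: algebra_simps)
  then show "ee (of_int (a * minv (int c) ((- d) mod int c) + b * ((- d) mod int c)) / of_nat c) =
      ee (of_int (- a * minv (int c) d + - b * d) / of_nat c)"
    unfolding d'_def [symmetric] by (rule ee_cong_mod [OF c])
qed (use c in \<open>auto simp: units_mod_def mod_minus_eq coprime_iff_gcd_eq_1 gcd.commute simp flip: gcd_red_int\<close>)

lemma norm_kloosterman_le: "norm (kloosterman a b c) \<le> real c"
proof -
  have "norm (kloosterman a b c) \<le> (\<Sum>d\<in>units_mod c. 1)"
    unfolding kloosterman_def by (rule sum_norm_le) (simp add: norm_ee)
  also have "\<dots> \<le> real c" using card_units_mod_le by simp
  finally show ?thesis .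
qed

lemma cnj_kloosterman: "cnj (kloosterman a b c) = kloosterman (- a) (- b) c"
proof -
  have "cnj (ee (of_int (a * p + b * d) / of_nat c)) = ee (of_int (- a * p + - b * d) / of_nat c)" for p d
  proof -
    have "of_int (- a * p + - b * d) = - (of_int (a * p + b * d) :: complex)" by simp
    then show ?thesis by (simp only: cnj_ee complex_cnj_divide complex_cnj_of_int complex_cnj_of_nat minus_divide_left)
  qed
  then show ?thesis unfolding kloosterman_def cnj_sum by (simp only:)
qed

section \<open>Interchange of the sums over moduli and frequencies\<close>

text \<open>The weights e are exponential or gamma type, s is the sign of the frequency, and Y is
  the part of the Bessel argument independent of c. Index n stands for frequency n + 1.\<close>

definition bessel_sum :: "nat \<Rightarrow> (nat \<Rightarrow> complex) \<Rightarrow> int \<Rightarrow> complex \<Rightarrow> nat \<Rightarrow> int \<Rightarrow> complex" where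
  "bessel_sum w e s Y c d = (\<Sum>\<^sub>\<infinity>n. e n * ee (of_int (s * int (Suc n) * d) / of_nat c)
     * bessel_series w (Y / (of_nat c)\<^sup>2 * of_nat (Suc n)))"

text \<open>Up to elementary factors, the sum over c of Kloosterman sums times Bessel functions in a
  Fourier coefficient of a Poincare series. Of the power of c, the part c^w belongs to the factor
  (x/2)^w of the Bessel function.\<close>

definition kloosterman_bessel :: "nat \<Rightarrow> nat \<Rightarrow> int \<Rightarrow> int \<Rightarrow> complex \<Rightarrow> nat \<Rightarrow> complex" where
  "kloosterman_bessel N w l s Y n = (\<Sum>\<^sub>\<infinity>i. kloosterman l (s * int n) (N * Suc i) / of_nat (N * Suc i) ^ Suc w
     * bessel_series w (Y / (of_nat (N * Suc i))\<^sup>2 * of_nat n))"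

lemma norm_bessel_series_div_le:
  assumes "\<rho> > 0" "c > 0"
  shows "norm (bessel_series w (Y / (of_nat c)\<^sup>2 * of_nat n)) \<le> exp (\<rho> * real n) * exp (norm Y / \<rho>)"
proof (rule norm_bessel_series_le)
  have "1 \<le> (real c)\<^sup>2" using assms(2) by simp
  then have "norm Y / (real c)\<^sup>2 \<le> norm Y / 1" using assms(2) by (intro divide_left_mono) auto
  then have "norm Y / (real c)\<^sup>2 * real n \<le> norm Y * real n" by (intro mult_right_mono) auto
  then show "norm (Y / (of_nat c)\<^sup>2 * of_nat n) \<le> norm Y * real n"
    by (simp add: norm_mult norm_divide norm_power)
qed (use assms in auto)

lemma bessel_sum_has_sum:
  assumes "\<rho> > 0" "c > 0" and e: "(\<lambda>n. norm (e n) * exp (\<rho> * real (Suc n))) summable_on UNIV"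
  shows "((\<lambda>n. e n * ee (of_int (s * int (Suc n) * d) / of_nat c)
     * bessel_series w (Y / (of_nat c)\<^sup>2 * of_nat (Suc n))) has_sum bessel_sum w e s Y c d) UNIV"
  unfolding bessel_sum_def
proof (rule has_sum_infsum, rule summable_on_norm_bound)
  show "(\<lambda>n. exp (norm Y / \<rho>) * (norm (e n) * exp (\<rho> * real (Suc n)))) summable_on UNIV"
    using e by (rule summable_on_cmult_right)
  show "norm (e n * ee (of_int (s * int (Suc n) * d) / of_nat c) * bessel_series w (Y / (of_nat c)\<^sup>2 * of_nat (Suc n)))
      \<le> exp (norm Y / \<rho>) * (norm (e n) * exp (\<rho> * real (Suc n)))" for n
  proof -
    have "norm (ee (of_int (s * int (Suc n) * d) / of_nat c)) = 1"
      by (simp add: norm_ee del: of_nat_Suc)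
    then show ?thesis
      using mult_left_mono [OF norm_bessel_series_div_le [OF assms(1,2), of w Y "Suc n"], of "norm (e n)"]
      by (simp add: norm_mult mult_ac del: of_nat_Suc)
  qed
qed

text \<open>For fixed c the residues d assemble into Kloosterman sums, frequency by frequency.
  Bounding these by c leaves 1/c^w, and the Bessel bound is uniform in c, so a product majorant
  exists.\<close>

lemma kloosterman_exchange:
  assumes N: "N > 0" and w: "w \<ge> 2" and \<rho>: "\<rho> > 0"
    and e: "(\<lambda>n. norm (e n) * exp (\<rho> * real (Suc n))) summable_on UNIV"
  obtains Z where
    "((\<lambda>i. (\<Sum>d\<in>units_mod (N * Suc i). ee (of_int (l * minv (int (N * Suc i)) d) / of_nat (N * Suc i))
        * bessel_sum w e s Y (N * Suc i) d) / of_nat (N * Suc i) ^ Suc w) has_sum Z) UNIV"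
    "((\<lambda>n. e n * kloosterman_bessel N w l s Y (Suc n)) has_sum Z) UNIV"
proof (rule has_sum_exchange)
  let ?c = "\<lambda>i. N * Suc i"
  let ?k = "\<lambda>i n. kloosterman l (s * int (Suc n)) (?c i) / of_nat (?c i) ^ Suc w * bessel_series w (Y / (of_nat (?c i))\<^sup>2 * of_nat (Suc n))"
  let ?f = "\<lambda>i n. e n * ?k i n"
  let ?E = "exp (norm Y / \<rho>)"
  have c: "?c i > 0" for i using N by simp
  have kb: "norm (?k i n) \<le> 1 / real (?c i) ^ w * (exp (\<rho> * real (Suc n)) * ?E)" for i n
  proof -
    have "norm (kloosterman l (s * int (Suc n)) (?c i) / of_nat (?c i) ^ Suc w) \<le> real (?c i) / real (?c i) ^ Suc w"
      unfolding norm_divide norm_power norm_of_nat by (intro divide_right_mono norm_kloosterman_le) simp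
    also have "\<dots> = 1 / real (?c i) ^ w"
    proof -
      have "real x / real x ^ Suc w = 1 / real x ^ w" if "x > 0" for x :: nat
        using that by simp
      from this [OF c] show ?thesis .
    qed
    finally show ?thesis
      unfolding norm_mult by (intro mult_mono norm_bessel_series_div_le \<rho> c) auto
  qed
  have sc: "(\<lambda>i. 1 / real (?c i) ^ w) summable_on UNIV"
    using N w by (intro summable_nonneg_imp_summable_on summable_inverse_multiples) auto
  show "(?f i has_sum ((\<Sum>d\<in>units_mod (?c i). ee (of_int (l * minv (int (?c i)) d) / of_nat (?c i))
        * bessel_sum w e s Y (?c i) d) / of_nat (?c i) ^ Suc w)) UNIV" for i
  proof -
    have "((\<lambda>n. (\<Sum>d\<in>units_mod (?c i). ee (of_int (l * minv (int (?c i)) d) / of_nat (?c i))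
        * (e n * ee (of_int (s * int (Suc n) * d) / of_nat (?c i)) * bessel_series w (Y / (of_nat (?c i))\<^sup>2 * of_nat (Suc n)))) / of_nat (?c i) ^ Suc w)
       has_sum ((\<Sum>d\<in>units_mod (?c i). ee (of_int (l * minv (int (?c i)) d) / of_nat (?c i))
        * bessel_sum w e s Y (?c i) d) / of_nat (?c i) ^ Suc w)) UNIV"
      by (intro has_sum_divide_const has_sum_sum_finite has_sum_cmult_right bessel_sum_has_sum [OF \<rho> c e]) auto
    moreover have "(\<Sum>d\<in>units_mod (?c i). ee (of_int (l * minv (int (?c i)) d) / of_nat (?c i))
        * (e n * ee (of_int (s * int (Suc n) * d) / of_nat (?c i)) * bessel_series w (Y / (of_nat (?c i))\<^sup>2 * of_nat (Suc n)))) / of_nat (?c i) ^ Suc w = ?f i n" for n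
    proof -
      have "ee (of_int (l * minv (int (?c i)) d) / of_nat (?c i)) * ee (of_int (s * int (Suc n) * d) / of_nat (?c i)) =
          ee (of_int (l * minv (int (?c i)) d + s * int (Suc n) * d) / of_nat (?c i))" for d
        unfolding ee_add [symmetric] by (simp add: add_divide_distrib del: of_nat_Suc of_nat_mult)
      then have "kloosterman l (s * int (Suc n)) (?c i) = (\<Sum>d\<in>units_mod (?c i). ee (of_int (l * minv (int (?c i)) d) / of_nat (?c i)) * ee (of_int (s * int (Suc n) * d) / of_nat (?c i)))"
        unfolding kloosterman_def by (simp only:)
      then show ?thesis
        by (simp add: sum_distrib_left sum_distrib_right sum_divide_distrib mult_ac del: of_nat_Suc of_nat_mult power_Suc)
    qed
    ultimately show ?thesis by (simp only:)
  qed
  show "((\<lambda>i. ?f i n) has_sum (e n * kloosterman_bessel N w l s Y (Suc n))) UNIV" for n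
    unfolding kloosterman_bessel_def
  proof (rule has_sum_cmult_right, rule has_sum_infsum, rule summable_on_norm_bound)
    show "(\<lambda>i. 1 / real (?c i) ^ w * (exp (\<rho> * real (Suc n)) * ?E)) summable_on UNIV"
      using sc by (rule summable_on_cmult_left)
  qed (rule kb)
  show "norm (?f i n) \<le> 1 / real (?c i) ^ w * (?E * (norm (e n) * exp (\<rho> * real (Suc n))))" for i n
    using mult_left_mono [OF kb [of n i] norm_ge_zero [of "e n"]] by (simp only: norm_mult mult_ac)
  show "(\<lambda>n. ?E * (norm (e n) * exp (\<rho> * real (Suc n)))) summable_on UNIV"
    using e by (rule summable_on_cmult_right)
  show "(\<lambda>i. 1 / real (?c i) ^ w) summable_on UNIV"
    by (rule sc)
qed (use that in auto)

section \<open>Fourier coefficients of the holomorphic Poincare series\<close>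

lemma weight_bound:
  assumes "K \<ge> 2" "Im z = v" "v > 0" "c > (0::nat)"
  shows "1 / (real c * norm z) ^ (K + 2) \<le> (1 / v) ^ (K - 2) / (real c * norm z) ^ 4"
proof -
  have vz: "v \<le> norm z" using abs_Im_le_cmod [of z] assms by simp
  also have "\<dots> \<le> real c * norm z" using assms mult_right_mono [of 1 "real c" "norm z"] by simp
  finally have le: "v \<le> real c * norm z" .
  have "K + 2 = (K - 2) + 4" using assms(1) by simp
  then have "1 / (real c * norm z) ^ (K + 2) = (1 / (real c * norm z)) ^ (K - 2) / (real c * norm z) ^ 4"
    by (simp only: power_add power_one_over) simp
  also have "\<dots> \<le> (1 / v) ^ (K - 2) / (real c * norm z) ^ 4"
    using le assms(3,4) by (intro divide_right_mono power_mono divide_left_mono mult_pos_pos) auto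
  finally show ?thesis .
qed

lemma ee_shift_power:
  "ee (\<tau> + of_int d / of_nat c) ^ Suc n = ee \<tau> ^ Suc n * ee (of_int (1 * int (Suc n) * d) / of_nat c)"
  unfolding ee_of_nat_mult [symmetric] ee_add [symmetric] by (simp add: ring_distribs del: of_nat_Suc)

lemma ee_shift_power_inverse:
  "inverse (ee (\<tau> + of_int d / of_nat c)) ^ Suc n = inverse (ee \<tau>) ^ Suc n * ee (of_int (- 1 * int (Suc n) * d) / of_nat c)"
proof -
  have "of_int (- 1 * int (Suc n) * d) / of_nat c = - (of_int (1 * int (Suc n) * d) / of_nat c :: complex)"
    by (simp del: of_nat_Suc)
  then show ?thesis
    unfolding power_inverse ee_shift_power by (simp only: ee_minus inverse_mult_distrib)
qed

lemma Poinc_expansion: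
  assumes N: "N > 0" and K: "K \<ge> 2" "even K" and \<tau>: "Im \<tau> > 0"
  shows "((\<lambda>n. (- 2 * of_real pi * \<i>) ^ (K + 2) * (of_nat (Suc n) ^ Suc K * kloosterman_bessel N (Suc K) l 1 (- 4 * of_real pi ^ 2 * of_int l) (Suc n)) * ee \<tau> ^ Suc n)
    has_sum (Poinc N (int K + 2) l \<tau> - ee (of_int l * \<tau>))) UNIV"
proof -
  let ?Y = "- 4 * of_real pi ^ 2 * of_int l :: complex"
  define e where "e n = of_nat (Suc n) ^ Suc K * ee \<tau> ^ Suc n" for n
  have \<rho>: "pi * Im \<tau> > 0" using \<tau> by simp
  have e: "(\<lambda>n. norm (e n) * exp (pi * Im \<tau> * real (Suc n))) summable_on UNIV"
    unfolding e_def by (rule summable_on_ee_power [OF \<tau>])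
  let ?f = "\<lambda>z. ee (of_int l * z)"
  let ?G = "\<lambda>c d. (- 2 * of_real pi * \<i>) ^ (K + 2) / of_nat c ^ (K + 2) * bessel_sum (Suc K) e 1 ?Y c d"
  have pw: "x powi (- (int K + 2)) = 1 / x ^ (K + 2)" for x :: complex
  proof -
    have "int K + 2 = int (K + 2)" by simp
    then show ?thesis by (simp only: power_int_minus power_int_of_nat inverse_eq_divide)
  qed
  have "((\<lambda>i. \<Sum>d\<in>units_mod (N * Suc i). ee (of_int (l * minv (int (N * Suc i)) d) / of_nat (N * Suc i)) * ?G (N * Suc i) d)
    has_sum (poincare_sum N (int K + 2) ?f \<tau> - ?f \<tau>)) UNIV"
  proof (rule poincare_sum_expand [OF N _ \<tau>])
    show "even (int K + 2)" using K by simp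
    show "?f (z + of_real x) = ee (of_int l * of_real x) * ?f z" for x z
      by (simp add: ring_distribs ee_add)
  next
    fix c :: nat and z assume c: "c > 0" and z: "Im z = Im \<tau>"
    have vz: "Im \<tau> \<le> norm z" using abs_Im_le_cmod [of z] z \<tau> by simp
    \<comment> \<open>For negative l the exponential grows with the imaginary part, but -1/(c^2 z)
      has modulus at most 1 / Im \<tau>, so the bound is uniform.\<close>
    have "norm (?f (- 1 / ((of_nat c)\<^sup>2 * z))) \<le> exp (2 * pi * (\<bar>of_int l\<bar> / Im \<tau>))"
    proof -
      have "Im \<tau> \<le> (real c)\<^sup>2 * norm z"
        using vz c mult_mono [of 1 "(real c)\<^sup>2" "Im \<tau>" "norm z"] \<tau> by simp
      then have "norm (of_int l * (- 1 / ((of_nat c)\<^sup>2 * z)) :: complex) \<le> \<bar>of_int l\<bar> / Im \<tau>"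
        using \<tau> by (simp add: norm_mult norm_divide norm_power divide_left_mono)
      then have "- Im (of_int l * (- 1 / ((of_nat c)\<^sup>2 * z))) \<le> \<bar>of_int l\<bar> / Im \<tau>"
        using abs_Im_le_cmod [of "of_int l * (- 1 / ((of_nat c)\<^sup>2 * z))"] by linarith
      then have "2 * pi * - Im (of_int l * (- 1 / ((of_nat c)\<^sup>2 * z))) \<le> 2 * pi * (\<bar>of_int l\<bar> / Im \<tau>)"
        by (intro mult_left_mono) auto
      then show ?thesis unfolding norm_ee by simp
    qed
    moreover have "norm ((of_nat c * z) powi (- (int K + 2))) \<le> (1 / Im \<tau>) ^ (K - 2) / (real c * norm z) ^ 4"
      unfolding pw using weight_bound [OF K(1) z \<tau> c] by (simp add: norm_divide norm_mult norm_power del: power_Suc)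
    ultimately have "norm ((of_nat c * z) powi (- (int K + 2)) * ?f (- 1 / ((of_nat c)\<^sup>2 * z))) \<le>
        ((1 / Im \<tau>) ^ (K - 2) / (real c * norm z) ^ 4) * exp (2 * pi * (\<bar>of_int l\<bar> / Im \<tau>))"
      unfolding norm_mult [of "_ powi _"] using \<tau> by (intro mult_mono) auto
    then show "norm ((of_nat c * z) powi (- (int K + 2)) * ?f (- 1 / ((of_nat c)\<^sup>2 * z))) \<le>
        ((1 / Im \<tau>) ^ (K - 2) * exp (2 * pi * (\<bar>of_int l\<bar> / Im \<tau>))) / (real c * norm z) ^ 4"
      by simp
  next
    fix c :: nat and d :: int assume c: "c > 0"
    \<comment> \<open>With this A, exp(A/z) is \<open>?f\<close> at -1/(c^2 z), and -2 \<pi> i A =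
      -4 \<pi>^2 l / c^2: positive l leads to J, negative l to I.\<close>
    let ?A = "- 2 * of_real pi * \<i> * of_int l / (of_nat c)\<^sup>2 :: complex"
    let ?z = "\<tau> + of_int d / of_nat c"
    have z: "Im ?z > 0" using \<tau> by simp
    have YA: "- 2 * of_real pi * \<i> * ?A = ?Y / (of_nat c)\<^sup>2"
    proof -
      have "(- 2 * of_real pi * \<i>) * (- 2 * of_real pi * \<i>) = - 4 * of_real pi ^ 2"
        by (simp add: complex_eq_iff power2_eq_square)
      then show ?thesis by (simp only: times_divide_eq_right mult.assoc [symmetric])
    qed
    obtain S where
      S: "((\<lambda>n. of_nat (Suc n) ^ Suc K * ee ?z ^ Suc n * bessel_series (Suc K) (- 2 * of_real pi * \<i> * ?A * of_nat (Suc n))) has_sum S) UNIV"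
      and S': "((\<lambda>n::int. exp (?A / (?z + of_int n)) / (?z + of_int n) ^ Suc (Suc K)) has_sum ((- 2 * of_real pi * \<i>) ^ Suc (Suc K) * S)) UNIV"
      by (rule holomorphic_inner_sum [OF z, of "Suc K" ?A]) simp
    have "((\<lambda>n. e n * ee (of_int (1 * int (Suc n) * d) / of_nat c) * bessel_series (Suc K) (?Y / (of_nat c)\<^sup>2 * of_nat (Suc n))) has_sum S) UNIV"
      using S [unfolded YA ee_shift_power] by (simp only: e_def mult.assoc)
    then have "S = bessel_sum (Suc K) e 1 ?Y c d"
      unfolding bessel_sum_def by (rule infsumI [symmetric])
    with has_sum_cmult_right [OF S', of "1 / of_nat c ^ (K + 2)"]
    have "((\<lambda>n::int. 1 / of_nat c ^ (K + 2) * (exp (?A / (?z + of_int n)) / (?z + of_int n) ^ (K + 2))) has_sum ?G c d) UNIV"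
      by (simp add: add_2_eq_Suc' del: power_Suc)
    moreover have "1 / of_nat c ^ (K + 2) * (exp (?A / (?z + of_int n)) / (?z + of_int n) ^ (K + 2)) =
        (of_nat c * (?z + of_int n)) powi (- (int K + 2)) * ?f (- 1 / ((of_nat c)\<^sup>2 * (?z + of_int n)))" for n :: int
    proof -
      have "?A / (?z + of_int n) = 2 * of_real pi * \<i> * (of_int l * (- 1 / ((of_nat c)\<^sup>2 * (?z + of_int n))))"
        by simp
      then show ?thesis
        unfolding pw ee_def by (simp only: power_mult_distrib) simp
    qed
    ultimately show "((\<lambda>n::int. (of_nat c * (?z + of_int n)) powi (- (int K + 2)) * ?f (- 1 / ((of_nat c)\<^sup>2 * (?z + of_int n)))) has_sum ?G c d) UNIV"
      by (simp only:)
  qed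
  moreover obtain Z where
    Z: "((\<lambda>i. (\<Sum>d\<in>units_mod (N * Suc i). ee (of_int (l * minv (int (N * Suc i)) d) / of_nat (N * Suc i))
        * bessel_sum (Suc K) e 1 ?Y (N * Suc i) d) / of_nat (N * Suc i) ^ Suc (Suc K)) has_sum Z) UNIV"
    and Z': "((\<lambda>n. e n * kloosterman_bessel N (Suc K) l 1 ?Y (Suc n)) has_sum Z) UNIV"
    by (rule kloosterman_exchange [OF N _ \<rho> e, where w = "Suc K" and l = l and s = 1 and Y = ?Y]) (use K in simp)
  have "((\<lambda>i. \<Sum>d\<in>units_mod (N * Suc i). ee (of_int (l * minv (int (N * Suc i)) d) / of_nat (N * Suc i)) * ?G (N * Suc i) d)
    has_sum ((- 2 * of_real pi * \<i>) ^ (K + 2) * Z)) UNIV"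
    using has_sum_cmult_right [OF Z, of "(- 2 * of_real pi * \<i>) ^ (K + 2)"]
    by (simp add: sum_distrib_left sum_divide_distrib mult_ac add_2_eq_Suc' del: power_Suc of_nat_Suc of_nat_mult)
  ultimately have "Poinc N (int K + 2) l \<tau> - ee (of_int l * \<tau>) = (- 2 * of_real pi * \<i>) ^ (K + 2) * Z"
    unfolding Poinc_def by (rule has_sum_unique)
  then show ?thesis
    using has_sum_cmult_right [OF Z', of "(- 2 * of_real pi * \<i>) ^ (K + 2)"]
    by (simp add: e_def mult_ac del: power_Suc of_nat_Suc)
qed


lemma integral_ee:
  "((\<lambda>u. ee (of_int p * Complex u 1)) has_integral (if p = 0 then 1 else 0)) {0..1}"
proof (cases "p = 0")
  case True
  then show ?thesis
    using has_integral_const_real [of "1 :: complex" 0 1] by simp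
next
  case False
  define F where "F u = ee (of_int p * Complex u 1) / (2 * of_real pi * \<i> * of_int p)" for u
  have lin: "of_int p * Complex u 1 = of_int p * \<i> + of_real u * of_int p" for u
    by (simp add: complex_eq_iff)
  have "(F has_vector_derivative ee (of_int p * Complex u 1)) (at u within {0..1})" for u
  proof -
    have "((\<lambda>w. ee (of_int p * \<i> + w * of_int p) / (2 * of_real pi * \<i> * of_int p)) has_field_derivative
        ee (of_int p * \<i> + of_real u * of_int p)) (at (of_real u))"
      using False by (auto intro!: derivative_eq_intros DERIV_chain2 [OF ee_has_deriv])
    then have "((\<lambda>w. ee (of_int p * \<i> + of_real w * of_int p) / (2 * of_real pi * \<i> * of_int p)) has_vector_derivative
        ee (of_int p * \<i> + of_real u * of_int p)) (at u)"
      by (rule has_vector_derivative_real_field)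
    then show ?thesis
      unfolding F_def lin by (rule has_vector_derivative_at_within)
  qed
  then have "((\<lambda>u. ee (of_int p * Complex u 1)) has_integral (F 1 - F 0)) {0..1}"
    by (intro fundamental_theorem_of_calculus) auto
  moreover have "F 1 = F 0"
  proof -
    have "of_int p * Complex 1 1 = of_int p * Complex 0 1 + of_int p"
      by (simp add: complex_eq_iff)
    then show ?thesis unfolding F_def by (simp only: ee_add_of_int)
  qed
  ultimately show ?thesis using False by simp
qed

text \<open>On a horizontal line each term has constant modulus, so absolute convergence at one
  point gives uniform convergence and orthogonality applies. As b j belongs to frequency j + 1, the
  coefficient of n is found at \<open>nat n - 1\<close>.\<close>

lemma fourier_coeff_expansion:
  fixes f :: "complex \<Rightarrow> complex"
  assumes f: "\<And>u. ((\<lambda>j. b j * ee (Complex u 1) ^ Suc j) has_sum (f (Complex u 1) - ee (of_int l * Complex u 1))) UNIV"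
  shows "fourier_coeff f n = (if n = l then 1 else 0) + (if n > 0 then b (nat n - 1) else 0)"
proof -
  define g where "g j u = b j * ee (of_int (int (Suc j) - n) * Complex u 1)" for j u
  have eq: "ee (Complex u 1) ^ Suc j * ee (- of_int n * Complex u 1) = ee (of_int (int (Suc j) - n) * Complex u 1)" for j u
    unfolding ee_of_nat_mult [symmetric] ee_add [symmetric] by (simp add: algebra_simps)
  define M where "M j = norm (g j 0)" for j
  have M: "norm (g j u) = M j" for j u
    by (simp add: M_def g_def norm_mult norm_ee)
  have gs: "((\<lambda>j. g j u) has_sum ((f (Complex u 1) - ee (of_int l * Complex u 1)) * ee (- of_int n * Complex u 1))) UNIV" for u
    using has_sum_cmult_left [OF f [of u], where c = "ee (- of_int n * Complex u 1)"] by (simp only: g_def mult.assoc eq)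
  then have "(\<lambda>j. g j 0) summable_on UNIV"
    by (rule has_sum_imp_summable)
  then have "summable M"
    unfolding M_def summable_on_iff_abs_summable_on_complex by (rule summable_on_imp_summable)
  then have ul: "uniform_limit {0..1} (\<lambda>N u. \<Sum>j<N. g j u) (\<lambda>u. \<Sum>j. g j u) sequentially"
    using M by (intro Weierstrass_m_test) auto
  have cont: "continuous_on {0..1} (g j)" for j
  proof -
    have "continuous_on {0..1} (\<lambda>u. Complex u 1)"
      unfolding Complex_eq by (intro continuous_intros)
    then show ?thesis
      unfolding g_def ee_def by (intro continuous_intros)
  qed
  have gi: "(g j has_integral (b j * (if int (Suc j) - n = 0 then 1 else 0))) {0..1}" for j
    unfolding g_def by (intro has_integral_mult_right integral_ee)
  obtain I J where I: "\<And>N. ((\<lambda>u. \<Sum>j<N. g j u) has_integral I N) {0..1}"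
    and J: "((\<lambda>u. \<Sum>j. g j u) has_integral J) {0..1}" and IJ: "I \<longlonglongrightarrow> J"
  proof (rule uniform_limit_integral [OF ul])
    show "\<And>N. continuous_on {0..1} (\<lambda>u. \<Sum>j<N. g j u)"
      by (intro continuous_on_sum cont)
  qed auto
  have "((\<lambda>u. \<Sum>j<N. g j u) has_integral (\<Sum>j<N. b j * (if int (Suc j) - n = 0 then 1 else 0))) {0..1}" for N
    by (intro has_integral_sum gi) auto
  then have "I = (\<lambda>N. \<Sum>j<N. b j * (if int (Suc j) - n = 0 then 1 else 0))"
    using I has_integral_unique by blast
  then have "(\<lambda>j. b j * (if int (Suc j) - n = 0 then 1 else 0)) sums J"
    using IJ by (simp add: sums_def)
  moreover have "(\<lambda>j. b j * (if int (Suc j) - n = 0 then 1 else 0)) sums (if n > 0 then b (nat n - 1) else 0)"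
  proof (cases "n > 0")
    case True
    have "(\<lambda>j. if j = nat n - 1 then b j else 0) sums b (nat n - 1)"
      by (rule sums_single)
    moreover have "(\<lambda>j. if j = nat n - 1 then b j else 0) = (\<lambda>j. b j * (if int (Suc j) - n = 0 then 1 else 0))"
      using True by (auto simp: fun_eq_iff)
    ultimately show ?thesis using True by simp
  next
    case False
    then have "(\<lambda>j. b j * (if int (Suc j) - n = 0 then 1 else 0)) = (\<lambda>_. 0)"
      by (auto simp: fun_eq_iff)
    then show ?thesis using False by simp
  qed
  ultimately have J_eq: "J = (if n > 0 then b (nat n - 1) else 0)"
    by (rule sums_unique2)
  have l: "((\<lambda>u. ee (of_int (l - n) * Complex u 1)) has_integral (if l - n = 0 then 1 else 0)) {0..1}"
    by (rule integral_ee)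
  have "f (Complex u 1) * ee (- of_int n * Complex u 1) = ee (of_int (l - n) * Complex u 1) + (\<Sum>j. g j u)" for u
  proof -
    have "(\<Sum>j. g j u) = (f (Complex u 1) - ee (of_int l * Complex u 1)) * ee (- of_int n * Complex u 1)"
      using has_sum_imp_sums [OF gs] by (rule sums_unique [symmetric])
    moreover have "ee (of_int l * Complex u 1) * ee (- of_int n * Complex u 1) = ee (of_int (l - n) * Complex u 1)"
      unfolding ee_add [symmetric] by (simp add: algebra_simps)
    ultimately show ?thesis by (simp only: left_diff_distrib) simp
  qed
  then have "((\<lambda>u. f (Complex u 1) * ee (- of_int n * Complex u 1)) has_integral ((if l - n = 0 then 1 else 0) + J)) {0..1}"
    using has_integral_add [OF l J] by simp
  then show ?thesis
    unfolding fourier_coeff_def J_eq by (auto dest: integral_unique)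
qed

lemma fourier_coeff_Poinc:
  assumes "N > 0" "K \<ge> 2" "even K"
  shows "fourier_coeff (Poinc N (int K + 2) l) n = (if n = l then 1 else 0) + (if n > 0 then
     (- 2 * of_real pi * \<i>) ^ (K + 2) * (of_int n ^ Suc K * kloosterman_bessel N (Suc K) l 1 (- 4 * of_real pi ^ 2 * of_int l) (nat n)) else 0)"
  by (subst fourier_coeff_expansion [OF Poinc_expansion [OF assms]]) (auto simp: of_nat_diff)

section \<open>The expansions in both half-planes\<close>

text \<open>By the mean value theorem, the vanishing to order K + 1 at y = 0 follows from the
  derivative of the truncated exponential. This is what makes the Poincare series of negative weight
  converge.\<close>

lemma ninc_gamma_complement_bounds:
  assumes "y \<ge> 0"
  shows "\<bar>1 - ninc_gamma (Suc K) y\<bar> \<le> y ^ Suc K"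
proof (cases "y = 0")
  case True
  have "{..K} = insert 0 {1..K}" by auto
  with True show ?thesis by (simp add: ninc_gamma_eq power_0_left)
next
  case False
  then have y: "y > 0" using assms by simp
  have "\<exists>x. 0 < x \<and> x < y \<and> ninc_gamma (Suc K) y - ninc_gamma (Suc K) 0 = (y - 0) * - (exp (- x) * x ^ K / fact K)"
    unfolding ninc_gamma_eq using exp_truncated_deriv by (intro MVT2 y) auto
  then obtain x where x: "0 < x" "x < y" "ninc_gamma (Suc K) y - ninc_gamma (Suc K) 0 = y * - (exp (- x) * x ^ K / fact K)"
    by auto
  have "{..K} = insert 0 {1..K}" by auto
  then have "ninc_gamma (Suc K) 0 = 1" by (simp add: ninc_gamma_eq power_0_left)
  then have eq: "1 - ninc_gamma (Suc K) y = y * (exp (- x) * x ^ K / fact K)"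
    using x(3) by simp
  have "exp (- x) * x ^ K / fact K \<le> 1 * y ^ K / 1"
    using x by (intro frac_le mult_mono power_mono) auto
  then have "y * (exp (- x) * x ^ K / fact K) \<le> y * y ^ K"
    using y by (intro mult_left_mono) auto
  moreover have "0 \<le> y * (exp (- x) * x ^ K / fact K)"
    using x y by auto
  ultimately show ?thesis unfolding eq by simp
qed

section \<open>Normalising constants\<close>

text \<open>The prefactors of H, of its constant term, of the Maass-Poincare expansion and of the
  holomorphic coefficients all reduce to this constant once powers of c are separated.\<close>

definition main_const :: "nat \<Rightarrow> nat \<Rightarrow> complex" where
  "main_const K m = (-1) ^ (K div 2) * of_real ((2 * pi) ^ (K + 2) * real m ^ Suc K)"

definition sum_const :: "nat \<Rightarrow> nat \<Rightarrow> complex" where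
  "sum_const K m = 2 * of_real pi * ((-1) powi ((- int K) div 2)) * of_real (real m powr ((1 - real_of_int (- int K)) / 2))"

lemma minus_one_powi_half:
  assumes "even K"
  shows "(-1 :: complex) powi ((- int K) div 2) = (-1) ^ (K div 2)"
    and "(-1 :: complex) powi ((- int K) div 2 + 1) = - ((-1) ^ (K div 2))"
proof -
  obtain h where K: "K = 2 * h" using assms by blast
  then have d: "(- int K) div 2 = - int h" by simp
  show 1: "(-1 :: complex) powi ((- int K) div 2) = (-1) ^ (K div 2)"
    unfolding d using K by (cases "even h") (simp_all add: power_int_minus)
  have "(-1 :: complex) powi ((- int K) div 2 + 1) = (-1) powi ((- int K) div 2) * (-1)"
    by (subst power_int_add) auto
  then show "(-1 :: complex) powi ((- int K) div 2 + 1) = - ((-1) ^ (K div 2))"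
    using 1 by simp
qed

lemma sum_const_eq:
  assumes "even K" "m > 0" "c > 0"
  shows "sum_const K m * (1 / of_nat c * of_real (bessel_scale m c ^ Suc K)) = main_const K m / of_nat c ^ (K + 2)"
proof -
  \<comment> \<open>One factor sqrt(m)^(K + 1) is the explicit power of m in H; the other comes from
    the Bessel scale.\<close>
  have "real m powr ((1 - real_of_int (- int K)) / 2) = sqrt (real m) ^ Suc K"
  proof -
    have "sqrt (real m) ^ Suc K = sqrt (real m) powr real (Suc K)"
      using assms by (subst powr_realpow) auto
    also have "\<dots> = real m powr (1 / 2 * real (Suc K))"
      using assms by (simp add: powr_half_sqrt [symmetric] powr_powr)
    finally show ?thesis by (simp add: field_simps)
  qed
  moreover have "sqrt (real m) ^ Suc K * sqrt (real m) ^ Suc K = real m ^ Suc K"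
    by (simp only: power_mult_distrib [symmetric]) simp
  ultimately have "2 * pi * real m powr ((1 - real_of_int (- int K)) / 2) * (1 / real c * bessel_scale m c ^ Suc K) =
      (2 * pi) ^ (K + 2) * real m ^ Suc K / real c ^ (K + 2)"
    unfolding bessel_scale_def by (simp add: power_divide power_mult_distrib)
  then have R: "complex_of_real (2 * pi * real m powr ((1 - real_of_int (- int K)) / 2) * (1 / real c * bessel_scale m c ^ Suc K)) =
      of_real ((2 * pi) ^ (K + 2) * real m ^ Suc K / real c ^ (K + 2))"
    by (rule arg_cong)
  have "sum_const K m * (1 / of_nat c * of_real (bessel_scale m c ^ Suc K)) = (-1) ^ (K div 2) *
      of_real (2 * pi * real m powr ((1 - real_of_int (- int K)) / 2) * (1 / real c * bessel_scale m c ^ Suc K))"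
    unfolding sum_const_def minus_one_powi_half [OF assms(1)] by (simp add: mult_ac del: power_Suc)
  also have "\<dots> = main_const K m / of_nat c ^ (K + 2)"
    unfolding R main_const_def by simp
  finally show ?thesis .
qed

lemma sum_const_nonzero: "m > 0 \<Longrightarrow> sum_const K m \<noteq> 0"
  by (simp add: sum_const_def)

text \<open>As K + 2 is even, both signs of 2 \<pi> i give the same power, and i^(K + 2) =
  -(-1)^(K/2).\<close>

lemma main_const_poincare:
  assumes "even K"
  shows "of_nat m ^ Suc K * (- 2 * of_real pi * \<i>) ^ (K + 2) = - main_const K m"
    and "of_nat m ^ Suc K * (2 * of_real pi * \<i>) ^ (K + 2) = - main_const K m"
proof -
  obtain h where K: "K = 2 * h" using assms by blast
  have p: "K + 2 = 2 * Suc h" using K by simp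
  have sq: "(2 * of_real pi * \<i>)\<^sup>2 = - (of_real ((2 * pi)\<^sup>2))" "(- 2 * of_real pi * \<i>)\<^sup>2 = - (of_real ((2 * pi)\<^sup>2))"
    by (simp_all add: power_mult_distrib)
  have "(- (of_real ((2 * pi)\<^sup>2)) :: complex) ^ Suc h = - ((-1) ^ (K div 2) * of_real ((2 * pi) ^ (K + 2)))"
    unfolding p power_mult [of "2 * pi"] power_minus [of "of_real ((2 * pi)\<^sup>2)"] using K by simp
  then show "of_nat m ^ Suc K * (- 2 * of_real pi * \<i>) ^ (K + 2) = - main_const K m"
    "of_nat m ^ Suc K * (2 * of_real pi * \<i>) ^ (K + 2) = - main_const K m"
    unfolding main_const_def p power_mult sq by (simp_all add: mult_ac)
qed

lemma main_const_maass:
  assumes "even K" "c > 0"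
  shows "of_nat c ^ K * (- 2 * of_real pi * \<i> * (2 * of_real pi * \<i> * of_nat m / (of_nat c)\<^sup>2) ^ Suc K) = main_const K m / of_nat c ^ (K + 2)"
proof -
  have "of_nat c ^ K * (- 2 * of_real pi * \<i> * (2 * of_real pi * \<i> * of_nat m / (of_nat c)\<^sup>2) ^ Suc K) =
      - (of_nat m ^ Suc K * (2 * of_real pi * \<i>) ^ (K + 2)) * (of_nat c ^ K / ((of_nat c)\<^sup>2) ^ Suc K)"
    by (simp add: power_mult_distrib power_divide mult_ac)
  also have "of_nat c ^ K / ((of_nat c)\<^sup>2) ^ Suc K = (1 / of_nat c ^ (K + 2) :: complex)"
    using assms(2) by (simp add: divide_simps power_add power_mult_distrib power2_eq_square)
  finally show ?thesis
    unfolding main_const_poincare(2) [OF assms(1)] by simp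
qed

lemma main_const_aplus:
  assumes "even K"
  shows "of_real ((2 * pi) ^ (K + 2)) * (-1) powi ((- int K) div 2 + 1) * of_int ((- int m) ^ Suc K) = main_const K m"
  unfolding minus_one_powi_half [OF assms] main_const_def using assms by (simp add: power_minus_odd mult_ac)

section \<open>The terms of H as weighted Bessel sums\<close>

definition exp_weight :: "complex \<Rightarrow> nat \<Rightarrow> complex" where
  "exp_weight \<tau> n = ee \<tau> ^ Suc n"

definition gamma_weight :: "nat \<Rightarrow> complex \<Rightarrow> nat \<Rightarrow> complex" where
  "gamma_weight K \<tau> n = inverse (ee \<tau>) ^ Suc n * of_real (inc_gamma (Suc K) (4 * pi * Im \<tau> * real (Suc n)))"

lemma inc_gamma_ninc: "inc_gamma (Suc K) y = fact K * ninc_gamma (Suc K) y"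
  by (simp add: ninc_gamma_def)

lemma exp_weight_summable:
  assumes "Im \<tau> > 0"
  shows "(\<lambda>n. norm (exp_weight \<tau> n) * exp (pi * Im \<tau> * real (Suc n))) summable_on UNIV"
  using summable_on_ee_power [OF assms, of 0] by (simp add: exp_weight_def)

lemma gamma_weight_summable:
  assumes "Im \<tau> > 0"
  shows "(\<lambda>n. norm (gamma_weight K \<tau> n) * exp (pi * Im \<tau> * real (Suc n))) summable_on UNIV"
  using summable_on_cmult_right [OF summable_on_ninc_gamma_exp [OF assms, of K], of "fact K"]
  by (simp add: gamma_weight_def inc_gamma_ninc norm_mult mult_ac del: of_nat_Suc power_Suc)

lemma bessel_scale_complex:
  "of_real ((bessel_scale m c)\<^sup>2) = (4 * of_real pi ^ 2 * of_nat m / (of_nat c)\<^sup>2 :: complex)"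
  by (simp add: bessel_scale_squared)

lemma bessel_sums_factor:
  assumes "((\<lambda>n. e n * ee (of_int (s * int (Suc n) * d) / of_nat c) * bessel_series w (Y / (of_nat c)\<^sup>2 * of_nat (Suc n)))
      has_sum bessel_sum w e s Y c d) UNIV"
    and "(\<lambda>n. e n * ee (of_int (s * int (Suc n) * d) / of_nat c) * (X * bessel_series w (Y / (of_nat c)\<^sup>2 * of_nat (Suc n)))) sums S"
  shows "S = X * bessel_sum w e s Y c d"
  using sums_mult [OF has_sum_imp_sums [OF assms(1)], of X] assms(2) by (simp add: mult_ac sums_unique2)

lemma Im_pos_of_radius:
  assumes "0 < r" "r < 2 * pi * Im \<tau>"
  shows "Im \<tau> > 0"
proof -
  have "0 < 2 * pi * Im \<tau>" using assms by linarith
  then show ?thesis by (simp add: zero_less_mult_iff)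
qed

lemma phi_plus_upper_eq:
  assumes c: "c > 0" and r: "0 < r" "r < 2 * pi * Im \<tau>"
  shows "ee (of_int d / of_nat c + \<tau>) * phi_plus (- int K) m r c d \<tau> =
    of_real (bessel_scale m c ^ Suc K) * bessel_sum (Suc K) (exp_weight \<tau>) 1 (4 * of_real pi ^ 2 * of_nat m) c d"
proof (rule bessel_sums_factor)
  have \<tau>: "Im \<tau> > 0" using r by (rule Im_pos_of_radius)
  show "((\<lambda>n. exp_weight \<tau> n * ee (of_int (1 * int (Suc n) * d) / of_nat c) * bessel_series (Suc K) ((4 * of_real pi ^ 2 * of_nat m) / (of_nat c)\<^sup>2 * of_nat (Suc n)))
      has_sum bessel_sum (Suc K) (exp_weight \<tau>) 1 (4 * of_real pi ^ 2 * of_nat m) c d) UNIV"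
    using \<tau> by (intro bessel_sum_has_sum [OF _ c exp_weight_summable]) auto
  show "(\<lambda>n. exp_weight \<tau> n * ee (of_int (1 * int (Suc n) * d) / of_nat c) * (of_real (bessel_scale m c ^ Suc K) * bessel_series (Suc K) ((4 * of_real pi ^ 2 * of_nat m) / (of_nat c)\<^sup>2 * of_nat (Suc n))))
      sums (ee (of_int d / of_nat c + \<tau>) * phi_plus (- int K) m r c d \<tau>)"
    using phi_plus_upper [OF r, where c = c and d = d and m = m and K = K]
    unfolding add.commute [of "of_int d / of_nat c" \<tau>] ee_shift_power bessel_scale_complex exp_weight_def .
qed

lemma phi_plus_lower_eq:
  assumes c: "c > 0" and r: "0 < r" "r < - (2 * pi * Im \<tau>)"
  shows "ee (of_int d / of_nat c + \<tau>) * phi_plus (- int K) m r c d \<tau> =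
    - of_real (bessel_scale m c ^ Suc K) * (1 / fact (Suc K) + bessel_sum (Suc K) (exp_weight (- \<tau>)) (- 1) (- 4 * of_real pi ^ 2 * of_nat m) c d)"
proof -
  let ?X = "of_real (bessel_scale m c ^ Suc K) :: complex"
  let ?S = "ee (of_int d / of_nat c + \<tau>) * phi_plus (- int K) m r c d \<tau>"
  have \<tau>: "Im (- \<tau>) > 0" using r by (intro Im_pos_of_radius [of r]) auto
  have Y: "- of_real ((bessel_scale m c)\<^sup>2) * of_nat n = (- 4 * of_real pi ^ 2 * of_nat m / (of_nat c)\<^sup>2 * of_nat n :: complex)" for n
    unfolding bessel_scale_complex by simp
  let ?b = "\<lambda>n. bessel_series (Suc K) (- 4 * of_real pi ^ 2 * of_nat m / (of_nat c)\<^sup>2 * of_nat n)"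
  have "(\<lambda>n. inverse (ee (of_int d / of_nat c + \<tau>)) ^ n * (?X * ?b n)) sums (- ?S)"
    using sums_minus [OF phi_plus_lower [OF r, where c = c and d = d and m = m and K = K]] unfolding Y by simp
  \<comment> \<open>The term n = 0 is split off: its Bessel series is 1 / (K + 1)!, independent of d
    and \<tau>. The inverse powers of e(\<tau>) that remain are the weights at - \<tau>.\<close>
  then have "(\<lambda>n. inverse (ee (\<tau> + of_int d / of_nat c)) ^ Suc n * (?X * ?b (Suc n))) sums (- ?S - ?X * (1 / fact (Suc K)))"
    unfolding add.commute [of "of_int d / of_nat c" \<tau>] by (subst sums_Suc_iff) (simp add: bessel_series_0 del: power_Suc fact_Suc of_nat_Suc)
  then have "(\<lambda>n. exp_weight (- \<tau>) n * ee (of_int (- 1 * int (Suc n) * d) / of_nat c) * (?X * ?b (Suc n))) sums (- ?S - ?X * (1 / fact (Suc K)))"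
    unfolding ee_shift_power_inverse exp_weight_def ee_minus .
  then have "- ?S - ?X * (1 / fact (Suc K)) = ?X * bessel_sum (Suc K) (exp_weight (- \<tau>)) (- 1) (- 4 * of_real pi ^ 2 * of_nat m) c d"
    by (rule bessel_sums_factor [rotated]) (use \<tau> in \<open>intro bessel_sum_has_sum [OF _ c exp_weight_summable], auto simp: mult_less_0_iff\<close>)
  then have "?S = - (?X * (1 / fact (Suc K)) + ?X * bessel_sum (Suc K) (exp_weight (- \<tau>)) (- 1) (- 4 * of_real pi ^ 2 * of_nat m) c d)"
    by (metis add.commute diff_add_cancel minus_minus)
  then show ?thesis by (simp only: distrib_left [symmetric] mult_minus_left)
qed

lemma phi_minus_upper_eq:
  assumes c: "c > 0" and r: "0 < r" "r < 2 * pi * Im \<tau>"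
  shows "of_real ((4 * pi * Im \<tau>) ^ Suc K) * phi_minus (- int K) m r c d \<tau> =
    of_real (bessel_scale m c ^ Suc K) * bessel_sum (Suc K) (gamma_weight K \<tau>) (- 1) (- 4 * of_real pi ^ 2 * of_nat m) c d"
proof (rule bessel_sums_factor)
  have \<tau>: "Im \<tau> > 0" using r by (rule Im_pos_of_radius)
  show "((\<lambda>n. gamma_weight K \<tau> n * ee (of_int (- 1 * int (Suc n) * d) / of_nat c) * bessel_series (Suc K) ((- 4 * of_real pi ^ 2 * of_nat m) / (of_nat c)\<^sup>2 * of_nat (Suc n)))
      has_sum bessel_sum (Suc K) (gamma_weight K \<tau>) (- 1) (- 4 * of_real pi ^ 2 * of_nat m) c d) UNIV"
    using \<tau> by (intro bessel_sum_has_sum [OF _ c gamma_weight_summable]) (auto simp: mult_less_0_iff)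
  have Y: "- of_real ((bessel_scale m c)\<^sup>2) * of_nat n = (- 4 * of_real pi ^ 2 * of_nat m / (of_nat c)\<^sup>2 * of_nat n :: complex)" for n
    unfolding bessel_scale_complex by simp
  show "(\<lambda>n. gamma_weight K \<tau> n * ee (of_int (- 1 * int (Suc n) * d) / of_nat c) * (of_real (bessel_scale m c ^ Suc K) * bessel_series (Suc K) ((- 4 * of_real pi ^ 2 * of_nat m) / (of_nat c)\<^sup>2 * of_nat (Suc n))))
      sums (of_real ((4 * pi * Im \<tau>) ^ Suc K) * phi_minus (- int K) m r c d \<tau>)"
    using phi_minus_upper(2) [OF r, where c = c and d = d and m = m and K = K]
    unfolding add.commute [of "of_int d / of_nat c" \<tau>] ee_shift_power_inverse Y gamma_weight_def by (simp only: mult_ac)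
qed

lemma phi_minus_lower_eq:
  assumes K: "even K" and c: "c > 0" and r: "0 < r" "r < - (2 * pi * Im \<tau>)"
  shows "of_real ((- (4 * pi * Im \<tau>)) ^ Suc K) * phi_minus (- int K) m r c d \<tau> =
    of_real (bessel_scale m c ^ Suc K) * bessel_sum (Suc K) (gamma_weight K (- \<tau>)) 1 (4 * of_real pi ^ 2 * of_nat m) c d"
proof (rule bessel_sums_factor)
  have \<tau>: "Im (- \<tau>) > 0" using r by (intro Im_pos_of_radius [of r]) auto
  show "((\<lambda>n. gamma_weight K (- \<tau>) n * ee (of_int (1 * int (Suc n) * d) / of_nat c) * bessel_series (Suc K) ((4 * of_real pi ^ 2 * of_nat m) / (of_nat c)\<^sup>2 * of_nat (Suc n)))
      has_sum bessel_sum (Suc K) (gamma_weight K (- \<tau>)) 1 (4 * of_real pi ^ 2 * of_nat m) c d) UNIV"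
    using \<tau> by (intro bessel_sum_has_sum [OF _ c gamma_weight_summable]) (auto simp: mult_less_0_iff)
  have "gamma_weight K (- \<tau>) n = ee \<tau> ^ Suc n * of_real (inc_gamma (Suc K) (- (4 * pi * Im \<tau>) * real (Suc n)))" for n
    by (simp add: gamma_weight_def ee_minus del: of_nat_Suc power_Suc)
  then show "(\<lambda>n. gamma_weight K (- \<tau>) n * ee (of_int (1 * int (Suc n) * d) / of_nat c) * (of_real (bessel_scale m c ^ Suc K) * bessel_series (Suc K) ((4 * of_real pi ^ 2 * of_nat m) / (of_nat c)\<^sup>2 * of_nat (Suc n))))
      sums (of_real ((- (4 * pi * Im \<tau>)) ^ Suc K) * phi_minus (- int K) m r c d \<tau>)"
    using phi_minus_lower(2) [OF K r, where c = c and d = d and m = m]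
    unfolding add.commute [of "of_int d / of_nat c" \<tau>] ee_shift_power bessel_scale_complex by (simp only: mult_ac)
qed

text \<open>The contribution of a single modulus, in the form in which H and the Maass-Poincare
  series are compared.\<close>

definition bessel_kloosterman_term :: "nat \<Rightarrow> nat \<Rightarrow> (nat \<Rightarrow> complex) \<Rightarrow> int \<Rightarrow> complex \<Rightarrow> nat \<Rightarrow> complex" where
  "bessel_kloosterman_term K m e s Y c = (\<Sum>d\<in>units_mod c. ee (of_int (- int m * minv (int c) d) / of_nat c)
     * bessel_sum (Suc K) e s Y c d) / of_nat c ^ Suc (Suc K)"

lemma Hplus_term_eq:
  "Hplus_term k m r \<tau> c = 1 / of_nat c * (\<Sum>d\<in>units_mod c. ee (of_int (- int m * minv (int c) d) / of_nat c)
     * (ee (of_int d / of_nat c + \<tau>) * phi_plus k m r c d \<tau>))"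
proof -
  have "ee (of_int (- int m * p + d) / of_nat c + \<tau>) = ee (of_int (- int m * p) / of_nat c) * ee (of_int d / of_nat c + \<tau>)" for p d
  proof -
    have "of_int (- int m * p + d) / of_nat c + \<tau> = of_int (- int m * p) / of_nat c + (of_int d / of_nat c + \<tau>)"
      by (simp add: diff_divide_distrib)
    then show ?thesis by (simp only: ee_add)
  qed
  then show ?thesis
    unfolding Hplus_term_def by (simp only: mult.assoc)
qed

lemma Hplus_term_upper:
  assumes "even K" "m > 0" "c > 0" "0 < r" "r < 2 * pi * Im \<tau>"
  shows "sum_const K m * Hplus_term (- int K) m r \<tau> c =
    main_const K m * bessel_kloosterman_term K m (exp_weight \<tau>) 1 (4 * of_real pi ^ 2 * of_nat m) c"
proof -
  have "Hplus_term (- int K) m r \<tau> c = (1 / of_nat c * of_real (bessel_scale m c ^ Suc K)) *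
     (\<Sum>d\<in>units_mod c. ee (of_int (- int m * minv (int c) d) / of_nat c) * bessel_sum (Suc K) (exp_weight \<tau>) 1 (4 * of_real pi ^ 2 * of_nat m) c d)"
    unfolding Hplus_term_eq phi_plus_upper_eq [OF assms(3-5)] by (simp only: sum_distrib_left mult_ac)
  then have "sum_const K m * Hplus_term (- int K) m r \<tau> c = sum_const K m * (1 / of_nat c * of_real (bessel_scale m c ^ Suc K)) *
     (\<Sum>d\<in>units_mod c. ee (of_int (- int m * minv (int c) d) / of_nat c) * bessel_sum (Suc K) (exp_weight \<tau>) 1 (4 * of_real pi ^ 2 * of_nat m) c d)"
    by (simp only: mult.assoc)
  then show ?thesis
    unfolding sum_const_eq [OF assms(1-3)] bessel_kloosterman_term_def by simp
qed

text \<open>The frequency 0 contributes the sum K(-m, 0; c) with the sign opposite to that in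
  \<open>aplus0\<close>, so the two cancel after summation over c.\<close>

lemma Hplus_term_lower:
  assumes "even K" "m > 0" "c > 0" "0 < r" "r < - (2 * pi * Im \<tau>)"
  shows "sum_const K m * Hplus_term (- int K) m r \<tau> c =
    - main_const K m * (aplus_term (- int K) m c / fact (Suc K)
      + bessel_kloosterman_term K m (exp_weight (- \<tau>)) (- 1) (- 4 * of_real pi ^ 2 * of_nat m) c)"
proof -
  let ?b = "bessel_sum (Suc K) (exp_weight (- \<tau>)) (- 1) (- 4 * of_real pi ^ 2 * of_nat m) c"
  have "Hplus_term (- int K) m r \<tau> c = - (1 / of_nat c * of_real (bessel_scale m c ^ Suc K)) *
     (\<Sum>d\<in>units_mod c. ee (of_int (- int m * minv (int c) d) / of_nat c) * (1 / fact (Suc K) + ?b d))"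
    unfolding Hplus_term_eq phi_plus_lower_eq [OF assms(3-5)] by (simp only: sum_distrib_left mult_ac mult_minus_left mult_minus_right)
  then have "sum_const K m * Hplus_term (- int K) m r \<tau> c = - (sum_const K m * (1 / of_nat c * of_real (bessel_scale m c ^ Suc K))) *
     (\<Sum>d\<in>units_mod c. ee (of_int (- int m * minv (int c) d) / of_nat c) * (1 / fact (Suc K) + ?b d))"
    by (simp only: mult.assoc mult_minus_left mult_minus_right)
  also have "(\<Sum>d\<in>units_mod c. ee (of_int (- int m * minv (int c) d) / of_nat c) * (1 / fact (Suc K) + ?b d)) =
     kloosterman (- int m) 0 c / fact (Suc K) + (\<Sum>d\<in>units_mod c. ee (of_int (- int m * minv (int c) d) / of_nat c) * ?b d)"
    unfolding kloosterman_def by (simp add: distrib_left sum.distrib sum_divide_distrib del: fact_Suc)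
  finally have *: "sum_const K m * Hplus_term (- int K) m r \<tau> c = - (sum_const K m * (1 / of_nat c * of_real (bessel_scale m c ^ Suc K))) *
     (kloosterman (- int m) 0 c / fact (Suc K) + (\<Sum>d\<in>units_mod c. ee (of_int (- int m * minv (int c) d) / of_nat c) * ?b d))" .
  show ?thesis
    unfolding bessel_kloosterman_term_def aplus_term_def
  proof -
    have "- (M / p) * (k / f + S) = - M * (k / p / f + S / p)" for M p k f S :: complex
      by (simp add: distrib_left add_divide_distrib mult.commute)
    moreover have "nat (2 - - int K) = K + 2" "Suc (Suc K) = K + 2" by auto
    ultimately show "sum_const K m * Hplus_term (- int K) m r \<tau> c = - main_const K m * (kloosterman (- int m) 0 c / of_nat c ^ nat (2 - - int K) / fact (Suc K) +
        (\<Sum>d\<in>units_mod c. ee (of_int (- int m * minv (int c) d) / of_nat c) * ?b d) / of_nat c ^ Suc (Suc K))"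
      using * unfolding sum_const_eq [OF assms(1-3)] by (simp only:)
  qed
qed

lemma Hminus_term_upper:
  assumes "even K" "m > 0" "c > 0" "0 < r" "r < 2 * pi * Im \<tau>"
  shows "sum_const K m * of_real ((4 * pi * Im \<tau>) ^ Suc K) * Hminus_term (- int K) m r \<tau> c =
    main_const K m * bessel_kloosterman_term K m (gamma_weight K \<tau>) (- 1) (- 4 * of_real pi ^ 2 * of_nat m) c"
proof -
  have "of_real ((4 * pi * Im \<tau>) ^ Suc K) * Hminus_term (- int K) m r \<tau> c = 1 / of_nat c * (\<Sum>d\<in>units_mod c.
      ee (of_int (- int m * minv (int c) d) / of_nat c) * (of_real ((4 * pi * Im \<tau>) ^ Suc K) * phi_minus (- int K) m r c d \<tau>))"
    unfolding Hminus_term_def by (simp only: sum_distrib_left mult_ac)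
  also have "\<dots> = (1 / of_nat c * of_real (bessel_scale m c ^ Suc K)) *
     (\<Sum>d\<in>units_mod c. ee (of_int (- int m * minv (int c) d) / of_nat c) * bessel_sum (Suc K) (gamma_weight K \<tau>) (- 1) (- 4 * of_real pi ^ 2 * of_nat m) c d)"
    unfolding phi_minus_upper_eq [OF assms(3-5)] by (simp only: sum_distrib_left mult_ac)
  finally have "sum_const K m * of_real ((4 * pi * Im \<tau>) ^ Suc K) * Hminus_term (- int K) m r \<tau> c = sum_const K m * (1 / of_nat c * of_real (bessel_scale m c ^ Suc K)) *
     (\<Sum>d\<in>units_mod c. ee (of_int (- int m * minv (int c) d) / of_nat c) * bessel_sum (Suc K) (gamma_weight K \<tau>) (- 1) (- 4 * of_real pi ^ 2 * of_nat m) c d)"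
    by (simp only: mult.assoc)
  then show ?thesis
    unfolding sum_const_eq [OF assms(1-3)] bessel_kloosterman_term_def by simp
qed

lemma Hminus_term_lower:
  assumes "even K" "m > 0" "c > 0" "0 < r" "r < - (2 * pi * Im \<tau>)"
  shows "sum_const K m * of_real ((4 * pi * Im \<tau>) ^ Suc K) * Hminus_term (- int K) m r \<tau> c =
    - (main_const K m * bessel_kloosterman_term K m (gamma_weight K (- \<tau>)) 1 (4 * of_real pi ^ 2 * of_nat m) c)"
proof -
  \<comment> \<open>Im \<tau> is negative and the exponent odd; this is the source of the minus sign
    in the conclusion.\<close>
  have odd: "(4 * pi * Im \<tau>) ^ Suc K = - ((- (4 * pi * Im \<tau>)) ^ Suc K)"
    using assms(1) by (subst power_minus_odd) auto
  have "of_real ((- (4 * pi * Im \<tau>)) ^ Suc K) * Hminus_term (- int K) m r \<tau> c = 1 / of_nat c * (\<Sum>d\<in>units_mod c.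
      ee (of_int (- int m * minv (int c) d) / of_nat c) * (of_real ((- (4 * pi * Im \<tau>)) ^ Suc K) * phi_minus (- int K) m r c d \<tau>))"
    unfolding Hminus_term_def by (simp only: sum_distrib_left mult_ac)
  also have "\<dots> = (1 / of_nat c * of_real (bessel_scale m c ^ Suc K)) *
     (\<Sum>d\<in>units_mod c. ee (of_int (- int m * minv (int c) d) / of_nat c) * bessel_sum (Suc K) (gamma_weight K (- \<tau>)) 1 (4 * of_real pi ^ 2 * of_nat m) c d)"
    unfolding phi_minus_lower_eq [OF assms(1,3-5)] by (simp only: sum_distrib_left mult_ac)
  finally have "sum_const K m * of_real ((- (4 * pi * Im \<tau>)) ^ Suc K) * Hminus_term (- int K) m r \<tau> c = sum_const K m * (1 / of_nat c * of_real (bessel_scale m c ^ Suc K)) *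
     (\<Sum>d\<in>units_mod c. ee (of_int (- int m * minv (int c) d) / of_nat c) * bessel_sum (Suc K) (gamma_weight K (- \<tau>)) 1 (4 * of_real pi ^ 2 * of_nat m) c d)"
    by (simp only: mult.assoc)
  then show ?thesis
    unfolding sum_const_eq [OF assms(1-3)] bessel_kloosterman_term_def odd by (simp del: power_Suc)
qed

lemma aplus_summable:
  assumes "N > 0" "K \<ge> 2"
  shows "(\<lambda>i. aplus_term (- int K) m (N * Suc i)) summable_on UNIV"
proof (rule summable_on_norm_bound)
  show "(\<lambda>i. 1 / real (N * Suc i) ^ Suc K) summable_on UNIV"
    using assms by (intro summable_nonneg_imp_summable_on summable_inverse_multiples) auto
  have bound: "norm (aplus_term (- int K) m c) \<le> 1 / real c ^ Suc K" if "c > 0" for c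
  proof -
    have "norm (aplus_term (- int K) m c) = norm (kloosterman (- int m) 0 c) / real c ^ (K + 2)"
      unfolding aplus_term_def norm_divide norm_power norm_of_nat by (simp add: nat_add_distrib)
    also have "\<dots> \<le> real c / real c ^ (K + 2)"
      by (intro divide_right_mono norm_kloosterman_le) simp
    also have "\<dots> = 1 / real c ^ Suc K" using that by simp
    finally show ?thesis .
  qed
  show "norm (aplus_term (- int K) m (N * Suc i)) \<le> 1 / real (N * Suc i) ^ Suc K" for i
    using assms(1) by (intro bound) simp
qed

lemma aplus0_eq:
  assumes "even K"
  shows "aplus0 N (- int K) m = main_const K m / fact (Suc K) * (\<Sum>n. aplus_term (- int K) m (N * Suc n))"
proof -
  have n: "nat (2 - - int K) = K + 2" "nat (1 - - int K) = Suc K" by auto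
  show ?thesis
    unfolding aplus0_def n main_const_aplus [OF assms] of_real_fact ..
qed

section \<open>Expansion of the Maass-Poincare series\<close>

definition maass_seed :: "nat \<Rightarrow> nat \<Rightarrow> complex \<Rightarrow> complex" where
  "maass_seed K m z = of_real (1 - ninc_gamma (Suc K) (4 * pi * real m * Im z)) * ee (- of_nat m * z)"

text \<open>At w = -1/(c^2 z) the gamma argument 4 \<pi> m Im w equals A/z - A/conj z, so the
  incomplete gamma function becomes a truncated exponential in A (1/z - 1/conj z).\<close>

lemma maass_seed_inversion:
  fixes c m :: nat and z :: complex
  defines "w \<equiv> - 1 / ((of_nat c)\<^sup>2 * z)" and "A \<equiv> 2 * of_real pi * \<i> * of_nat m / (of_nat c)\<^sup>2"
  shows "(of_nat c * z) ^ K * maass_seed K m w = of_nat c ^ K * maass_term K A z"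
proof -
  define Y where "Y = 4 * pi * real m * Im w"
  have 1: "A / z = 2 * of_real pi * \<i> * (- of_nat m * w)"
    by (simp add: A_def w_def)
  have "cnj w = - 1 / ((of_nat c)\<^sup>2 * cnj z)"
    by (simp add: w_def)
  then have 2: "A / cnj z = 2 * of_real pi * \<i> * (- of_nat m * cnj w)"
    by (simp add: A_def)
  have Y: "A / z - A / cnj z = of_real Y"
    unfolding 1 2 Y_def by (simp add: complex_eq_iff algebra_simps)
  then have "A * (1 / z - 1 / cnj z) = of_real Y"
    by (simp add: right_diff_distrib)
  moreover have "exp (A / z) = ee (- of_nat m * w)"
    unfolding 1 ee_def ..
  moreover have "exp (A / cnj z) = ee (- of_nat m * w) * of_real (exp (- Y))"
  proof -
    have "A / cnj z = A / z - of_real Y" using Y by (simp add: algebra_simps)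
    then show ?thesis
      using \<open>exp (A / z) = ee (- of_nat m * w)\<close> by (simp only: exp_diff_of_real)
  qed
  ultimately have "maass_term K A z = z ^ K * (ee (- of_nat m * w) - ee (- of_nat m * w) * of_real (exp (- Y)) * of_real (\<Sum>j\<le>K. Y ^ j / fact j))"
    unfolding maass_term_def by simp
  also have "\<dots> = z ^ K * (of_real (1 - ninc_gamma (Suc K) Y) * ee (- of_nat m * w))"
    unfolding ninc_gamma_eq by (simp add: algebra_simps del: of_real_sum)
  finally show ?thesis
    unfolding maass_seed_def Y_def [symmetric] by (simp add: power_mult_distrib mult.assoc)
qed

text \<open>Since Im w = v / (c |z|)^2, the factor (Im w)^(K + 1) from the gamma function beats the
  growing weight factor (c |z|)^K and leaves the exponent -(K + 2).\<close>

lemma norm_maass_seed_le: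
  assumes K: "K \<ge> 2" and z: "Im z = v" "v > 0" and c: "c > 0"
  shows "norm ((of_nat c * z) ^ K * maass_seed K m (- 1 / ((of_nat c)\<^sup>2 * z))) \<le>
    ((4 * pi * real m * v) ^ Suc K * exp (2 * pi * real m / v) * (1 / v) ^ (K - 2)) / (real c * norm z) ^ 4"
proof -
  define w where "w = - 1 / ((of_nat c)\<^sup>2 * z)"
  have vz: "v \<le> norm z" using abs_Im_le_cmod [of z] z by simp
  have z0: "z \<noteq> 0" using z by auto
  define t where "t = (real c * norm z)\<^sup>2"
  have t0: "t > 0" using c z0 by (simp add: t_def)
  have Imw: "Im w = v / t"
  proof -
    have "w = of_real (- 1 / (real c)\<^sup>2) * inverse z"
      by (simp add: w_def divide_inverse)
    then have "Im w = - 1 / (real c)\<^sup>2 * (- Im z / ((Re z)\<^sup>2 + (Im z)\<^sup>2))"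
      by (simp only: Im_complex_of_real Re_complex_of_real times_complex.sel inverse_complex.sel)
    then show ?thesis
      using z by (simp add: t_def power_mult_distrib cmod_power2)
  qed
  then have w0: "Im w \<ge> 0" using z t0 by simp
  have "norm (ee (- of_nat m * w)) \<le> exp (2 * pi * real m / v)"
  proof -
    have "v\<^sup>2 \<le> t"
    proof -
      have "v \<le> real c * norm z"
        using vz c mult_right_mono [of 1 "real c" "norm z"] by simp
      then show ?thesis unfolding t_def using z by (intro power_mono) auto
    qed
    then have "v / t \<le> v / v\<^sup>2" using z t0 by (intro divide_left_mono) auto
    then have "Im w \<le> 1 / v" using z by (simp add: Imw power2_eq_square)
    then have "2 * pi * real m * Im w \<le> 2 * pi * real m * (1 / v)"
      by (intro mult_left_mono) auto
    then show ?thesis by (simp add: norm_ee)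
  qed
  moreover have "\<bar>1 - ninc_gamma (Suc K) (4 * pi * real m * Im w)\<bar> \<le> (4 * pi * real m * Im w) ^ Suc K"
    using w0 by (intro ninc_gamma_complement_bounds) auto
  ultimately have "norm (maass_seed K m w) \<le> (4 * pi * real m * Im w) ^ Suc K * exp (2 * pi * real m / v)"
    unfolding maass_seed_def norm_mult norm_of_real using w0 by (intro mult_mono) auto
  then have "norm ((of_nat c * z) ^ K * maass_seed K m w) \<le> (real c * norm z) ^ K * ((4 * pi * real m * Im w) ^ Suc K * exp (2 * pi * real m / v))"
    unfolding norm_mult norm_power norm_of_nat by (intro mult_left_mono) auto
  also have "\<dots> = (4 * pi * real m * v) ^ Suc K * exp (2 * pi * real m / v) * ((real c * norm z) ^ K / t ^ Suc K)"
    unfolding Imw by (simp add: power_divide)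
  also have "(real c * norm z) ^ K / t ^ Suc K = 1 / (real c * norm z) ^ (K + 2)"
  proof -
    have "t ^ Suc K = (real c * norm z) ^ K * (real c * norm z) ^ (K + 2)"
      unfolding t_def power_mult [symmetric] power_add [symmetric] by (rule arg_cong [where f = "\<lambda>n. _ ^ n"]) simp
    then show ?thesis using c z0 by simp
  qed
  also have "(4 * pi * real m * v) ^ Suc K * exp (2 * pi * real m / v) * (1 / (real c * norm z) ^ (K + 2)) \<le>
      (4 * pi * real m * v) ^ Suc K * exp (2 * pi * real m / v) * ((1 / v) ^ (K - 2) / (real c * norm z) ^ 4)"
    using z by (intro mult_left_mono weight_bound [OF K z c]) auto
  finally show ?thesis by (simp add: w_def)
qed

lemma bessel_sum_scale: "bessel_sum w (\<lambda>n. a * e n) s Y c d = a * bessel_sum w e s Y c d"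
  unfolding bessel_sum_def infsum_cmult_right' [symmetric] by (simp only: mult.assoc)

text \<open>The division by K! occurs because \<open>gamma_weight\<close> uses the unnormalised
  incomplete gamma function, as the integral over t in \<phi>- does.\<close>

lemma MaassPoinc_expansion:
  assumes N: "N > 0" and K: "K \<ge> 2" "even K" and \<tau>: "Im \<tau> > 0"
  shows "((\<lambda>i. main_const K m * (aplus_term (- int K) m (N * Suc i) / fact (Suc K)
      + bessel_kloosterman_term K m (exp_weight \<tau>) 1 (4 * of_real pi ^ 2 * of_nat m) (N * Suc i)
      + bessel_kloosterman_term K m (gamma_weight K \<tau>) (- 1) (- 4 * of_real pi ^ 2 * of_nat m) (N * Suc i) / fact K))
    has_sum (MaassPoinc N (- int K) m \<tau> - maass_seed K m \<tau>)) UNIV"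
proof -
  let ?b1 = "bessel_sum (Suc K) (exp_weight \<tau>) 1 (4 * of_real pi ^ 2 * of_nat m)"
  let ?b2 = "bessel_sum (Suc K) (gamma_weight K \<tau>) (- 1) (- 4 * of_real pi ^ 2 * of_nat m)"
  let ?G = "\<lambda>c d. main_const K m / of_nat c ^ (K + 2) * (1 / fact (Suc K) + ?b1 c d + ?b2 c d / fact K)"
  have F: "MaassPoinc N (- int K) m \<tau> = poincare_sum N (- int K) (maass_seed K m) \<tau>"
  proof -
    have "nat (1 - - int K) = Suc K" by auto
    then show ?thesis unfolding MaassPoinc_def maass_seed_def by (simp only:)
  qed
  have pw: "x powi (- (- int K)) = x ^ K" for x :: complex by simp
  have "((\<lambda>i. \<Sum>d\<in>units_mod (N * Suc i). ee (of_int ((- int m) * minv (int (N * Suc i)) d) / of_nat (N * Suc i)) * ?G (N * Suc i) d)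
    has_sum (poincare_sum N (- int K) (maass_seed K m) \<tau> - maass_seed K m \<tau>)) UNIV"
  proof (rule poincare_sum_expand [OF N _ \<tau>])
    show "even (- int K)" using K by simp
    show "maass_seed K m (z + of_real x) = ee (of_int (- int m) * of_real x) * maass_seed K m z" for x z
      unfolding maass_seed_def by (simp add: distrib_left mult_ac flip: ee_add)
    show "norm ((of_nat c * z) powi (- (- int K)) * maass_seed K m (- 1 / ((of_nat c)\<^sup>2 * z))) \<le>
        ((4 * pi * real m * Im \<tau>) ^ Suc K * exp (2 * pi * real m / Im \<tau>) * (1 / Im \<tau>) ^ (K - 2)) / (real c * norm z) ^ 4"
      if "c > 0" "Im z = Im \<tau>" for c z
      unfolding pw by (rule norm_maass_seed_le [OF K(1) that(2) \<tau> that(1)])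
  next
    fix c :: nat and d :: int assume c: "c > 0"
    let ?A = "2 * of_real pi * \<i> * of_nat m / (of_nat c)\<^sup>2 :: complex"
    let ?z = "\<tau> + of_int d / of_nat c"
    have z: "Im ?z > 0" and Imz: "Im ?z = Im \<tau>" using \<tau> by simp_all
    have sq: "(2 * of_real pi * \<i>) * (2 * of_real pi * \<i>) = - 4 * of_real pi ^ 2" "(- 2 * of_real pi * \<i>) * (2 * of_real pi * \<i>) = 4 * of_real pi ^ 2"
      by (simp_all add: complex_eq_iff power2_eq_square)
    have YA: "- 2 * of_real pi * \<i> * ?A = 4 * of_real pi ^ 2 * of_nat m / (of_nat c)\<^sup>2" "2 * of_real pi * \<i> * ?A = - 4 * of_real pi ^ 2 * of_nat m / (of_nat c)\<^sup>2"
      using sq by (simp_all only: times_divide_eq_right mult.assoc [symmetric])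
    obtain S1 S2 where S1: "((\<lambda>l. ee ?z ^ Suc l * bessel_series (Suc K) (- 2 * of_real pi * \<i> * ?A * of_nat (Suc l))) has_sum S1) UNIV"
      and S2: "((\<lambda>l. of_real (ninc_gamma (Suc K) (4 * pi * Im ?z * real (Suc l))) * inverse (ee ?z) ^ Suc l
          * bessel_series (Suc K) (2 * of_real pi * \<i> * ?A * of_nat (Suc l))) has_sum S2) UNIV"
      and S: "((\<lambda>n::int. maass_term K ?A (?z + of_int n)) has_sum (- 2 * of_real pi * \<i> * ?A ^ Suc K * (1 / fact (Suc K) + S1 + S2))) UNIV"
      by (rule maass_inner_sum [OF z, where K = K and A = ?A])
    have "S1 = ?b1 c d"
      using S1 [unfolded YA ee_shift_power] unfolding bessel_sum_def exp_weight_def by (rule infsumI [symmetric])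
    moreover have "S2 = ?b2 c d / fact K"
    proof -
      have "gamma_weight K \<tau> n = fact K * (of_real (ninc_gamma (Suc K) (4 * pi * Im \<tau> * real (Suc n))) * inverse (ee \<tau>) ^ Suc n)" for n
        unfolding gamma_weight_def inc_gamma_ninc by simp
      then have "?b2 c d = fact K * bessel_sum (Suc K) (\<lambda>n. of_real (ninc_gamma (Suc K) (4 * pi * Im \<tau> * real (Suc n))) * inverse (ee \<tau>) ^ Suc n) (- 1) (- 4 * of_real pi ^ 2 * of_nat m) c d"
        unfolding bessel_sum_scale [symmetric] by presburger
      moreover have "bessel_sum (Suc K) (\<lambda>n. of_real (ninc_gamma (Suc K) (4 * pi * Im \<tau> * real (Suc n))) * inverse (ee \<tau>) ^ Suc n) (- 1) (- 4 * of_real pi ^ 2 * of_nat m) c d = S2"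
        using S2 [unfolded YA ee_shift_power_inverse Imz] unfolding bessel_sum_def mult.assoc by (rule infsumI)
      ultimately show ?thesis by simp
    qed
    ultimately have "of_nat c ^ K * (- 2 * of_real pi * \<i> * ?A ^ Suc K * (1 / fact (Suc K) + S1 + S2)) = ?G c d"
      unfolding mult.assoc [symmetric] using main_const_maass [OF K(2) c, of m] by (simp only: mult.assoc [symmetric])
    then have "((\<lambda>n::int. of_nat c ^ K * maass_term K ?A (?z + of_int n)) has_sum ?G c d) UNIV"
      using has_sum_cmult_right [OF S, of "of_nat c ^ K"] by simp
    then show "((\<lambda>n::int. (of_nat c * (?z + of_int n)) powi (- (- int K)) * maass_seed K m (- 1 / ((of_nat c)\<^sup>2 * (?z + of_int n)))) has_sum ?G c d) UNIV"
      unfolding pw maass_seed_inversion .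
  qed
  moreover have "(\<Sum>d\<in>units_mod c. ee (of_int ((- int m) * minv (int c) d) / of_nat c) * ?G c d) =
     main_const K m * (aplus_term (- int K) m c / fact (Suc K)
      + bessel_kloosterman_term K m (exp_weight \<tau>) 1 (4 * of_real pi ^ 2 * of_nat m) c
      + bessel_kloosterman_term K m (gamma_weight K \<tau>) (- 1) (- 4 * of_real pi ^ 2 * of_nat m) c / fact K)" for c
  proof -
    let ?e = "\<lambda>d. ee (of_int (- int m * minv (int c) d) / of_nat c)"
    have n: "nat (2 - - int K) = K + 2" "Suc (Suc K) = K + 2" by auto
    have k: "kloosterman (- int m) 0 c = (\<Sum>d\<in>units_mod c. ?e d)" by (simp add: kloosterman_def)
    have "?e d * ?G c d = main_const K m * (?e d / of_nat c ^ (K + 2) / fact (Suc K) + ?e d * ?b1 c d / of_nat c ^ (K + 2) + ?e d * ?b2 c d / of_nat c ^ (K + 2) / fact K)" for d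
    proof -
      have "e * (M / p * (1 / f + x + y / g)) = M * (e / p / f + e * x / p + e * y / p / g)" for e M p f x y g :: complex
        by (simp add: distrib_left mult_ac)
      then show ?thesis .
    qed
    then show ?thesis
      unfolding aplus_term_def bessel_kloosterman_term_def n k
      by (simp only: sum_distrib_left [symmetric] sum.distrib sum_divide_distrib)
  qed
  ultimately show ?thesis
    unfolding F by (simp only:)
qed

section \<open>Comparison in the two half-planes\<close>

lemma weight_series_exchange:
  assumes "N > 0" "K \<ge> 2" "\<rho> > 0" "(\<lambda>n. norm (e n) * exp (\<rho> * real (Suc n))) summable_on UNIV"
  obtains Z where "((\<lambda>i. bessel_kloosterman_term K m e s Y (N * Suc i)) has_sum Z) UNIV"
    "((\<lambda>n. e n * kloosterman_bessel N (Suc K) (- int m) s Y (Suc n)) has_sum Z) UNIV"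
  unfolding bessel_kloosterman_term_def
  by (rule kloosterman_exchange [OF assms(1) _ assms(3,4), where w = "Suc K" and l = "- int m" and s = s and Y = Y])
     (use assms(2) in simp)

lemma Hplus_split:
  assumes "even K"
  shows "Hplus N (- int K) m r \<tau> = ee (- of_nat m * \<tau>) + main_const K m / fact (Suc K) * (\<Sum>n. aplus_term (- int K) m (N * Suc n))
     + sum_const K m * (\<Sum>n. Hplus_term (- int K) m r \<tau> (N * Suc n))"
  unfolding Hplus_def aplus0_eq [OF assms] sum_const_def by simp

lemma Hminus_split:
  "Hminus N (- int K) m r \<tau> = - of_real (ninc_gamma (Suc K) (4 * pi * real m * Im \<tau>)) * ee (- of_nat m * \<tau>)
     + (sum_const K m * of_real ((4 * pi * Im \<tau>) ^ Suc K) * (\<Sum>n. Hminus_term (- int K) m r \<tau> (N * Suc n))) / fact K"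
proof -
  have n: "nat (1 - - int K) = Suc K" "nat (- (- int K)) = K" by auto
  show ?thesis
    unfolding Hminus_def sum_const_def n by (simp add: mult_ac)
qed

lemma summable_suminf_mult_left:
  fixes a :: complex
  assumes "(\<lambda>n. a * f n) sums s" "a \<noteq> 0"
  shows "summable f" "a * suminf f = s"
proof -
  have "summable (\<lambda>n. a * f n)" using assms(1) by (rule sums_summable)
  then show "summable f" using assms(2) by (simp add: summable_cmult_iff)
  then show "a * suminf f = s"
    using assms(1) by (simp add: suminf_mult [symmetric] sums_iff)
qed

text \<open>The two q^(-m) terms of H+ and H- add up to the seed, the contribution of the identity
  coset; all other cosets match for each modulus c.\<close>

lemma H_upper:
  assumes N: "N > 0" and m: "m > 0" and K: "K \<ge> 2" "even K" and r: "0 < r" "r < 2 * pi * Im \<tau>"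
  shows "Hconverges N (- int K) m r \<tau>" "Hfun N (- int K) m r \<tau> = MaassPoinc N (- int K) m \<tau>"
proof -
  have \<tau>: "Im \<tau> > 0" using r by (rule Im_pos_of_radius)
  then have \<rho>: "pi * Im \<tau> > 0" by simp
  have c: "N * Suc i > 0" for i using N by simp
  obtain Z1 where Z1: "((\<lambda>i. bessel_kloosterman_term K m (exp_weight \<tau>) 1 (4 * of_real pi ^ 2 * of_nat m) (N * Suc i)) has_sum Z1) UNIV"
    by (rule weight_series_exchange [OF N K(1) \<rho> exp_weight_summable [OF \<tau>]])
  obtain Z2 where Z2: "((\<lambda>i. bessel_kloosterman_term K m (gamma_weight K \<tau>) (- 1) (- 4 * of_real pi ^ 2 * of_nat m) (N * Suc i)) has_sum Z2) UNIV"
    by (rule weight_series_exchange [OF N K(1) \<rho> gamma_weight_summable [OF \<tau>]])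
  define SA where "SA = (\<Sum>n. aplus_term (- int K) m (N * Suc n))"
  have sa: "(\<lambda>i. aplus_term (- int K) m (N * Suc i)) summable_on UNIV"
    by (rule aplus_summable [OF N K(1)])
  have sa': "summable (\<lambda>i. aplus_term (- int K) m (N * Suc i))"
    using sa by (rule summable_on_imp_summable)
  have SA: "((\<lambda>i. aplus_term (- int K) m (N * Suc i)) has_sum SA) UNIV"
    using has_sum_infsum [OF sa] has_sum_imp_sums [OF has_sum_infsum [OF sa]] by (simp add: SA_def sums_iff)
  have hp: "(\<lambda>n. sum_const K m * Hplus_term (- int K) m r \<tau> (N * Suc n)) sums (main_const K m * Z1)"
    unfolding Hplus_term_upper [OF K(2) m c r] by (intro has_sum_imp_sums has_sum_cmult_right Z1)
  have hm: "(\<lambda>n. sum_const K m * of_real ((4 * pi * Im \<tau>) ^ Suc K) * Hminus_term (- int K) m r \<tau> (N * Suc n)) sums (main_const K m * Z2)"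
    unfolding Hminus_term_upper [OF K(2) m c r] by (intro has_sum_imp_sums has_sum_cmult_right Z2)
  have nz: "sum_const K m \<noteq> 0" "sum_const K m * of_real ((4 * pi * Im \<tau>) ^ Suc K) \<noteq> 0"
    using sum_const_nonzero [OF m] \<tau> by auto
  show "Hconverges N (- int K) m r \<tau>"
    unfolding Hconverges_def
    using sa' summable_suminf_mult_left(1) [OF hp nz(1)] summable_suminf_mult_left(1) [OF hm nz(2)] phi_minus_upper(1) [OF r]
    by blast
  have "((\<lambda>i. main_const K m * (aplus_term (- int K) m (N * Suc i) / fact (Suc K)
      + bessel_kloosterman_term K m (exp_weight \<tau>) 1 (4 * of_real pi ^ 2 * of_nat m) (N * Suc i)
      + bessel_kloosterman_term K m (gamma_weight K \<tau>) (- 1) (- 4 * of_real pi ^ 2 * of_nat m) (N * Suc i) / fact K))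
    has_sum (main_const K m * (SA / fact (Suc K) + Z1 + Z2 / fact K))) UNIV"
    by (intro has_sum_cmult_right has_sum_add has_sum_divide_const SA Z1 Z2)
  then have "MaassPoinc N (- int K) m \<tau> - maass_seed K m \<tau> = main_const K m * (SA / fact (Suc K) + Z1 + Z2 / fact K)"
    using MaassPoinc_expansion [OF N K \<tau>] has_sum_unique by blast
  then show "Hfun N (- int K) m r \<tau> = MaassPoinc N (- int K) m \<tau>"
    unfolding Hfun_def Hplus_split [OF K(2)] Hminus_split summable_suminf_mult_left(2) [OF hp nz(1)] summable_suminf_mult_left(2) [OF hm nz(2)]
      SA_def [symmetric] maass_seed_def diff_eq_eq
    by (simp add: algebra_simps del: fact_Suc)
qed

lemma kloosterman_bessel_minus:
  assumes "N > 0"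
  shows "kloosterman_bessel N w (- l) (- s) Y n = kloosterman_bessel N w l s Y n"
  using assms unfolding kloosterman_bessel_def mult_minus_left by (simp add: kloosterman_minus del: power_Suc mult_Suc_right)

text \<open>Conjugation negates both arguments of each Kloosterman sum, which changes nothing. Thus
  the coefficients are real and the conjugation in the non-holomorphic Eichler integral is
  harmless.\<close>

lemma cnj_kloosterman_bessel:
  assumes "N > 0" "cnj Y = Y"
  shows "cnj (kloosterman_bessel N w l s Y n) = kloosterman_bessel N w l s Y n"
proof -
  have "cnj (kloosterman_bessel N w l s Y n) = kloosterman_bessel N w (- l) (- s) Y n"
    unfolding kloosterman_bessel_def infsum_cnj [symmetric]
    by (simp add: cnj_kloosterman cnj_bessel_series assms(2) del: power_Suc mult_Suc_right)
  then show ?thesis by (simp only: kloosterman_bessel_minus [OF assms(1)])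
qed

text \<open>Fits the Fourier expansion of a Poincare series: one principal exponent l, of either
  sign, plus the positive frequencies.\<close>

lemma has_sum_nonzero_ints:
  fixes h :: "int \<Rightarrow> complex"
  assumes h: "((\<lambda>n. h (int (Suc n))) has_sum S) UNIV" and l: "l \<noteq> 0"
  shows "((\<lambda>n. (if n = l then a else 0) + (if n > 0 then h n else 0)) has_sum (a + S)) {n. n \<noteq> 0}"
proof (rule has_sum_add)
  show "((\<lambda>n. if n = l then a else 0) has_sum a) {n. n \<noteq> 0}"
    using l by (intro has_sum_finite_neutralI [of "{l}"]) auto
  have "bij_betw (\<lambda>n. int (Suc n)) UNIV {0<..}"
    by (rule bij_betwI [where g = "\<lambda>n. nat n - 1"]) auto
  from has_sum_reindex_bij_betw [OF this, of h] h have "(h has_sum S) {0<..}" by simp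
  then show "((\<lambda>n. if n > 0 then h n else 0) has_sum S) {n. n \<noteq> 0}"
    by (rule has_sum_cong_neutral [THEN iffD1, rotated -1]) auto
qed

lemma H_lower:
  assumes N: "N > 0" and m: "m > 0" and K: "K \<ge> 2" "even K" and r: "0 < r" "r < - (2 * pi * Im \<tau>)"
  shows "Hconverges N (- int K) m r \<tau>"
    "Hfun N (- int K) m r \<tau> = of_nat m ^ Suc K * (eichler (Poinc N (int K + 2) (int m)) (int K + 2) (- \<tau>)
       - of_real ((4 * pi) ^ Suc K / fact K) * nh_eichler (Poinc N (int K + 2) (- int m)) (int K + 2) (- \<tau>))"
proof -
  have \<tau>: "Im (- \<tau>) > 0" using r by (intro Im_pos_of_radius [of r]) auto
  then have \<rho>: "pi * Im (- \<tau>) > 0" by (simp add: mult_less_0_iff)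
  have c: "N * Suc i > 0" for i using N by simp
  let ?Y = "4 * of_real pi ^ 2 * of_nat m :: complex"
  let ?I = "(- 2 * of_real pi * \<i>) ^ (K + 2)"
  obtain Z1 where Z1: "((\<lambda>i. bessel_kloosterman_term K m (exp_weight (- \<tau>)) (- 1) (- 4 * of_real pi ^ 2 * of_nat m) (N * Suc i)) has_sum Z1) UNIV"
    and Z1': "((\<lambda>n. exp_weight (- \<tau>) n * kloosterman_bessel N (Suc K) (- int m) (- 1) (- 4 * of_real pi ^ 2 * of_nat m) (Suc n)) has_sum Z1) UNIV"
    by (rule weight_series_exchange [OF N K(1) \<rho> exp_weight_summable [OF \<tau>]])
  obtain Z2 where Z2: "((\<lambda>i. bessel_kloosterman_term K m (gamma_weight K (- \<tau>)) 1 ?Y (N * Suc i)) has_sum Z2) UNIV"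
    and Z2': "((\<lambda>n. gamma_weight K (- \<tau>) n * kloosterman_bessel N (Suc K) (- int m) 1 ?Y (Suc n)) has_sum Z2) UNIV"
    by (rule weight_series_exchange [OF N K(1) \<rho> gamma_weight_summable [OF \<tau>]])
  define SA where "SA = (\<Sum>n. aplus_term (- int K) m (N * Suc n))"
  have sa': "summable (\<lambda>i. aplus_term (- int K) m (N * Suc i))"
    using aplus_summable [OF N K(1)] by (rule summable_on_imp_summable)
  then have SA: "(\<lambda>i. aplus_term (- int K) m (N * Suc i)) sums SA"
    unfolding SA_def by (rule summable_sums)
  \<comment> \<open>The part with SA is the negative of \<open>aplus0\<close>.\<close>
  have hp: "(\<lambda>n. sum_const K m * Hplus_term (- int K) m r \<tau> (N * Suc n)) sums (- main_const K m * (SA / fact (Suc K) + Z1))"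
    unfolding Hplus_term_lower [OF K(2) m c r] by (intro sums_mult sums_add sums_divide SA has_sum_imp_sums [OF Z1])
  have hm: "(\<lambda>n. sum_const K m * of_real ((4 * pi * Im \<tau>) ^ Suc K) * Hminus_term (- int K) m r \<tau> (N * Suc n)) sums (- (main_const K m * Z2))"
    unfolding Hminus_term_lower [OF K(2) m c r] by (intro sums_minus sums_mult has_sum_imp_sums [OF Z2])
  have nz: "sum_const K m \<noteq> 0" "sum_const K m * of_real ((4 * pi * Im \<tau>) ^ Suc K) \<noteq> 0"
    using sum_const_nonzero [OF m] \<tau> by auto
  show "Hconverges N (- int K) m r \<tau>"
    unfolding Hconverges_def
    using sa' summable_suminf_mult_left(1) [OF hp nz(1)] summable_suminf_mult_left(1) [OF hm nz(2)] phi_minus_lower(1) [OF K(2) r]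
    by blast
  have nat_eq: "nat (int K + 2 - 1) = Suc K" by simp
  have odd: "(- of_nat m) ^ Suc K = - (of_nat m ^ Suc K :: complex)"
    using K(2) by (subst power_minus_odd) auto
  have m0: "of_nat m \<noteq> (0 :: complex)" using m by simp
  \<comment> \<open>The exponent n = m contributes e(-m \<tau>), the q^(-m) of H+. The positive
    frequencies match Z1 after both Kloosterman arguments are negated.\<close>
  have E: "of_nat m ^ Suc K * eichler (Poinc N (int K + 2) (int m)) (int K + 2) (- \<tau>) = ee (- of_nat m * \<tau>) - main_const K m * Z1"
  proof -
    define h where "h n = ?I * kloosterman_bessel N (Suc K) (int m) 1 (- ?Y) (nat n) * ee (of_int n * - \<tau>)" for n
    have "h (int (Suc n)) = ?I * (exp_weight (- \<tau>) n * kloosterman_bessel N (Suc K) (- int m) (- 1) (- 4 * of_real pi ^ 2 * of_nat m) (Suc n))" for n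
      unfolding h_def exp_weight_def ee_of_nat_mult [symmetric] kloosterman_bessel_minus [OF N] nat_int by (simp add: mult_ac del: of_nat_Suc)
    then have h: "((\<lambda>n. h (int (Suc n))) has_sum (?I * Z1)) UNIV"
      using has_sum_cmult_right [OF Z1', of ?I] by (simp only:)
    have "eichler (Poinc N (int K + 2) (int m)) (int K + 2) (- \<tau>) =
      (\<Sum>\<^sub>\<infinity>n\<in>{n. n \<noteq> 0}. (if n = int m then ee (- of_nat m * \<tau>) / of_nat m ^ Suc K else 0) + (if n > 0 then h n else 0))"
      unfolding eichler_def nat_eq fourier_coeff_Poinc [OF N K]
      by (intro infsum_cong) (auto simp: h_def field_simps simp del: power_Suc)
    also have "\<dots> = ee (- of_nat m * \<tau>) / of_nat m ^ Suc K + ?I * Z1"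
      using m by (intro infsumI has_sum_nonzero_ints h) auto
    finally have "of_nat m ^ Suc K * eichler (Poinc N (int K + 2) (int m)) (int K + 2) (- \<tau>) =
        ee (- of_nat m * \<tau>) + of_nat m ^ Suc K * ?I * Z1"
      using m0 by (simp add: distrib_left del: power_Suc)
    then show ?thesis
      unfolding main_const_poincare(1) [OF K(2)] by simp
  qed
  \<comment> \<open>The exponent n = -m evaluates the incomplete gamma function at 4 \<pi> m Im
    \<tau> < 0, in its closed form. With (-m)^(K + 1) = - m^(K + 1), it yields the explicit gamma
    term of H-.\<close>
  have P: "of_nat m ^ Suc K * (of_real ((4 * pi) ^ Suc K / fact K) * nh_eichler (Poinc N (int K + 2) (- int m)) (int K + 2) (- \<tau>)) =
      of_real (ninc_gamma (Suc K) (4 * pi * real m * Im \<tau>)) * ee (- of_nat m * \<tau>) + main_const K m * Z2 / fact K"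
  proof -
    define h where "h n = ?I * kloosterman_bessel N (Suc K) (- int m) 1 ?Y (nat n) * of_real (inc_gamma (Suc K) (4 * pi * of_int n * Im (- \<tau>))) * ee (- of_int n * - \<tau>)" for n
    define g where "g = of_real (inc_gamma (Suc K) (4 * pi * real m * Im \<tau>)) * ee (- of_nat m * \<tau>)"
    have "h (int (Suc n)) = ?I * (gamma_weight K (- \<tau>) n * kloosterman_bessel N (Suc K) (- int m) 1 ?Y (Suc n))" for n
    proof -
      have "ee (- of_int (int (Suc n)) * - \<tau>) = inverse (ee (- \<tau>)) ^ Suc n"
        unfolding ee_minus inverse_inverse_eq ee_of_nat_mult [symmetric] by (simp del: of_nat_Suc)
      then show ?thesis
        unfolding h_def gamma_weight_def nat_int by (simp add: mult_ac del: of_nat_Suc power_Suc)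
    qed
    then have h: "((\<lambda>n. h (int (Suc n))) has_sum (?I * Z2)) UNIV"
      using has_sum_cmult_right [OF Z2', of ?I] by (simp only:)
    \<comment> \<open>An even power of an imaginary number; its reality is read off from
      \<open>main_const\<close>.\<close>
    have cI: "cnj ?I = ?I"
    proof -
      have "cnj (of_nat m ^ Suc K * ?I) = of_nat m ^ Suc K * ?I"
        unfolding main_const_poincare(1) [OF K(2)] by (simp add: main_const_def)
      then show ?thesis using m0 by simp
    qed
    have YY: "- 4 * of_real pi ^ 2 * of_int (- int m) = ?Y" by simp
    have ck: "cnj (kloosterman_bessel N (Suc K) (- int m) 1 ?Y n) = kloosterman_bessel N (Suc K) (- int m) 1 ?Y n" for n
      by (rule cnj_kloosterman_bessel [OF N]) simp
    have fc: "cnj (fourier_coeff (Poinc N (int K + 2) (- int m)) n) = (if n = - int m then 1 else 0) + (if n > 0 then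
       ?I * (of_int n ^ Suc K * kloosterman_bessel N (Suc K) (- int m) 1 ?Y (nat n)) else 0)" for n
    proof -
      let ?x = "of_int n ^ Suc K * kloosterman_bessel N (Suc K) (- int m) 1 ?Y (nat n)"
      have "cnj ?x = ?x" by (simp add: ck del: power_Suc)
      then have "cnj (?I * ?x) = ?I * ?x" by (simp only: complex_cnj_mult [of ?I ?x] cI)
      then show ?thesis
        unfolding fourier_coeff_Poinc [OF N K] YY
        by (cases "n = - int m"; cases "n > 0") (simp_all only: simp_thms if_True if_False complex_cnj_add complex_cnj_one complex_cnj_zero)
    qed
    have "(\<Sum>\<^sub>\<infinity>n\<in>{n::int. n \<noteq> 0}. cnj (fourier_coeff (Poinc N (int K + 2) (- int m)) n) / of_int n ^ Suc K
        * of_real (inc_gamma (Suc K) (4 * pi * of_int n * Im (- \<tau>))) * ee (- of_int n * - \<tau>)) =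
      (\<Sum>\<^sub>\<infinity>n\<in>{n. n \<noteq> 0}. (if n = - int m then - g / of_nat m ^ Suc K else 0) + (if n > 0 then h n else 0))"
    proof (rule infsum_cong)
      fix n :: int assume "n \<in> {n. n \<noteq> 0}"
      then have n0: "of_int n \<noteq> (0 :: complex)" by simp
      show "cnj (fourier_coeff (Poinc N (int K + 2) (- int m)) n) / of_int n ^ Suc K
        * of_real (inc_gamma (Suc K) (4 * pi * of_int n * Im (- \<tau>))) * ee (- of_int n * - \<tau>) =
        (if n = - int m then - g / of_nat m ^ Suc K else 0) + (if n > 0 then h n else 0)"
      proof (cases "n = - int m")
        case True
        then have "\<not> n > 0" "of_int n ^ Suc K = - (of_nat m ^ Suc K :: complex)" using m odd by auto
        then show ?thesis
          unfolding fc g_def using True by (simp del: power_Suc)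
      next
        case False
        then show ?thesis
          unfolding fc h_def using n0 by (simp del: power_Suc)
      qed
    qed
    also have "\<dots> = - g / of_nat m ^ Suc K + ?I * Z2"
      using m by (intro infsumI has_sum_nonzero_ints h) auto
    finally have "nh_eichler (Poinc N (int K + 2) (- int m)) (int K + 2) (- \<tau>) =
        - of_real ((4 * pi) powi (1 - (int K + 2))) * (- g / of_nat m ^ Suc K + ?I * Z2)"
      unfolding nh_eichler_def nat_eq by (simp only:)
    moreover have "(4 * pi) powi (1 - (int K + 2)) = 1 / (4 * pi) ^ Suc K"
    proof -
      have "1 - (int K + 2) = - int (Suc K)" by simp
      then show ?thesis by (simp only: power_int_minus power_int_of_nat inverse_eq_divide)
    qed
    ultimately have nh: "nh_eichler (Poinc N (int K + 2) (- int m)) (int K + 2) (- \<tau>) =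
        - of_real (1 / (4 * pi) ^ Suc K) * (- g / of_nat m ^ Suc K + ?I * Z2)"
      by (simp only:)
    have "M * (p / f * (- (1 / p) * (- g / M + J * Z))) = (g - (M * J) * Z) / f" if "M \<noteq> 0" "p \<noteq> 0" for M p f J Z :: complex
      using that by (simp add: divide_simps)
    from this [of "of_nat m ^ Suc K" "of_real ((4 * pi) ^ Suc K)" "fact K" ?I Z2]
    have "of_nat m ^ Suc K * (of_real ((4 * pi) ^ Suc K / fact K) * nh_eichler (Poinc N (int K + 2) (- int m)) (int K + 2) (- \<tau>)) =
        (g - (of_nat m ^ Suc K * ?I) * Z2) / fact K"
      unfolding nh using m0 by (simp del: power_Suc)
    then show ?thesis
      unfolding main_const_poincare(1) [OF K(2)] g_def ninc_gamma_def by (simp add: add_divide_distrib)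
  qed
  show "Hfun N (- int K) m r \<tau> = of_nat m ^ Suc K * (eichler (Poinc N (int K + 2) (int m)) (int K + 2) (- \<tau>)
       - of_real ((4 * pi) ^ Suc K / fact K) * nh_eichler (Poinc N (int K + 2) (- int m)) (int K + 2) (- \<tau>))"
    unfolding right_diff_distrib E P
    unfolding Hfun_def Hplus_split [OF K(2)] Hminus_split summable_suminf_mult_left(2) [OF hp nz(1)] summable_suminf_mult_left(2) [OF hm nz(2)]
      SA_def [symmetric]
    by (simp add: algebra_simps del: fact_Suc)
qed

text \<open>The radius may vary arbitrarily with \<tau> below 2 \<pi> |v|. For |s| \<le> r one has
  |Re s| < 2 \<pi> |v|, so this bound already keeps e^s q on the same side of the unit circle as
  q.\<close>

theorem theorem1p1:
  fixes N m :: nat and k :: int and r :: "complex \<Rightarrow> real"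
  assumes "N > 0" and "m > 0" and "k \<le> -2" and "even k"
    and "\<And>\<tau>. Im \<tau> \<noteq> 0 \<Longrightarrow> 0 < r \<tau> \<and> r \<tau> < 2 * pi * \<bar>Im \<tau>\<bar>"
  shows "(\<forall>\<tau>. Im \<tau> \<noteq> 0 \<longrightarrow> Hconverges N k m (r \<tau>) \<tau>)
       \<and> (\<forall>\<tau>. Im \<tau> > 0 \<longrightarrow> Hfun N k m (r \<tau>) \<tau> = MaassPoinc N k m \<tau>)
       \<and> (\<forall>\<tau>. Im \<tau> < 0 \<longrightarrow>
            Hfun N k m (r \<tau>) \<tau> =
              of_nat m ^ nat (1 - k) *
              (eichler (Poinc N (2 - k) (int m)) (2 - k) (- \<tau>)
               - of_real ((4 * pi) ^ nat (1 - k) / fact (nat (- k)))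
                 * nh_eichler (Poinc N (2 - k) (- int m)) (2 - k) (- \<tau>)))"
proof -
  define K where "K = nat (- k)"
  have k: "k = - int K" and K: "K \<ge> 2" using assms(3) by (auto simp: K_def)
  have "even K" using assms(4) unfolding k by simp
  have e: "nat (1 - k) = Suc K" "nat (- k) = K" "2 - k = int K + 2" using K by (auto simp: k)
  have r: "0 < r \<tau>" "r \<tau> < 2 * pi * Im \<tau>" if "Im \<tau> > 0" for \<tau>
    using assms(5) [of \<tau>] that by auto
  have r': "0 < r \<tau>" "r \<tau> < - (2 * pi * Im \<tau>)" if "Im \<tau> < 0" for \<tau>
    using assms(5) [of \<tau>] that by auto
  note up = H_upper [OF assms(1,2) K \<open>even K\<close> r] and low = H_lower [OF assms(1,2) K \<open>even K\<close> r']
  have "Hconverges N k m (r \<tau>) \<tau>" if "Im \<tau> \<noteq> 0" for \<tau>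
    using up(1) [of \<tau>] low(1) [of \<tau>] that unfolding k by linarith
  moreover have "Hfun N k m (r \<tau>) \<tau> = MaassPoinc N k m \<tau>" if "Im \<tau> > 0" for \<tau>
    using up(2) [OF that that] unfolding k .
  moreover have "Hfun N k m (r \<tau>) \<tau> = of_nat m ^ nat (1 - k) * (eichler (Poinc N (2 - k) (int m)) (2 - k) (- \<tau>)
       - of_real ((4 * pi) ^ nat (1 - k) / fact (nat (- k))) * nh_eichler (Poinc N (2 - k) (- int m)) (2 - k) (- \<tau>))"
    if "Im \<tau> < 0" for \<tau>
    unfolding e using low(2) [OF that that] unfolding k .
  ultimately show ?thesis by blast
qed

end
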